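(* Let $d,m\in\{1,2,\dots\}$, let $\mathbb{C}=(\mathbb{C}_{i\alpha}^{j\beta})_{i,j=1,\dots,m}^{\alpha,\beta=1,\dots,d}\in L^\infty(\mathbb{R}^d;\mathbb{R}^{m^2d^2})$, and define the bilinear form $a:\dot{H}^1\times\dot{H}^1\to\mathbb{R}$ by $$a(u,v):=\int_{\mathbb{R}^d}\mathbb{C}_{i\alpha}^{j\beta}\,\partial_\alpha u_i\,\partial_\beta v_j\,dx$$ (summation over repeated indices). Let $f\in L^1_{\rm loc}(\mathbb{R}^d;\mathbb{R}^m)$ be of the form $f=\mathrm{div}\,g$ in the sense of distributions for some $g\in L^2(\mathbb{R}^d;\mathbb{R}^{m\times d})$, and let $\ell$ be the bounded linear functional on $\dot{H}^1$ obtained by extending $$\ell([v]):=\int_{\mathbb{R}^d}f\cdot v^*\,dx,\qquad v^*\in[v],\ v^*\in\mathscr{D},\qquad [v]\in\dot{\mathscr{D}}.$$ Suppose that $a$ is coercive, that is, there is a constant $c_0>0$ such that $$a(u,u)\ge c_0\|\partial u\|_{L^2}^2\qquad\text{for all }u\in\dot{H}^1.$$ Then there exists a unique $u\in\dot{H}^1$ such that $$a(u,v)=\ell(v)\qquad\text{for all }v\in\mathscr{D}.$$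
   Context: All functions take values in $\mathbb{R}^m$. $\mathscr{D}=\mathscr{D}(\mathbb{R}^d;\mathbb{R}^m)$ is the space of $C^\infty$ functions with compact support. For a measurable $u:\mathbb{R}^d\to\mathbb{R}^m$, $[u]:=\{u+c\mid c\in\mathbb{R}^m\}$ is the equivalence class modulo additive constants, and $\dot{\mathscr{D}}:=\{[u]\mid u\in\mathscr{D}\}$. $\partial u$ is the distributional gradient. $\dot{H}^1:=\{[u]\mid u\in W^{1,2}_{\rm loc}(\mathbb{R}^d;\mathbb{R}^m),\ \partial u\in L^2\}$, a Hilbert space with inner product $(\partial\cdot,\partial\cdot)_{L^2}$ and norm $\|\partial u\|_{L^2}$. Brackets are dropped: $u\in\dot{H}^1$ means an arbitrary representative of a class; $a$ and $\ell$ depend only on the classes, and uniqueness is as an element of $\dot{H}^1$, i.e. up to additive constants. For $v\in\mathscr{D}$, $\ell(v)$ means $\ell([v])$. The divergence of $g$ is taken row-wise: $(\mathrm{div}\,g)_i=\partial_\alpha g_{i\alpha}$. *)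

theory Defs
  imports "HOL-Analysis.Analysis"
begin

primrec times_cont_diff ::
  "nat \<Rightarrow> ('a::euclidean_space \<Rightarrow> 'b::real_normed_vector) \<Rightarrow> bool" where
  "times_cont_diff 0 f \<longleftrightarrow> continuous_on UNIV f"
| "times_cont_diff (Suc k) f \<longleftrightarrow>
     (\<forall>x. f differentiable at x) \<and>
     (\<forall>h. times_cont_diff k (\<lambda>x. frechet_derivative f (at x) h))"

definition test_functions :: "('a::euclidean_space \<Rightarrow> 'b::real_normed_vector) set" where
  "test_functions = {\<phi>. (\<forall>k. times_cont_diff k \<phi>) \<and> compact (closure {x. \<phi> x \<noteq> 0})}"

definition partial_deriv :: "'d::finite \<Rightarrow> (real^'d \<Rightarrow> real) \<Rightarrow> real^'d \<Rightarrow> real" where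
  "partial_deriv \<alpha> \<phi> x = frechet_derivative \<phi> (at x) (axis \<alpha> 1)"

definition L1_loc :: "('a::euclidean_space \<Rightarrow> 'b::euclidean_space) set" where
  "L1_loc = {f \<in> borel_measurable lebesgue. \<forall>K. compact K \<longrightarrow> set_integrable lebesgue K f}"

definition L2 :: "('a::euclidean_space \<Rightarrow> 'b::euclidean_space) set" where
  "L2 = {f \<in> borel_measurable lebesgue. integrable lebesgue (\<lambda>x. (norm (f x))\<^sup>2)}"

definition L2_loc :: "('a::euclidean_space \<Rightarrow> 'b::euclidean_space) set" where
  "L2_loc = {f \<in> borel_measurable lebesgue.
     \<forall>K. compact K \<longrightarrow> set_integrable lebesgue K (\<lambda>x. (norm (f x))\<^sup>2)}"

definition L_infinity :: "('a::euclidean_space \<Rightarrow> 'b::euclidean_space) set" where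
  "L_infinity = {f \<in> borel_measurable lebesgue. \<exists>M. AE x in lebesgue. norm (f x) \<le> M}"

definition L2_norm :: "('a::euclidean_space \<Rightarrow> 'b::euclidean_space) \<Rightarrow> real" where
  "L2_norm f = sqrt (\<integral>x. (norm (f x))\<^sup>2 \<partial>lebesgue)"

(* G x $ i $ \<alpha> is the weak derivative of u_i in direction \<alpha>. *)
definition is_weak_gradient ::
  "(real^'d \<Rightarrow> real^'m) \<Rightarrow> (real^'d \<Rightarrow> real^'d^'m) \<Rightarrow> bool" where
  "is_weak_gradient u G \<longleftrightarrow> u \<in> L1_loc \<and> G \<in> L1_loc \<and>
     (\<forall>\<phi>\<in>test_functions. \<forall>i \<alpha>.
        (\<integral>x. u x $ i * partial_deriv \<alpha> \<phi> x \<partial>lebesgue) =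
        - (\<integral>x. G x $ i $ \<alpha> * \<phi> x \<partial>lebesgue))"

(* Weak gradients are unique only up to null sets, so this picks one of them;
   every use below is insensitive to the choice. *)
definition weak_gradient :: "(real^'d \<Rightarrow> real^'m) \<Rightarrow> real^'d \<Rightarrow> real^'d^'m" where
  "weak_gradient u = (SOME G. is_weak_gradient u G)"

definition W12_loc :: "(real^'d \<Rightarrow> real^'m) set" where
  "W12_loc = {u \<in> L2_loc. \<exists>G\<in>L2_loc. is_weak_gradient u G}"

(* f = div g in the sense of distributions, the divergence being taken row-wise. *)
definition is_weak_divergence ::
  "(real^'d \<Rightarrow> real^'m) \<Rightarrow> (real^'d \<Rightarrow> real^'d^'m) \<Rightarrow> bool" where
  "is_weak_divergence f g \<longleftrightarrow>
     (\<forall>\<phi>\<in>test_functions. \<forall>i.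
        (\<integral>x. f x $ i * \<phi> x \<partial>lebesgue) =
        - (\<integral>x. (\<Sum>\<alpha>\<in>UNIV. g x $ i $ \<alpha> * partial_deriv \<alpha> \<phi> x) \<partial>lebesgue))"

(* The class of u modulo additive constants.  Functions that agree almost everywhere are
   identified, so that the L2 norm of the gradient is a norm on classes. *)
definition const_class :: "(real^'d \<Rightarrow> real^'m) \<Rightarrow> (real^'d \<Rightarrow> real^'m) set" where
  "const_class u = {w. \<exists>c. AE x in lebesgue. w x = u x + c}"

definition D_dot :: "(real^'d \<Rightarrow> real^'m) set set" where
  "D_dot = const_class ` test_functions"

definition H1_dot :: "(real^'d \<Rightarrow> real^'m) set set" where
  "H1_dot = const_class ` {u \<in> W12_loc. weak_gradient u \<in> L2}"

definition class_gradient :: "(real^'d \<Rightarrow> real^'m) set \<Rightarrow> real^'d \<Rightarrow> real^'d^'m" where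
  "class_gradient U = weak_gradient (SOME u. u \<in> U)"

definition H1_dot_norm :: "(real^'d \<Rightarrow> real^'m) set \<Rightarrow> real" where
  "H1_dot_norm U = L2_norm (class_gradient U)"

(* C x $ i $ \<alpha> $ j $ \<beta> is the coefficient with lower indices i, \<alpha> and upper indices j, \<beta>. *)
definition bilinear_form ::
  "(real^'d \<Rightarrow> real^'d^'m^'d^'m) \<Rightarrow>
   (real^'d \<Rightarrow> real^'m) set \<Rightarrow> (real^'d \<Rightarrow> real^'m) set \<Rightarrow> real" where
  "bilinear_form C U V =
     (\<integral>x. (\<Sum>i\<in>UNIV. \<Sum>\<alpha>\<in>UNIV. \<Sum>j\<in>UNIV. \<Sum>\<beta>\<in>UNIV.
        C x $ i $ \<alpha> $ j $ \<beta> * class_gradient U x $ i $ \<alpha> * class_gradient V x $ j $ \<beta>)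
      \<partial>lebesgue)"

(* Linearity is stated through representatives: the vector space operations on classes are
   [u] + [w] = [u + w] and r [u] = [r u]. *)
definition bounded_linear_functional :: "((real^'d \<Rightarrow> real^'m) set \<Rightarrow> real) \<Rightarrow> bool" where
  "bounded_linear_functional L \<longleftrightarrow>
     (\<forall>u w. const_class u \<in> H1_dot \<longrightarrow> const_class w \<in> H1_dot \<longrightarrow>
        L (const_class (\<lambda>x. u x + w x)) = L (const_class u) + L (const_class w)) \<and>
     (\<forall>r u. const_class u \<in> H1_dot \<longrightarrow>
        L (const_class (\<lambda>x. r *\<^sub>R u x)) = r * L (const_class u)) \<and>
     (\<exists>M. \<forall>U\<in>H1_dot. \<bar>L U\<bar> \<le> M * H1_dot_norm U)"

(* The bounded linear functional on H1_dot that extends [v] \<mapsto> \<integral> f \<bullet> v*, where v* is a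
   test function in [v].  The requirement of being extensional only fixes the irrelevant values
   outside H1_dot, so that the description is unique; existence and uniqueness of the extension
   are not built into the definition. *)
definition functional_of ::
  "(real^'d \<Rightarrow> real^'m) \<Rightarrow> (real^'d \<Rightarrow> real^'m) set \<Rightarrow> real" where
  "functional_of f = (THE L. L \<in> extensional H1_dot \<and> bounded_linear_functional L \<and>
     (\<forall>V\<in>D_dot. \<forall>v\<in>V \<inter> test_functions. L V = (\<integral>x. f x \<bullet> v x \<partial>lebesgue)))"

definition coercive_form :: "((real^'d \<Rightarrow> real^'m) set \<Rightarrow> (real^'d \<Rightarrow> real^'m) set \<Rightarrow> real) \<Rightarrow> bool" where
  "coercive_form a \<longleftrightarrow> (\<exists>c\<^sub>0>0. \<forall>U\<in>H1_dot. a U U \<ge> c\<^sub>0 * (H1_dot_norm U)\<^sup>2)"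

end

theory Submission
  imports Defs
begin

text \<open>Passing to gradients turns the problem into the Lax--Milgram theorem on a closed subspace of
  \<open>L\<^sup>2\<close>, namely the closure \<open>S\<close> of the gradients of test functions; on it \<open>\<ell>\<close> is \<open>q \<mapsto> - \<langle>g, q\<rangle>\<close>. What has
  to be shown is that \<open>S\<close> is exactly the set of gradients of elements of \<open>H1_dot\<close>. By the Poincare
  inequality on balls, test functions whose gradients converge in \<open>L\<^sup>2\<close> converge in \<open>L\<^sup>2\<^sub>l\<^sub>o\<^sub>c\<close> after
  subtraction of means, so every element of \<open>S\<close> is a gradient. Conversely, the part of a gradient
  orthogonal to \<open>S\<close> is a square integrable gradient of a weakly harmonic function. Mollification
  makes the function smooth, and Caccioppoli's argument shows that its gradient vanishes.\<close>

section \<open>Smooth functions\<close>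

text \<open>Coercivity is known for gradients only, so the fixed point argument cannot run on all of
  \<open>L2\<close>, and on \<open>S\<close> it needs every element of \<open>S\<close> to be a
  gradient. The opposite inclusion is used twice: the difference of two solutions must lie in
  \<open>S\<close> to be tested with itself, and the description in \<open>functional_of\<close>
  denotes something only if a bounded linear functional on \<open>H1_dot\<close> is determined by
  its values on test functions.

  Cutting off an element u of \<open>H1_dot\<close> at scale n, after subtracting a mean c_n, does
  not give this density directly: the Poincare inequality on balls bounds the product of u - c_n
  with the gradient of the cutoff in \<open>L2\<close>, but does not make it small. For a weakly
  harmonic function the same product is paired with the gradient of that function, and the pairing
  does tend to zero. Hence the detour through orthogonality and a Liouville theorem. As nothing but
  the Poincare inequality on balls enters, all dimensions are treated alike.\<close>

definition smooth :: "('a::euclidean_space \<Rightarrow> 'b::real_normed_vector) \<Rightarrow> bool" where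
  "smooth f \<longleftrightarrow> (\<forall>k. times_cont_diff k f)"

abbreviation dderiv :: "'a::euclidean_space \<Rightarrow> ('a \<Rightarrow> 'b::real_normed_vector) \<Rightarrow> 'a \<Rightarrow> 'b" where
  "dderiv h f \<equiv> \<lambda>x. frechet_derivative f (at x) h"

lemma times_cont_diff_imp_continuous:
  "times_cont_diff k f \<Longrightarrow> continuous_on UNIV f"
proof (cases k)
  case (Suc n)
  then show "times_cont_diff k f \<Longrightarrow> continuous_on UNIV f"
    by (simp add: continuous_at_imp_continuous_on differentiable_imp_continuous_within)
qed simp

lemma times_cont_diff_SucD: "times_cont_diff (Suc k) f \<Longrightarrow> times_cont_diff k f"
proof (induction k arbitrary: f)
  case 0
  then show ?case using times_cont_diff_imp_continuous[OF 0] by simp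
next
  case (Suc k)
  then show ?case by (metis times_cont_diff.simps(2))
qed

lemma smooth_differentiable: "smooth f \<Longrightarrow> f differentiable at x"
  unfolding smooth_def by (metis times_cont_diff.simps(2))

lemma smooth_has_derivative: "smooth f \<Longrightarrow> (f has_derivative frechet_derivative f (at x)) (at x)"
  by (simp add: smooth_differentiable frechet_derivative_works[symmetric])

lemma smooth_linear: "smooth f \<Longrightarrow> linear (frechet_derivative f (at x))"
  by (rule has_derivative_linear[OF smooth_has_derivative])

lemma dderiv_Basis_sum:
  fixes f :: "'a::euclidean_space \<Rightarrow> real"
  assumes "smooth f"
  shows "dderiv h f x = (\<Sum>b\<in>Basis. (h \<bullet> b) * dderiv b f x)"
proof -
  have "dderiv h f x = dderiv (\<Sum>b\<in>Basis. (h \<bullet> b) *\<^sub>R b) f x"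
    by (simp only: euclidean_representation)
  then show ?thesis
    by (simp only: linear_sum[OF smooth_linear[OF assms]] linear_scale[OF smooth_linear[OF assms]]
        real_scaleR_def)
qed

lemma smooth_dderiv: "smooth f \<Longrightarrow> smooth (dderiv h f)"
  unfolding smooth_def by (metis times_cont_diff.simps(2))

lemma smooth_continuous: "smooth f \<Longrightarrow> continuous_on S f"
  unfolding smooth_def using times_cont_diff_imp_continuous continuous_on_subset by blast

text \<open>Replaces formulas for higher derivatives: an invariant that survives every directional
  derivative carries the induction on the order, with \<open>f\<close> generalised.\<close>

lemma smooth_coinduct:
  assumes "P f"
    and D: "\<And>f x. P f \<Longrightarrow> f differentiable at x"
    and S: "\<And>f h. P f \<Longrightarrow> P (dderiv h f)"
  shows "smooth f"
proof -
  have "times_cont_diff k f" if "P f" for k f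
    using that
  proof (induction k arbitrary: f)
    case 0
    then show ?case
      by (simp add: D continuous_at_imp_continuous_on differentiable_imp_continuous_within)
  next
    case (Suc k)
    then show ?case using D S by auto
  qed
  with \<open>P f\<close> show ?thesis by (auto simp: smooth_def)
qed

lemma dderiv_eq: "(\<And>x. (f has_derivative f' x) (at x)) \<Longrightarrow> dderiv h f = (\<lambda>x. f' x h)"
  by (intro ext) (metis frechet_derivative_at)

lemma smooth_const: "smooth (\<lambda>x. c)"
proof (rule smooth_coinduct[where P="\<lambda>f. \<exists>c. f = (\<lambda>x. c)"])
  show "\<exists>c. dderiv h f = (\<lambda>x. c)" if "\<exists>c. f = (\<lambda>x. c)" for f :: "'a \<Rightarrow> 'b" and h
    using that by (auto simp: frechet_derivative_const)
qed auto

lemma dderiv_bounded_linear: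
  assumes "bounded_linear L" "smooth f"
  shows "((\<lambda>x. L (f x)) has_derivative (\<lambda>h. L (frechet_derivative f (at x) h))) (at x)"
  using bounded_linear.has_derivative[OF assms(1) smooth_has_derivative[OF assms(2)]] .


lemma smooth_bounded_linear:
  fixes f :: "'a::euclidean_space \<Rightarrow> 'b::real_normed_vector" and L :: "'b \<Rightarrow> 'c::real_normed_vector"
  assumes L: "bounded_linear L" and f: "smooth f"
  shows "smooth (\<lambda>x. L (f x))"
proof (rule smooth_coinduct[where P="\<lambda>g. \<exists>f. smooth f \<and> g = (\<lambda>x. L (f x))"])
  show "\<exists>f'. smooth f' \<and> (\<lambda>x. L (f x)) = (\<lambda>x. L (f' x))"
    using f by blast
next
  fix g :: "'a \<Rightarrow> 'c" and x assume "\<exists>f. smooth f \<and> g = (\<lambda>x. L (f x))"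
  then show "g differentiable at x"
    using dderiv_bounded_linear[OF L] differentiableI by blast
next
  fix g :: "'a \<Rightarrow> 'c" and h assume "\<exists>f. smooth f \<and> g = (\<lambda>x. L (f x))"
  then obtain f where f: "smooth f" "g = (\<lambda>x. L (f x))" by blast
  then have "dderiv h g = (\<lambda>x. L (dderiv h f x))"
    using dderiv_eq[OF dderiv_bounded_linear[OF L]] by blast
  then show "\<exists>f. smooth f \<and> dderiv h g = (\<lambda>x. L (f x))"
    using smooth_dderiv[OF f(1)] by blast
qed

lemma times_cont_diff_add:
  "times_cont_diff k f \<Longrightarrow> times_cont_diff k g \<Longrightarrow> times_cont_diff k (\<lambda>x. f x + g x)"
proof (induction k arbitrary: f g)
  case (Suc k)
  have "dderiv h (\<lambda>x. f x + g x) = (\<lambda>x. dderiv h f x + dderiv h g x)" for h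
    using Suc.prems
    by (intro dderiv_eq has_derivative_add) (auto simp: frechet_derivative_works[symmetric])
  with Suc show ?case by auto
qed (auto intro: continuous_on_add)

lemma smooth_add: "smooth f \<Longrightarrow> smooth g \<Longrightarrow> smooth (\<lambda>x. f x + g x)"
  by (simp add: smooth_def times_cont_diff_add)

lemma dderiv_mult:
  fixes f g :: "'a::euclidean_space \<Rightarrow> real"
  assumes "smooth f" "smooth g"
  shows "((\<lambda>x. f x * g x) has_derivative
    (\<lambda>h. f x * frechet_derivative g (at x) h + frechet_derivative f (at x) h * g x)) (at x)"
  by (intro has_derivative_mult smooth_has_derivative assms)

text \<open>Products are not closed under differentiation, so an invariant is awkward here and the
  order is used instead. The Leibniz rule leaves one factor undifferentiated, which has to be
  lowered by one order with \<open>times_cont_diff_SucD\<close>.\<close>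

lemma times_cont_diff_mult:
  fixes f g :: "'a::euclidean_space \<Rightarrow> real"
  shows "times_cont_diff k f \<Longrightarrow> times_cont_diff k g \<Longrightarrow> times_cont_diff k (\<lambda>x. f x * g x)"
proof (induction k arbitrary: f g)
  case (Suc k)
  have "dderiv h (\<lambda>x. f x * g x) = (\<lambda>x. f x * dderiv h g x + dderiv h f x * g x)" for h
    using Suc.prems
    by (intro dderiv_eq has_derivative_mult) (auto simp: frechet_derivative_works[symmetric])
  moreover have "times_cont_diff k f" "times_cont_diff k g"
    using Suc.prems times_cont_diff_SucD by blast+
  ultimately show ?case using Suc
    by (auto intro!: times_cont_diff_add derivative_intros)
qed (auto intro: continuous_on_mult)

lemma smooth_mult:
  fixes f g :: "'a::euclidean_space \<Rightarrow> real"
  shows "smooth f \<Longrightarrow> smooth g \<Longrightarrow> smooth (\<lambda>x. f x * g x)"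
  by (simp add: smooth_def times_cont_diff_mult)

lemma smooth_prod:
  fixes f :: "'i \<Rightarrow> 'a::euclidean_space \<Rightarrow> real"
  shows "(\<And>i. i \<in> I \<Longrightarrow> smooth (f i)) \<Longrightarrow> smooth (\<lambda>x. \<Prod>i\<in>I. f i x)"
  by (induction I rule: infinite_finite_induct) (auto simp: smooth_const intro: smooth_mult)

lemma smooth_compose_affine:
  fixes f :: "'b::euclidean_space \<Rightarrow> 'c::real_normed_vector" and L :: "'a::euclidean_space \<Rightarrow> 'b"
  assumes f: "smooth f" and L: "bounded_linear L"
  shows "smooth (\<lambda>x. f (L x + a))"
proof (rule smooth_coinduct[where P="\<lambda>g. \<exists>f. smooth f \<and> g = (\<lambda>x. f (L x + a))"])
  have D: "((\<lambda>x. f (L x + a)) has_derivative (\<lambda>h. frechet_derivative f (at (L x + a)) (L h))) (at x)"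
    if "smooth f" for f :: "'b \<Rightarrow> 'c" and x
  proof -
    have "((\<lambda>x. L x + a) has_derivative L) (at x)"
      using has_derivative_add[OF bounded_linear_imp_has_derivative[OF L] has_derivative_const[of a]]
      by simp
    from has_derivative_compose[OF this smooth_has_derivative[OF that]] show ?thesis .
  qed
  show "\<exists>f'. smooth f' \<and> (\<lambda>x. f (L x + a)) = (\<lambda>x. f' (L x + a))"
    using f by blast
  show "g differentiable at x" if "\<exists>f. smooth f \<and> g = (\<lambda>x. f (L x + a))" for g :: "'a \<Rightarrow> 'c" and x
    using that D differentiableI by blast
  show "\<exists>f. smooth f \<and> dderiv h g = (\<lambda>x. f (L x + a))"
    if ex: "\<exists>f. smooth f \<and> g = (\<lambda>x. f (L x + a))" for g :: "'a \<Rightarrow> 'c" and h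
  proof -
    obtain f :: "'b \<Rightarrow> 'c" where f: "smooth f" "g = (\<lambda>x. f (L x + a))" using ex by blast
    then have "dderiv h g = (\<lambda>x. dderiv (L h) f (L x + a))"
      using dderiv_eq[OF D] by blast
    then show ?thesis using smooth_dderiv[OF f(1)] by blast
  qed
qed

subsection \<open>Test functions\<close>

lemma test_functions_iff:
  "\<phi> \<in> test_functions \<longleftrightarrow> smooth \<phi> \<and> bounded {x. \<phi> x \<noteq> 0}"
  by (simp add: test_functions_def smooth_def compact_closure)

lemma test_smooth: "\<phi> \<in> test_functions \<Longrightarrow> smooth \<phi>"
  by (simp add: test_functions_iff)

lemma test_support:
  assumes "\<phi> \<in> test_functions"
  obtains r where "r > 0" "\<And>x. norm x > r \<Longrightarrow> \<phi> x = 0"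
proof -
  obtain b where "b > 0" "\<forall>x\<in>{x. \<phi> x \<noteq> 0}. norm x \<le> b"
    using assms by (auto simp: test_functions_iff bounded_pos)
  then show ?thesis using that[of b] by force
qed

lemma test_functionsI:
  assumes "smooth \<phi>" "\<And>x. norm x > r \<Longrightarrow> \<phi> x = 0"
  shows "\<phi> \<in> test_functions"
proof -
  have "{x. \<phi> x \<noteq> 0} \<subseteq> cball 0 r" using assms(2) by (auto simp: not_less[symmetric])
  then show ?thesis
    using assms(1) bounded_subset[OF bounded_cball] by (auto simp: test_functions_iff)
qed

lemma dderiv_zero_outside:
  assumes "\<And>x. norm x > r \<Longrightarrow> \<phi> x = 0" "norm x > r"
  shows "dderiv h \<phi> x = 0"
proof -
  have "open {x::'a. norm x > r}"
    by (intro open_Collect_less continuous_intros)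
  then have "(\<phi> has_derivative (\<lambda>_. 0)) (at x)"
    by (intro has_derivative_transform_within_open[OF has_derivative_const[of 0]]) (use assms in auto)
  then show ?thesis by (metis frechet_derivative_at)
qed

lemma test_dderiv: "\<phi> \<in> test_functions \<Longrightarrow> dderiv h \<phi> \<in> test_functions"
proof -
  assume \<phi>: "\<phi> \<in> test_functions"
  then obtain r where "r > 0" "\<And>x. norm x > r \<Longrightarrow> \<phi> x = 0"
    using test_support[OF \<phi>] by blast
  then show ?thesis
    by (intro test_functionsI[of _ r] smooth_dderiv test_smooth[OF \<phi>] dderiv_zero_outside)
qed

lemma test_bounded_linear:
  assumes L: "bounded_linear L" and "\<phi> \<in> test_functions"
  shows "(\<lambda>x. L (\<phi> x)) \<in> test_functions"
proof -
  obtain r where "r > 0" "\<And>x. norm x > r \<Longrightarrow> \<phi> x = 0"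
    using test_support[OF assms(2)] by blast
  then show ?thesis
    using smooth_bounded_linear[OF L test_smooth[OF assms(2)]]
    by (intro test_functionsI[of _ r]) (auto simp: linear_0 bounded_linear.linear[OF L])
qed

lemma test_add:
  assumes "\<phi> \<in> test_functions" "\<psi> \<in> test_functions"
  shows "(\<lambda>x. \<phi> x + \<psi> x) \<in> test_functions"
proof -
  obtain r where r: "r > 0" "\<And>x. norm x > r \<Longrightarrow> \<phi> x = 0"
    using test_support[OF assms(1)] by blast
  obtain s where s: "s > 0" "\<And>x. norm x > s \<Longrightarrow> \<psi> x = 0"
    using test_support[OF assms(2)] by blast
  show ?thesis
    using assms r s by (intro test_functionsI[of _ "max r s"]) (auto intro: smooth_add test_smooth)
qed

lemma test_mult:
  fixes \<phi> \<psi> :: "'a::euclidean_space \<Rightarrow> real"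
  assumes "\<phi> \<in> test_functions" "smooth \<psi>"
  shows "(\<lambda>x. \<phi> x * \<psi> x) \<in> test_functions"
proof -
  obtain r where r: "r > 0" "\<And>x. norm x > r \<Longrightarrow> \<phi> x = 0"
    using test_support[OF assms(1)] by blast
  then show ?thesis
    using assms by (intro test_functionsI[of _ r]) (auto intro: smooth_mult test_smooth)
qed

lemma test_bounded:
  assumes "\<phi> \<in> test_functions"
  obtains B where "B > 0" "\<And>x. norm (\<phi> x) \<le> B"
proof -
  obtain r where r: "r > 0" "\<And>x. norm x > r \<Longrightarrow> \<phi> x = 0"
    using test_support[OF assms] by blast
  have "compact (\<phi> ` cball 0 r)"
    by (intro compact_continuous_image smooth_continuous test_smooth assms compact_cball)
  then obtain B where B: "B > 0" "\<forall>y\<in>\<phi> ` cball 0 r. norm y \<le> B"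
    using compact_imp_bounded bounded_pos by metis
  have "norm (\<phi> x) \<le> B" for x
    using B r(2)[of x] by (cases "norm x \<le> r") auto
  with B(1) show ?thesis using that by blast
qed

subsection \<open>Bump functions\<close>

text \<open>The functions \<open>p(1/s) exp(-1/s)\<close>, extended by zero to \<open>s \<le> 0\<close>, form a family that is
  closed under differentiation, which makes their smoothness a coinduction.\<close>

definition exp_inv_poly :: "real poly \<Rightarrow> real \<Rightarrow> real" where
  "exp_inv_poly p s = (if s > 0 then poly p (1 / s) * exp (- (1 / s)) else 0)"

lemma poly_exp_tendsto_0: "((\<lambda>x::real. poly p x * exp (- x)) \<longlongrightarrow> 0) at_top"
proof -
  have "((\<lambda>x::real. \<Sum>i\<le>degree p. coeff p i * (x ^ i / exp x)) \<longlongrightarrow> (\<Sum>i\<le>degree p. coeff p i * 0)) at_top"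
    by (intro tendsto_sum tendsto_mult tendsto_const tendsto_power_div_exp_0)
  moreover have "(\<lambda>x::real. \<Sum>i\<le>degree p. coeff p i * (x ^ i / exp x)) = (\<lambda>x. poly p x * exp (- x))"
    by (simp add: poly_altdef sum_divide_distrib exp_minus divide_inverse mult.assoc sum_distrib_right)
  ultimately show ?thesis by simp
qed

text \<open>With t = 1/s one has d/ds = - t^2 d/dt, so p(t) exp(-t) has the derivative t^2 (p(t) -
  p'(t)) exp(-t). This is where the polynomial on the right comes from. Only s = 0 needs a
  limit.\<close>

lemma exp_inv_poly_has_derivative:
  "(exp_inv_poly p has_real_derivative exp_inv_poly ([:0, 0, 1:] * (p - pderiv p)) s) (at s)"
proof -
  consider "s > 0" | "s < 0" | "s = 0" by linarith
  then show ?thesis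
  proof cases
    case 1
    have "((\<lambda>s. poly p (1 / s) * exp (- (1 / s))) has_real_derivative
        exp_inv_poly ([:0, 0, 1:] * (p - pderiv p)) s) (at s)"
      using 1 unfolding exp_inv_poly_def
      by (auto intro!: derivative_eq_intros simp: field_simps power2_eq_square)
    then show ?thesis
      by (rule DERIV_cong_ev[THEN iffD1, OF refl _ refl, rotated])
        (use 1 in \<open>auto simp: exp_inv_poly_def eventually_nhds intro!: exI[of _ "{0<..}"]\<close>)
  next
    case 2
    have "((\<lambda>s. 0) has_real_derivative exp_inv_poly ([:0, 0, 1:] * (p - pderiv p)) s) (at s)"
      using 2 unfolding exp_inv_poly_def by simp
    then show ?thesis
      by (rule DERIV_cong_ev[THEN iffD1, OF refl _ refl, rotated])
        (use 2 in \<open>auto simp: exp_inv_poly_def eventually_nhds intro!: exI[of _ "{..<0}"]\<close>)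
  next
    case 3
    \<comment> \<open>Dividing by h multiplies the polynomial in 1/h by its variable, so the
      difference quotient at 0 from the right is again polynomial times exponential.\<close>
    have "((\<lambda>h. poly ([:0, 1:] * p) (1 / h) * exp (- (1 / h))) \<longlongrightarrow> 0) (at_right 0)"
      using filterlim_compose[OF poly_exp_tendsto_0 filterlim_inverse_at_top_right, of "[:0, 1:] * p"]
      by (simp add: inverse_eq_divide)
    then have "((\<lambda>h. exp_inv_poly p h / h) \<longlongrightarrow> 0) (at_right 0)"
      by (rule Lim_transform_eventually)
        (auto simp: eventually_at_right_field exp_inv_poly_def intro!: exI[of _ 1])
    moreover have "((\<lambda>h. exp_inv_poly p h / h) \<longlongrightarrow> 0) (at_left 0)"
      by (rule Lim_transform_eventually[OF tendsto_const])
        (auto simp: eventually_at_left_field exp_inv_poly_def intro!: exI[of _ "-1"])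
    ultimately have "((\<lambda>h. exp_inv_poly p h / h) \<longlongrightarrow> 0) (at 0)"
      by (simp add: filterlim_at_split)
    with 3 show ?thesis by (simp add: DERIV_def exp_inv_poly_def)
  qed
qed

lemma smooth_exp_inv_poly: "smooth (exp_inv_poly p)"
\<comment> \<open>The factor \<open>c\<close> absorbs the direction: on the real line
  \<open>dderiv h\<close> is h times the ordinary derivative.\<close>
proof (rule smooth_coinduct[where P="\<lambda>f. \<exists>p c. f = (\<lambda>s. c * exp_inv_poly p s)"])
  have D: "((\<lambda>s. c * exp_inv_poly p s) has_derivative
      (\<lambda>h. c * (exp_inv_poly ([:0, 0, 1:] * (p - pderiv p)) s * h))) (at s)" for c p s
    using exp_inv_poly_has_derivative[of p s]
    by (intro has_derivative_mult_right) (simp add: has_field_derivative_def)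
  show "\<exists>q c. exp_inv_poly p = (\<lambda>s. c * exp_inv_poly q s)"
    by (rule exI[of _ p], rule exI[of _ 1]) simp
  show "f differentiable at x" if "\<exists>p c. f = (\<lambda>s. c * exp_inv_poly p s)" for f x
    using that D differentiableI by blast
  show "\<exists>p c. dderiv h f = (\<lambda>s. c * exp_inv_poly p s)"
    if ex: "\<exists>p c. f = (\<lambda>s. c * exp_inv_poly p s)" for f and h
  proof -
    obtain p c where "f = (\<lambda>s. c * exp_inv_poly p s)" using ex by blast
    then have "dderiv h f = (\<lambda>s. (c * h) * exp_inv_poly ([:0, 0, 1:] * (p - pderiv p)) s)"
      using dderiv_eq[OF D] by (simp add: mult_ac)
    then show ?thesis by blast
  qed
qed

text \<open>Positive exactly on the open box when n > 0. The parameter \<open>n\<close> only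
  sharpens it: on the box each factor is exp(-1/(n s)) with s > 0, which tends to 1. This gives
  smooth approximations of box indicators from below without any mollification.\<close>

definition box_bump :: "real \<Rightarrow> 'a::euclidean_space \<Rightarrow> 'a \<Rightarrow> 'a \<Rightarrow> real" where
  "box_bump n a b x =
    (\<Prod>i\<in>Basis. exp_inv_poly 1 (n * (x \<bullet> i - a \<bullet> i)) * exp_inv_poly 1 (n * (b \<bullet> i - x \<bullet> i)))"

lemma exp_inv_poly_1_bounds: "0 \<le> exp_inv_poly 1 s" "exp_inv_poly 1 s \<le> 1"
  by (auto simp: exp_inv_poly_def)

lemma box_bump_bounds: "0 \<le> box_bump n a b x" "box_bump n a b x \<le> 1"
  unfolding box_bump_def
  by (auto intro!: prod_nonneg prod_le_1 mult_nonneg_nonneg mult_le_one exp_inv_poly_1_bounds)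

lemma box_bump_zero: "n > 0 \<Longrightarrow> x \<notin> box a b \<Longrightarrow> box_bump n a b x = 0"
  unfolding box_bump_def mem_box
  by (rule prod_zero) (auto simp: exp_inv_poly_def zero_less_mult_iff)

lemma smooth_box_bump: "smooth (box_bump n a b)"
proof -
  have "smooth (\<lambda>x. exp_inv_poly 1 (n *\<^sub>R (x \<bullet> i) + (- n * (a \<bullet> i))))" for i
    by (rule smooth_compose_affine[OF smooth_exp_inv_poly, of "\<lambda>x. n *\<^sub>R (x \<bullet> i)"])
      (intro bounded_linear_intros)
  moreover have "smooth (\<lambda>x. exp_inv_poly 1 ((- n) *\<^sub>R (x \<bullet> i) + n * (b \<bullet> i)))" for i
    by (rule smooth_compose_affine[OF smooth_exp_inv_poly, of "\<lambda>x. (- n) *\<^sub>R (x \<bullet> i)"])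
      (intro bounded_linear_intros)
  ultimately have "smooth (\<lambda>x. \<Prod>i\<in>Basis. exp_inv_poly 1 (n *\<^sub>R (x \<bullet> i) + (- n * (a \<bullet> i))) *
     exp_inv_poly 1 ((- n) *\<^sub>R (x \<bullet> i) + n * (b \<bullet> i)))"
    by (intro smooth_prod smooth_mult)
  then show ?thesis
    by (rule back_subst[of smooth]) (auto simp: box_bump_def fun_eq_iff algebra_simps)
qed

lemma test_box_bump: "n > 0 \<Longrightarrow> box_bump n a b \<in> test_functions"
proof -
  assume n: "n > 0"
  have "{x. box_bump n a b x \<noteq> 0} \<subseteq> box a b" using box_bump_zero[OF n] by blast
  then show ?thesis
    using smooth_box_bump bounded_subset[OF bounded_box] by (auto simp: test_functions_iff)
qed

lemma box_bump_tendsto_indicator: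
  "(\<lambda>n. box_bump (real (Suc n)) a b x) \<longlonglongrightarrow> indicator (box a b) x"
proof (cases "x \<in> box a b")
  case True
  have *: "(\<lambda>n. exp_inv_poly 1 (real (Suc n) * s)) \<longlonglongrightarrow> 1" if "s > 0" for s
  proof -
    have "(\<lambda>n. exp (- (1 / s) * inverse (real (Suc n)))) \<longlonglongrightarrow> exp (- (1 / s) * 0)"
      by (intro tendsto_intros LIMSEQ_inverse_real_of_nat)
    moreover have "(\<lambda>n. exp (- (1 / s) * inverse (real (Suc n)))) = (\<lambda>n. exp_inv_poly 1 (real (Suc n) * s))"
      using that by (intro ext) (simp add: exp_inv_poly_def zero_less_mult_iff inverse_eq_divide)
    ultimately show ?thesis by simp
  qed
  have "(\<lambda>n. box_bump (real (Suc n)) a b x) \<longlonglongrightarrow> (\<Prod>i\<in>(Basis::'a set). 1 * 1)"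
    unfolding box_bump_def
    by (intro tendsto_prod tendsto_mult *) (use True in \<open>auto simp: mem_box\<close>)
  with True show ?thesis by simp
next
  case False
  then show ?thesis by (simp add: box_bump_zero)
qed

text \<open>By symmetry the gradient vanishes at the centre; this is all that the cutoff argument in the
  Liouville theorem needs.\<close>

lemma ex_centred_bump:
  obtains \<eta> :: "'a::euclidean_space \<Rightarrow> real" where "\<eta> \<in> test_functions" "\<eta> 0 = 1"
    "\<And>h. dderiv h \<eta> 0 = 0"
proof -
  define b :: "'a \<Rightarrow> real" where "b = box_bump 1 (- One) One"
  have b: "b \<in> test_functions" unfolding b_def by (rule test_box_bump) simp
  have b0: "b 0 \<noteq> 0" by (auto simp: b_def box_bump_def exp_inv_poly_def)
  \<comment> \<open>Reflection exchanges the two factors belonging to each coordinate. An even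
    function has an even derivative map at 0, which is also odd by linearity, hence zero.\<close>
  have sym: "b (- x) = b x" for x
    unfolding b_def box_bump_def by (intro prod.cong refl) (simp add: mult.commute add.commute)
  have D: "(b has_derivative frechet_derivative b (at 0)) (at 0)"
    by (intro smooth_has_derivative test_smooth b)
  have m: "(uminus has_derivative uminus) (at (0::'a))"
    by (intro has_derivative_minus has_derivative_ident)
  have "((\<lambda>x. b (- x)) has_derivative (\<lambda>h. frechet_derivative b (at 0) (- h))) (at 0)"
    using has_derivative_compose[OF m, of b "frechet_derivative b (at 0)"] D by simp
  then have "(b has_derivative (\<lambda>h. frechet_derivative b (at 0) (- h))) (at 0)"
    by (simp only: sym)
  then have *: "frechet_derivative b (at 0) = (\<lambda>h. frechet_derivative b (at 0) (- h))"
    by (rule has_derivative_unique[OF D])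
  have b': "dderiv h b 0 = 0" for h
    using linear_neg[OF has_derivative_linear[OF D], of h] fun_cong[OF *, of h] by linarith
  have L: "bounded_linear (\<lambda>t. t / b 0)" by (rule bounded_linear_divide)
  define \<eta> where "\<eta> = (\<lambda>x. b x / b 0)"
  have "\<eta> \<in> test_functions" unfolding \<eta>_def by (rule test_bounded_linear[OF L b])
  moreover have "\<eta> 0 = 1" using b0 by (simp add: \<eta>_def)
  moreover have "dderiv h \<eta> 0 = 0" for h
  proof -
    have "dderiv h \<eta> = (\<lambda>x. dderiv h b x / b 0)"
      unfolding \<eta>_def by (rule dderiv_eq[OF dderiv_bounded_linear[OF L test_smooth[OF b]]])
    from fun_cong[OF this, of 0] show ?thesis using b'[of h] by simp
  qed
  ultimately show ?thesis by (rule that)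
qed

section \<open>Hilbert spaces\<close>

text \<open>A sequence minimising the distance to \<open>S\<close> is Cauchy by the parallelogram
  law, because midpoints stay in \<open>S\<close>. Orthogonality is the first variation at the
  minimiser.\<close>

lemma closed_subspace_projection:
  fixes S :: "'h::{real_inner,complete_space} set"
  assumes S: "subspace S" and cl: "closed S"
  obtains p where "p \<in> S" "\<And>q. q \<in> S \<Longrightarrow> (x - p) \<bullet> q = 0"
proof -
  define D where "D = (INF q\<in>S. (norm (x - q))\<^sup>2)"
  have bdd: "bdd_below ((\<lambda>q. (norm (x - q))\<^sup>2) ` S)"
    by (rule bdd_belowI[of _ 0]) auto
  have ne: "S \<noteq> {}" using S subspace_0 by blast
  have D_le: "D \<le> (norm (x - q))\<^sup>2" if "q \<in> S" for q
    unfolding D_def by (rule cINF_lower[OF bdd that])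
  have "\<exists>q\<in>S. (norm (x - q))\<^sup>2 < D + inverse (real (Suc n))" for n
    using cINF_less_iff[OF ne bdd, of "D + inverse (real (Suc n))"] by (simp add: D_def)
  then obtain q where q: "q n \<in> S" "(norm (x - q n))\<^sup>2 < D + inverse (real (Suc n))" for n
    by metis
  \<comment> \<open>The squared distance from x to the midpoint is at least D, so the parallelogram
    law leaves only the two excesses over D for the difference.\<close>
  have par: "(norm (q n - q m))\<^sup>2 \<le> 2 * inverse (real (Suc n)) + 2 * inverse (real (Suc m))" for n m
  proof -
    have "(1/2) *\<^sub>R (q n + q m) \<in> S"
      by (intro subspace_scale subspace_add S q)
    from D_le[OF this] have "4 * D \<le> (norm (2 *\<^sub>R (x - (1/2) *\<^sub>R (q n + q m))))\<^sup>2"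
      by (simp only: norm_scaleR power_mult_distrib) simp
    moreover have "(norm (2 *\<^sub>R (x - (1/2) *\<^sub>R (q n + q m))))\<^sup>2 + (norm (q n - q m))\<^sup>2
        = 2 * (norm (x - q n))\<^sup>2 + 2 * (norm (x - q m))\<^sup>2"
      by (simp add: power2_norm_eq_inner inner_simps algebra_simps inner_commute)
    ultimately show ?thesis using q(2)[of n] q(2)[of m] by linarith
  qed
  have "Cauchy q"
  proof (rule metric_CauchyI)
    fix e :: real assume "e > 0"
    then have "e\<^sup>2 / 4 > 0" by simp
    then obtain N where N: "inverse (real (Suc N)) < e\<^sup>2 / 4"
      using reals_Archimedean by blast
    have "dist (q m) (q n) < e" if "N \<le> m" "N \<le> n" for m n
    proof -
      have "inverse (real (Suc m)) \<le> inverse (real (Suc N))" "inverse (real (Suc n)) \<le> inverse (real (Suc N))"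
        using that by (auto intro!: le_imp_inverse_le)
      with par[of m n] N have "(norm (q m - q n))\<^sup>2 < e\<^sup>2" by linarith
      then show ?thesis using \<open>e > 0\<close> by (simp add: dist_norm power2_less_imp_less)
    qed
    then show "\<exists>M. \<forall>m\<ge>M. \<forall>n\<ge>M. dist (q m) (q n) < e" by blast
  qed
  then obtain p where lim: "q \<longlonglongrightarrow> p"
    using Cauchy_convergent convergent_def by blast
  have "p \<in> S" using closed_sequentially[OF cl q(1) lim] .
  have "(norm (x - p))\<^sup>2 \<le> D + 0"
  proof (rule LIMSEQ_le)
    show "(\<lambda>n. (norm (x - q n))\<^sup>2) \<longlonglongrightarrow> (norm (x - p))\<^sup>2"
      by (intro tendsto_intros lim)
    show "(\<lambda>n. D + inverse (real (Suc n))) \<longlonglongrightarrow> D + 0"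
      by (intro tendsto_intros LIMSEQ_inverse_real_of_nat)
    show "\<exists>N. \<forall>n\<ge>N. (norm (x - q n))\<^sup>2 \<le> D + inverse (real (Suc n))"
      using q(2) less_imp_le by blast
  qed
  then have min: "(norm (x - p))\<^sup>2 \<le> (norm (x - r))\<^sup>2" if "r \<in> S" for r
    using D_le[OF that] by linarith
  have "(x - p) \<bullet> r = 0" if r: "r \<in> S" for r
  proof (cases "r = 0")
    case False
    \<comment> \<open>This t minimises the quadratic polynomial t -> |x - p - t r|^2. Any nonzero
      inner product would make its value smaller than at t = 0.\<close>
    define t where "t = ((x - p) \<bullet> r) / (r \<bullet> r)"
    have rr: "r \<bullet> r > 0" using False by simp
    have "(norm (x - p))\<^sup>2 \<le> (norm (x - (p + t *\<^sub>R r)))\<^sup>2"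
      by (intro min subspace_add subspace_scale S \<open>p \<in> S\<close> r)
    also have "\<dots> = (norm (x - p))\<^sup>2 - 2 * t * ((x - p) \<bullet> r) + t * t * (r \<bullet> r)"
      by (simp add: power2_norm_eq_inner inner_simps algebra_simps inner_commute)
    also have "\<dots> = (norm (x - p))\<^sup>2 - ((x - p) \<bullet> r)\<^sup>2 / (r \<bullet> r)"
      using rr by (simp add: t_def power2_eq_square)
    finally have "((x - p) \<bullet> r)\<^sup>2 / (r \<bullet> r) \<le> 0" by simp
    then show ?thesis using rr by (simp add: divide_le_0_iff)
  qed simp
  with \<open>p \<in> S\<close> show ?thesis using that by blast
qed

text \<open>The solution is the fixed point of the contraction \<open>p \<mapsto> p - \<rho> P (A p - b)\<close>, where \<open>P\<close> is
  the orthogonal projection onto \<open>S\<close>.\<close>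

lemma Lax_Milgram:
  fixes A :: "'h::{real_inner,complete_space} \<Rightarrow> 'h"
  assumes A: "bounded_linear A" and S: "subspace S" and cl: "closed S"
    and c: "c > 0" "\<And>p. p \<in> S \<Longrightarrow> A p \<bullet> p \<ge> c * (norm p)\<^sup>2"
  obtains p where "p \<in> S" "\<And>q. q \<in> S \<Longrightarrow> A p \<bullet> q = b \<bullet> q"
proof -
  interpret A: bounded_linear A by fact
  obtain K where K: "K > 0" "\<And>x. norm (A x) \<le> norm x * K"
    using A.pos_bounded by blast
  \<comment> \<open>The maximum guarantees \<open>c \<le> M\<close>, so that the contraction factor
    below is the root of a nonnegative number.\<close>
  define M where "M = max K c"
  have M: "M > 0" "c \<le> M" using K(1) by (auto simp: M_def)
  have AM: "norm (A x) \<le> M * norm x" for x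
  proof -
    have "norm x * K \<le> norm x * M" by (intro mult_left_mono) (auto simp: M_def)
    then show ?thesis using K(2)[of x] by (simp add: mult.commute)
  qed
  have "\<exists>p. p \<in> S \<and> (\<forall>q\<in>S. (x - p) \<bullet> q = 0)" for x
    by (rule closed_subspace_projection[OF S cl, of x]) auto
  then obtain P where P: "P x \<in> S" "\<And>q. q \<in> S \<Longrightarrow> (x - P x) \<bullet> q = 0" for x
    by metis
  \<comment> \<open>The minimiser of 1 - 2 \<rho> c + \<rho>^2 M^2, the factor that bounds the
    squared distance of two images; its minimum is 1 - c^2/M^2.\<close>
  define \<rho> where "\<rho> = c / M\<^sup>2"
  have \<rho>: "\<rho> > 0" using c M by (simp add: \<rho>_def)
  define T where "T p = p - \<rho> *\<^sub>R P (A p - b)" for p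
  define k where "k = sqrt (1 - c\<^sup>2 / M\<^sup>2)"
  have cM: "c\<^sup>2 / M\<^sup>2 \<le> 1" "c\<^sup>2 / M\<^sup>2 > 0"
    using c M by (auto simp: power_mono)
  have k: "0 \<le> k" "k < 1"
    using cM by (auto simp: k_def)
  have contr: "dist (T p) (T p') \<le> k * dist p p'" if "p \<in> S" "p' \<in> S" for p p'
  proof -
    define w where "w = p - p'"
    define r where "r = P (A p - b) - P (A p' - b)"
    have wS: "w \<in> S" and rS: "r \<in> S"
      using that P S by (auto simp: w_def r_def intro: subspace_diff)
    have rq: "r \<bullet> q = A w \<bullet> q" if "q \<in> S" for q
      using P(2)[OF that, of "A p - b"] P(2)[OF that, of "A p' - b"]
      by (simp add: r_def w_def inner_simps A.diff)
    \<comment> \<open>\<open>r\<close> is the projection of \<open>A w\<close>, and testing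
      \<open>rq\<close> with \<open>r\<close> itself shows that projecting does not increase the
      norm.\<close>
    have "(norm r)\<^sup>2 \<le> norm (A w) * norm r"
      unfolding power2_norm_eq_inner rq[OF rS] by (rule norm_cauchy_schwarz)
    then have "norm r \<le> norm (A w)"
      by (cases "r = 0") (auto simp: power2_eq_square)
    then have rM: "norm r \<le> M * norm w" using AM[of w] by linarith
    then have "(norm r)\<^sup>2 \<le> (M * norm w)\<^sup>2" by (intro power_mono) auto
    have "(norm (w - \<rho> *\<^sub>R r))\<^sup>2 = (norm w)\<^sup>2 - 2 * \<rho> * (r \<bullet> w) + \<rho>\<^sup>2 * (norm r)\<^sup>2"
      unfolding power2_norm_eq_inner power2_eq_square[of \<rho>]
      by (simp add: inner_simps algebra_simps inner_commute)
    also have "\<dots> \<le> (norm w)\<^sup>2 - 2 * \<rho> * (c * (norm w)\<^sup>2) + \<rho>\<^sup>2 * (M * norm w)\<^sup>2"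
      using \<rho> c(2)[OF wS] rq[OF wS] \<open>(norm r)\<^sup>2 \<le> (M * norm w)\<^sup>2\<close>
      by (intro add_mono diff_mono mult_left_mono) auto
    also have "\<dots> = (1 - c\<^sup>2 / M\<^sup>2) * (norm w)\<^sup>2"
      using M(1) by (simp add: \<rho>_def power2_eq_square field_simps)
    also have "\<dots> = (k * norm w)\<^sup>2"
      using cM by (simp add: k_def power_mult_distrib)
    finally have "norm (w - \<rho> *\<^sub>R r) \<le> k * norm w"
      by (rule power2_le_imp_le) (use k in auto)
    moreover have "T p - T p' = w - \<rho> *\<^sub>R r"
      by (simp add: T_def w_def r_def algebra_simps)
    ultimately show ?thesis by (simp add: dist_norm w_def)
  qed
  have "T ` S \<subseteq> S"
    using P S by (auto simp: T_def intro!: subspace_diff subspace_scale)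
  moreover have "complete S" using cl by (simp add: complete_eq_closed)
  moreover have "S \<noteq> {}" using S subspace_0 by blast
  ultimately have "\<exists>!p. p \<in> S \<and> T p = p"
    using Banach_fix[of S k T] k contr by simp
  then obtain p where p: "p \<in> S" "T p = p" by auto
  then have "P (A p - b) = 0" using \<rho> by (simp add: T_def)
  then have "A p \<bullet> q = b \<bullet> q" if "q \<in> S" for q
    using P(2)[OF that, of "A p - b"] by (simp add: inner_simps)
  with p(1) show ?thesis using that by blast
qed

section \<open>The Hilbert space of square integrable functions\<close>

lemma L2_measurable: "f \<in> L2 \<Longrightarrow> f \<in> borel_measurable lebesgue"
  and L2_integrable: "f \<in> L2 \<Longrightarrow> integrable lebesgue (\<lambda>x. (norm (f x))\<^sup>2)"
  by (auto simp: L2_def)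

lemma L2_I:
  assumes "f \<in> borel_measurable lebesgue" "integrable lebesgue g"
    "AE x in lebesgue. (norm (f x))\<^sup>2 \<le> g x"
  shows "f \<in> L2"
proof -
  note [measurable] = assms(1)
  have "integrable lebesgue (\<lambda>x. (norm (f x))\<^sup>2)"
    by (rule Bochner_Integration.integrable_bound[OF assms(2)]) (use assms(3) in \<open>auto\<close>)
  with assms(1) show ?thesis by (simp add: L2_def)
qed

lemma L2_I_nn:
  assumes [measurable]: "f \<in> borel_measurable lebesgue"
    and "(\<integral>\<^sup>+x. ennreal ((norm (f x))\<^sup>2) \<partial>lebesgue) < \<infinity>"
  shows "f \<in> L2"
  using assms by (auto simp: L2_def intro!: integrableI_bounded)

lemma norm_add_power2_le: "(norm (a + b))\<^sup>2 \<le> 2 * (norm a)\<^sup>2 + 2 * (norm b)\<^sup>2"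
proof -
  have "(norm (a + b))\<^sup>2 \<le> (norm a + norm b)\<^sup>2"
    by (intro power_mono norm_triangle_ineq) auto
  also have "\<dots> \<le> 2 * (norm a)\<^sup>2 + 2 * (norm b)\<^sup>2"
    using sum_squares_bound[of "norm a" "norm b"] by (simp add: power2_sum)
  finally show ?thesis .
qed

lemma L2_add: "f \<in> L2 \<Longrightarrow> g \<in> L2 \<Longrightarrow> (\<lambda>x. f x + g x) \<in> L2"
  by (rule L2_I[where g="\<lambda>x. 2 * (norm (f x))\<^sup>2 + 2 * (norm (g x))\<^sup>2"])
    (auto simp: L2_def norm_add_power2_le)

lemma L2_bounded_linear:
  assumes L: "bounded_linear L" and f: "f \<in> L2"
  shows "(\<lambda>x. L (f x)) \<in> L2"
proof -
  obtain K where K: "K > 0" "\<And>x. norm (L x) \<le> norm x * K"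
    using bounded_linear.pos_bounded[OF L] by blast
  have [measurable]: "f \<in> borel_measurable lebesgue" using f by (simp add: L2_def)
  have "continuous_on UNIV L"
    by (simp add: linear_continuous_on L)
  then have [measurable]: "L \<in> borel_measurable borel" by (rule borel_measurable_continuous_onI)
  show ?thesis
  proof (rule L2_I[where g="\<lambda>x. K\<^sup>2 * (norm (f x))\<^sup>2"])
    show "AE x in lebesgue. (norm (L (f x)))\<^sup>2 \<le> K\<^sup>2 * (norm (f x))\<^sup>2"
      using power_mono[OF K(2), of _ 2] by (intro AE_I2) (simp add: power_mult_distrib mult.commute)
  qed (use L2_integrable[OF f] in auto)
qed

lemma L2_scaleR: "f \<in> L2 \<Longrightarrow> (\<lambda>x. r *\<^sub>R f x) \<in> L2"
  by (rule L2_bounded_linear[OF bounded_linear_scaleR_right])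

lemma L2_uminus: "f \<in> L2 \<Longrightarrow> (\<lambda>x. - f x) \<in> L2"
  using L2_scaleR[of f "-1"] by simp

lemma L2_diff: "f \<in> L2 \<Longrightarrow> g \<in> L2 \<Longrightarrow> (\<lambda>x. f x - g x) \<in> L2"
  using L2_add[OF _ L2_uminus, of f g] by simp

lemma L2_zero: "(\<lambda>x. 0) \<in> L2"
  by (simp add: L2_def)

lemma L2_cong_AE:
  assumes "f \<in> L2" "g \<in> borel_measurable lebesgue" "AE x in lebesgue. f x = g x"
  shows "g \<in> L2"
  by (rule L2_I[OF assms(2) L2_integrable[OF assms(1)]]) (use assms(3) in auto)

lemma L2_integrable_inner:
  assumes "f \<in> L2" "g \<in> L2"
  shows "integrable lebesgue (\<lambda>x. f x \<bullet> g x)"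
proof -
  note [measurable] = assms[THEN L2_measurable]
  show ?thesis
  proof (rule Bochner_Integration.integrable_bound)
    show "integrable lebesgue (\<lambda>x. (norm (f x))\<^sup>2 + (norm (g x))\<^sup>2)"
      using assms by (auto simp: L2_def)
    have "norm (f x \<bullet> g x) \<le> norm ((norm (f x))\<^sup>2 + (norm (g x))\<^sup>2)" for x
    proof -
      have "\<bar>f x \<bullet> g x\<bar> \<le> norm (f x) * norm (g x)" by (rule Cauchy_Schwarz_ineq2)
      also have "2 * (norm (f x) * norm (g x)) \<le> (norm (f x))\<^sup>2 + (norm (g x))\<^sup>2"
        using sum_squares_bound[of "norm (f x)" "norm (g x)"] by simp
      then have "norm (f x) * norm (g x) \<le> (norm (f x))\<^sup>2 + (norm (g x))\<^sup>2"
        using mult_nonneg_nonneg[OF norm_ge_zero norm_ge_zero, of "f x" "g x"] by linarith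
      finally show ?thesis by simp
    qed
    then show "AE x in lebesgue. norm (f x \<bullet> g x) \<le> norm ((norm (f x))\<^sup>2 + (norm (g x))\<^sup>2)" by simp
  qed simp
qed

text \<open>A partial equivalence: a function outside \<open>L2\<close> is not related even to
  itself, so the quotient contains square integrable classes only. A type is built, rather than a
  set of classes, so that lemmas about the class \<open>complete_space\<close> apply.\<close>

definition l2_rel :: "('a::euclidean_space \<Rightarrow> 'b::euclidean_space) \<Rightarrow> ('a \<Rightarrow> 'b) \<Rightarrow> bool" where
  "l2_rel f g \<longleftrightarrow> f \<in> L2 \<and> g \<in> L2 \<and> (AE x in lebesgue. f x = g x)"

quotient_type (overloaded) ('a, 'b) l2 = "'a::euclidean_space \<Rightarrow> 'b::euclidean_space" / partial: l2_rel
  morphisms rep_l2 abs_l2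
proof (rule part_equivpI)
  show "\<exists>f. l2_rel f f" by (rule exI[of _ "\<lambda>x. 0"]) (simp add: l2_rel_def L2_zero)
  show "symp l2_rel" by (auto simp: symp_def l2_rel_def)
  show "transp l2_rel" by (auto simp: transp_def l2_rel_def elim: eventually_elim2)
qed

lemma abs_l2_eq_iff:
  "f \<in> L2 \<Longrightarrow> g \<in> L2 \<Longrightarrow> abs_l2 f = abs_l2 g \<longleftrightarrow> (AE x in lebesgue. f x = g x)"
  using Quotient_rel[OF Quotient_l2, of f g] by (simp add: l2_rel_def)

lemma rep_l2_in_L2: "rep_l2 p \<in> L2"
  using Quotient_rep_reflp[OF Quotient_l2, of p] by (simp add: l2_rel_def)

lemma abs_rep_l2: "abs_l2 (rep_l2 p) = p"
  by (rule Quotient_abs_rep[OF Quotient_l2])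

lemma rep_abs_l2: "f \<in> L2 \<Longrightarrow> AE x in lebesgue. rep_l2 (abs_l2 f) x = f x"
  by (metis abs_l2_eq_iff abs_rep_l2 rep_l2_in_L2)

instantiation l2 :: (euclidean_space, euclidean_space) real_inner
begin

lift_definition zero_l2 :: "('a, 'b) l2" is "\<lambda>x. 0"
  by (simp add: l2_rel_def L2_zero)

lift_definition plus_l2 :: "('a, 'b) l2 \<Rightarrow> ('a, 'b) l2 \<Rightarrow> ('a, 'b) l2" is "\<lambda>f g x. f x + g x"
  by (auto simp: l2_rel_def intro: L2_add)

lift_definition minus_l2 :: "('a, 'b) l2 \<Rightarrow> ('a, 'b) l2 \<Rightarrow> ('a, 'b) l2" is "\<lambda>f g x. f x - g x"
  by (auto simp: l2_rel_def intro: L2_diff)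

lift_definition uminus_l2 :: "('a, 'b) l2 \<Rightarrow> ('a, 'b) l2" is "\<lambda>f x. - f x"
  by (auto simp: l2_rel_def intro: L2_uminus)

lift_definition scaleR_l2 :: "real \<Rightarrow> ('a, 'b) l2 \<Rightarrow> ('a, 'b) l2" is "\<lambda>r f x. r *\<^sub>R f x"
  by (auto simp: l2_rel_def intro: L2_scaleR)

lift_definition inner_l2 :: "('a, 'b) l2 \<Rightarrow> ('a, 'b) l2 \<Rightarrow> real"
  is "\<lambda>f g. \<integral>x. f x \<bullet> g x \<partial>lebesgue"
proof -
  fix f f' g g' :: "'a \<Rightarrow> 'b" assume *: "l2_rel f f'" "l2_rel g g'"
  then have [measurable]: "f \<in> borel_measurable lebesgue" "f' \<in> borel_measurable lebesgue"
    "g \<in> borel_measurable lebesgue" "g' \<in> borel_measurable lebesgue"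
    by (auto simp: l2_rel_def L2_def)
  from * show "(\<integral>x. f x \<bullet> g x \<partial>lebesgue) = (\<integral>x. f' x \<bullet> g' x \<partial>lebesgue)"
    by (intro integral_cong_AE) (auto simp: l2_rel_def)
qed

definition norm_l2 :: "('a, 'b) l2 \<Rightarrow> real" where "norm_l2 p = sqrt (p \<bullet> p)"
definition sgn_l2 :: "('a, 'b) l2 \<Rightarrow> ('a, 'b) l2" where "sgn_l2 p = inverse (norm p) *\<^sub>R p"
definition dist_l2 :: "('a, 'b) l2 \<Rightarrow> ('a, 'b) l2 \<Rightarrow> real" where "dist_l2 p q = norm (p - q)"
definition uniformity_l2 :: "(('a, 'b) l2 \<times> ('a, 'b) l2) filter" where
  "uniformity_l2 = (INF e\<in>{0<..}. principal {(x, y). dist x y < e})"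
definition open_l2 :: "('a, 'b) l2 set \<Rightarrow> bool" where
  "open_l2 U \<longleftrightarrow> (\<forall>x\<in>U. eventually (\<lambda>(x', y). x' = x \<longrightarrow> y \<in> U) uniformity)"

instance
proof
  fix p q r :: "('a, 'b) l2" and s t :: real
  show "p + q + r = p + (q + r)"
    by transfer (auto simp: l2_rel_def add.assoc intro!: L2_add)
  show "p + q = q + p"
    by transfer (auto simp: l2_rel_def add.commute intro!: L2_add)
  show "0 + p = p"
    by transfer (auto simp: l2_rel_def)
  show "- p + p = 0"
    by transfer (auto simp: l2_rel_def L2_zero)
  show "p - q = p + - q"
    by transfer (auto simp: l2_rel_def intro: L2_diff)
  show "s *\<^sub>R (p + q) = s *\<^sub>R p + s *\<^sub>R q"
    by transfer (auto simp: l2_rel_def scaleR_add_right intro!: L2_add L2_scaleR)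
  show "(s + t) *\<^sub>R p = s *\<^sub>R p + t *\<^sub>R p"
    by transfer (auto simp: l2_rel_def scaleR_add_left intro!: L2_add L2_scaleR)
  show "s *\<^sub>R t *\<^sub>R p = (s * t) *\<^sub>R p"
    by transfer (auto simp: l2_rel_def intro!: L2_scaleR)
  show "1 *\<^sub>R p = p"
    by transfer (auto simp: l2_rel_def)
  show "p \<bullet> q = q \<bullet> p"
    by transfer (simp add: inner_commute)
  show "(p + q) \<bullet> r = p \<bullet> r + q \<bullet> r"
    by transfer (auto simp: l2_rel_def inner_add_left intro!: Bochner_Integration.integral_add L2_integrable_inner)
  show "(s *\<^sub>R p) \<bullet> q = s * (p \<bullet> q)"
    by transfer simp
  show "0 \<le> p \<bullet> p"
    by transfer (simp add: Bochner_Integration.integral_nonneg)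
  show "(p \<bullet> p = 0) = (p = 0)"
  proof transfer
    fix f :: "'a \<Rightarrow> 'b" assume "l2_rel f f"
    then have f: "f \<in> L2" by (simp add: l2_rel_def)
    have "(\<integral>x. f x \<bullet> f x \<partial>lebesgue) = 0 \<longleftrightarrow> (AE x in lebesgue. f x \<bullet> f x = 0)"
      by (rule integral_nonneg_eq_0_iff_AE[OF L2_integrable_inner[OF f f]]) simp
    then show "((\<integral>x. f x \<bullet> f x \<partial>lebesgue) = 0) = l2_rel f (\<lambda>x. 0)"
      using f by (simp add: l2_rel_def L2_zero)
  qed
qed (simp_all only: norm_l2_def sgn_l2_def dist_l2_def uniformity_l2_def open_l2_def)

end

lemma abs_l2_add: "f \<in> L2 \<Longrightarrow> g \<in> L2 \<Longrightarrow> abs_l2 (\<lambda>x. f x + g x) = abs_l2 f + abs_l2 g"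
  by (rule plus_l2.abs_eq[symmetric]) (auto simp: l2_rel_def)

lemma abs_l2_diff: "f \<in> L2 \<Longrightarrow> g \<in> L2 \<Longrightarrow> abs_l2 (\<lambda>x. f x - g x) = abs_l2 f - abs_l2 g"
  by (rule minus_l2.abs_eq[symmetric]) (auto simp: l2_rel_def)

lemma abs_l2_scaleR: "f \<in> L2 \<Longrightarrow> abs_l2 (\<lambda>x. r *\<^sub>R f x) = r *\<^sub>R abs_l2 f"
  by (rule scaleR_l2.abs_eq[symmetric]) (auto simp: l2_rel_def)

lemma abs_l2_zero: "abs_l2 (\<lambda>x. 0) = 0"
  by (simp add: zero_l2_def)

lemma inner_abs_l2: "f \<in> L2 \<Longrightarrow> g \<in> L2 \<Longrightarrow> abs_l2 f \<bullet> abs_l2 g = (\<integral>x. f x \<bullet> g x \<partial>lebesgue)"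
  by (rule inner_l2.abs_eq) (auto simp: l2_rel_def)

lemma norm_abs_l2: "f \<in> L2 \<Longrightarrow> norm (abs_l2 f) = L2_norm f"
  by (simp add: norm_eq_sqrt_inner inner_abs_l2 L2_norm_def power2_norm_eq_inner)

lemma norm_power2_abs_l2: "f \<in> L2 \<Longrightarrow> (norm (abs_l2 f))\<^sup>2 = (\<integral>x. (norm (f x))\<^sup>2 \<partial>lebesgue)"
  by (simp add: power2_norm_eq_inner inner_abs_l2)

lemma nn_integral_norm_power2:
  "f \<in> L2 \<Longrightarrow> (\<integral>\<^sup>+x. ennreal ((norm (f x))\<^sup>2) \<partial>lebesgue) = ennreal ((norm (abs_l2 f))\<^sup>2)"
  by (simp add: norm_power2_abs_l2 nn_integral_eq_integral L2_integrable)

lemma Cauchy_fast_subseq: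
  fixes X :: "nat \<Rightarrow> 'a::metric_space"
  assumes "Cauchy X"
  obtains r where "strict_mono r" "\<And>n m. n \<le> m \<Longrightarrow> dist (X (r n)) (X (r m)) \<le> (1/2) ^ n"
proof -
  have "\<exists>N. \<forall>i\<ge>N. \<forall>j\<ge>N. dist (X i) (X j) < (1/2) ^ n" for n
    using metric_CauchyD[OF assms, of "(1/2)^n"] by auto
  then obtain N where N: "\<And>n i j. i \<ge> N n \<Longrightarrow> j \<ge> N n \<Longrightarrow> dist (X i) (X j) < (1/2) ^ n"
    by metis
  \<comment> \<open>The partial sum dominates \<open>N n\<close>, and the summand n makes the
    indices strictly increasing.\<close>
  define r where "r n = n + (\<Sum>k\<le>n. N k)" for n
  have mono: "strict_mono r" by (rule strict_monoI_Suc) (simp add: r_def)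
  have ge: "N n \<le> r n" for n
    unfolding r_def by (rule trans_le_add2, rule member_le_sum) auto
  have "dist (X (r n)) (X (r m)) \<le> (1/2) ^ n" if "n \<le> m" for n m
    using N[of n "r n" "r m"] ge[of n] strict_mono_leD[OF mono that] by simp
  with mono show ?thesis by (rule that)
qed

text \<open>Riesz--Fischer: along a fast subsequence the weighted sum of the squared increments is
  integrable, hence finite almost everywhere, which forces pointwise convergence.\<close>

lemma l2_fast_convergent:
  fixes X :: "nat \<Rightarrow> ('a::euclidean_space, 'b::euclidean_space) l2"
  assumes X: "\<And>n m. n \<le> m \<Longrightarrow> dist (X n) (X m) \<le> (1/2) ^ n"
  shows "convergent X"
proof -
  define f where "f n = rep_l2 (X n)" for n
  have f: "f n \<in> L2" "abs_l2 (f n) = X n" for n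
    by (auto simp: f_def rep_l2_in_L2 abs_rep_l2)
  note [measurable] = L2_measurable[OF f(1)]
  have nn: "(\<integral>\<^sup>+x. ennreal ((norm (f m x - f n x))\<^sup>2) \<partial>lebesgue) \<le> ennreal (((1/2) ^ n)\<^sup>2)" if "n \<le> m" for n m
  proof -
    have "norm (X m - X n) \<le> (1/2)^n" using X[OF that] by (simp add: dist_norm norm_minus_commute)
    then show ?thesis
      using power_mono[of "norm (X m - X n)" "(1/2)^n" 2]
      by (simp add: nn_integral_norm_power2 L2_diff f abs_l2_diff ennreal_leI)
  qed
  \<comment> \<open>The squared increments integrate to at most (1/4)^n, so the weight 2^n still
    leaves a convergent series. Conversely, a finite weighted sum B bounds the n-th increment by
    sqrt B times sqrt(1/2)^n, which is summable.\<close>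
  define g where "g n x = 2 ^ n * (norm (f (Suc n) x - f n x))\<^sup>2" for n x
  have [measurable]: "g n \<in> borel_measurable lebesgue" for n
    unfolding g_def by measurable
  have "(\<integral>\<^sup>+x. (\<Sum>n. ennreal (g n x)) \<partial>lebesgue) = (\<Sum>n. \<integral>\<^sup>+x. ennreal (g n x) \<partial>lebesgue)"
    by (rule nn_integral_suminf) auto
  also have "\<dots> \<le> (\<Sum>n. ennreal ((1/2) ^ n))"
  proof (rule suminf_le)
    fix n
    have "(\<integral>\<^sup>+x. ennreal (g n x) \<partial>lebesgue) =
        ennreal (2 ^ n) * (\<integral>\<^sup>+x. ennreal ((norm (f (Suc n) x - f n x))\<^sup>2) \<partial>lebesgue)"
      unfolding g_def by (subst nn_integral_cmult[symmetric]) (auto simp: ennreal_mult)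
    also have "\<dots> \<le> ennreal (2 ^ n) * ennreal (((1/2) ^ n)\<^sup>2)"
      by (intro mult_left_mono nn) auto
    also have "\<dots> = ennreal ((1/2) ^ n)"
      by (subst ennreal_mult[symmetric]) (auto simp: power2_eq_square field_simps)
    finally show "(\<integral>\<^sup>+x. ennreal (g n x) \<partial>lebesgue) \<le> ennreal ((1/2) ^ n)" .
  qed auto
  also have "\<dots> = ennreal (\<Sum>n. (1/2) ^ n)"
    by (intro suminf_ennreal2) (auto simp: summable_geometric)
  also have "\<dots> < \<infinity>" by simp
  finally have "(\<integral>\<^sup>+x. (\<Sum>n. ennreal (g n x)) \<partial>lebesgue) \<noteq> \<infinity>" by simp
  then have AE: "AE x in lebesgue. (\<Sum>n. ennreal (g n x)) \<noteq> \<infinity>"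
    by (intro nn_integral_PInf_AE) auto
  have conv: "convergent (\<lambda>n. f n x)" if fin: "(\<Sum>n. ennreal (g n x)) \<noteq> \<infinity>" for x
  proof -
    obtain B where B: "B \<ge> 0" "(\<Sum>n. ennreal (g n x)) = ennreal B"
      using fin by (cases "\<Sum>n. ennreal (g n x)") auto
    have gB: "g n x \<le> B" for n
    proof -
      have "ennreal (g n x) \<le> (\<Sum>n. ennreal (g n x))"
        using sum_le_suminf[of "\<lambda>n. ennreal (g n x)" "{n}"] by simp
      then show ?thesis using B by simp
    qed
    have "norm (f (Suc n) x - f n x) \<le> sqrt B * (sqrt (1/2)) ^ n" for n
    proof -
      have "(norm (f (Suc n) x - f n x))\<^sup>2 \<le> B * (1/2) ^ n"
        using gB[of n] by (simp add: g_def field_simps)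
      then have "norm (f (Suc n) x - f n x) \<le> sqrt (B * (1/2) ^ n)"
        by (rule real_le_rsqrt)
      then show ?thesis by (simp only: real_sqrt_mult real_sqrt_power)
    qed
    note bound = this
    have sm: "summable (\<lambda>n. sqrt B * (sqrt (1/2)) ^ n)"
      by (intro summable_mult summable_geometric) (simp add: real_sqrt_lt_1_iff)
    have "summable (\<lambda>n. f (Suc n) x - f n x)"
      by (rule summable_comparison_test'[OF sm, of 0]) (rule bound)
    then have "convergent (\<lambda>n. (\<Sum>k<n. f (Suc k) x - f k x) + f 0 x)"
      by (intro convergent_add convergent_const) (simp add: summable_iff_convergent)
    moreover have "(\<Sum>k<n. f (Suc k) x - f k x) + f 0 x = f n x" for n
      using sum_lessThan_telescope[of "\<lambda>k. f k x" n] by simp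
    ultimately show ?thesis by simp
  qed
  define F where "F x = lim (\<lambda>n. f n x)" for x
  have [measurable]: "F \<in> borel_measurable lebesgue"
    unfolding F_def by (rule borel_measurable_lim_metric) auto
  have F: "AE x in lebesgue. (\<lambda>n. f n x) \<longlonglongrightarrow> F x"
    using AE by eventually_elim (simp only: F_def convergent_LIMSEQ_iff[THEN iffD1, OF conv] not_False_eq_True)
  \<comment> \<open>Fatou's lemma, applied as m grows, turns the Cauchy estimate into an estimate of
    the distance to the pointwise limit.\<close>
  have le: "(\<integral>\<^sup>+x. ennreal ((norm (F x - f n x))\<^sup>2) \<partial>lebesgue) \<le> ennreal (((1/2) ^ n)\<^sup>2)" for n
  proof -
    have "AE x in lebesgue. ennreal ((norm (F x - f n x))\<^sup>2) = liminf (\<lambda>m. ennreal ((norm (f m x - f n x))\<^sup>2))"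
      using F
    proof eventually_elim
      case (elim x)
      have "(\<lambda>m. ennreal ((norm (f m x - f n x))\<^sup>2)) \<longlonglongrightarrow> ennreal ((norm (F x - f n x))\<^sup>2)"
        by (intro tendsto_ennrealI tendsto_power tendsto_norm tendsto_diff tendsto_const elim)
      from lim_imp_Liminf[OF sequentially_bot this] show ?case by (rule sym)
    qed
    then have "(\<integral>\<^sup>+x. ennreal ((norm (F x - f n x))\<^sup>2) \<partial>lebesgue) =
        (\<integral>\<^sup>+x. liminf (\<lambda>m. ennreal ((norm (f m x - f n x))\<^sup>2)) \<partial>lebesgue)"
      by (rule nn_integral_cong_AE)
    also have "\<dots> \<le> liminf (\<lambda>m. \<integral>\<^sup>+x. ennreal ((norm (f m x - f n x))\<^sup>2) \<partial>lebesgue)"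
      by (rule nn_integral_liminf) auto
    also have "\<dots> \<le> limsup (\<lambda>m. \<integral>\<^sup>+x. ennreal ((norm (f m x - f n x))\<^sup>2) \<partial>lebesgue)"
      by (rule Liminf_le_Limsup) simp
    also have "\<dots> \<le> ennreal (((1/2) ^ n)\<^sup>2)"
      by (rule Limsup_bounded) (use nn eventually_ge_at_top in \<open>auto simp: eventually_sequentially\<close>)
    finally show ?thesis .
  qed
  \<comment> \<open>Square integrability of the limit comes from the estimate for n = 0, by adding
    back \<open>f 0\<close>.\<close>
  have "(\<lambda>x. F x - f 0 x) \<in> L2"
    by (rule L2_I_nn) (use le[of 0] in \<open>auto intro: le_less_trans\<close>)
  from L2_add[OF this f(1)[of 0]] have FL: "F \<in> L2" by simp
  have "norm (X n - abs_l2 F) \<le> (1/2) ^ n" for n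
  proof -
    have "ennreal ((norm (abs_l2 F - X n))\<^sup>2) \<le> ennreal (((1/2) ^ n)\<^sup>2)"
      using le[of n] by (simp add: nn_integral_norm_power2 L2_diff FL f abs_l2_diff)
    then show ?thesis
      by (subst norm_minus_commute) (rule power2_le_imp_le, auto)
  qed
  then have "(\<lambda>n. X n - abs_l2 F) \<longlonglongrightarrow> 0"
    by (intro Lim_null_comparison[OF always_eventually LIMSEQ_power_zero[of "1/2::real"]]) auto
  then show ?thesis
    by (auto simp: convergent_def LIM_zero_iff)
qed

instance l2 :: (euclidean_space, euclidean_space) complete_space
proof
  fix X :: "nat \<Rightarrow> ('a, 'b) l2" assume X: "Cauchy X"
  obtain r where r: "strict_mono r" "\<And>n m. n \<le> m \<Longrightarrow> dist (X (r n)) (X (r m)) \<le> (1/2) ^ n"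
    using Cauchy_fast_subseq[OF X] by blast
  obtain l where "(X \<circ> r) \<longlonglongrightarrow> l"
    using l2_fast_convergent[of "X \<circ> r"] r(2) by (auto simp: convergent_def)
  then show "convergent X"
    using Cauchy_converges_subseq[OF X r(1)] by (auto simp: convergent_def)
qed

section \<open>Locally integrable functions and test functions\<close>

lemma L1_loc_measurable: "w \<in> L1_loc \<Longrightarrow> w \<in> borel_measurable lebesgue"
  by (simp add: L1_loc_def)

lemma L1_loc_bound:
  assumes g: "g \<in> L1_loc" and f: "f \<in> borel_measurable lebesgue"
    and le: "AE x in lebesgue. norm (f x) \<le> norm (g x)"
  shows "f \<in> L1_loc"
proof -
  have "set_integrable lebesgue K f" if K: "compact K" for K
    unfolding set_integrable_def
  proof (rule Bochner_Integration.integrable_bound)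
    show "integrable lebesgue (\<lambda>x. indicator K x *\<^sub>R g x)"
      using g K by (simp add: L1_loc_def set_integrable_def)
    show "(\<lambda>x. indicator K x *\<^sub>R f x) \<in> borel_measurable lebesgue"
      using K by (intro borel_measurable_scaleR borel_measurable_indicator f) (simp add: borel_compact)
    show "AE x in lebesgue. norm (indicator K x *\<^sub>R f x) \<le> norm (indicator K x *\<^sub>R g x)"
      using le by eventually_elim (simp add: mult_left_mono)
  qed
  with f show ?thesis by (simp add: L1_loc_def)
qed

lemma L1_loc_bounded_linear:
  assumes L: "bounded_linear L" and f: "f \<in> L1_loc"
  shows "(\<lambda>x. L (f x)) \<in> L1_loc"
proof -
  have "L \<in> borel_measurable borel"
    by (intro borel_measurable_continuous_onI linear_continuous_on L)
  then have "(\<lambda>x. L (f x)) \<in> borel_measurable lebesgue"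
    by (rule measurable_compose[OF L1_loc_measurable[OF f]])
  moreover have "set_integrable lebesgue K (\<lambda>x. L (f x))" if "compact K" for K
    using f that integrable_bounded_linear[OF L, of lebesgue "\<lambda>x. indicator K x *\<^sub>R f x"]
    by (simp add: L1_loc_def set_integrable_def linear_scale[OF bounded_linear.linear[OF L]])
  ultimately show ?thesis by (simp add: L1_loc_def)
qed

lemma L1_loc_lincomb:
  assumes "u \<in> L1_loc" "w \<in> L1_loc" shows "(\<lambda>x. s *\<^sub>R u x + t *\<^sub>R w x) \<in> L1_loc"
proof -
  have "set_integrable lebesgue K (\<lambda>x. s *\<^sub>R u x + t *\<^sub>R w x)" if K: "compact K" for K
    using assms K by (intro set_integral_add(1) set_integrable_scaleR_right) (auto simp: L1_loc_def)
  moreover have "(\<lambda>x. s *\<^sub>R u x + t *\<^sub>R w x) \<in> borel_measurable lebesgue"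
    using assms by (intro borel_measurable_add borel_measurable_scaleR borel_measurable_const L1_loc_measurable)
  ultimately show ?thesis by (simp add: L1_loc_def)
qed

lemma L1_loc_integrable_mult:
  fixes w \<psi> :: "'a::euclidean_space \<Rightarrow> real"
  assumes w: "w \<in> L1_loc" and [measurable]: "\<psi> \<in> borel_measurable lebesgue"
    and B: "\<And>x. \<bar>\<psi> x\<bar> \<le> B" and r: "\<And>x. norm x > r \<Longrightarrow> \<psi> x = 0"
  shows "integrable lebesgue (\<lambda>x. w x * \<psi> x)"
proof -
  have [measurable]: "w \<in> borel_measurable lebesgue" using w by (rule L1_loc_measurable)
  have "integrable lebesgue (\<lambda>x. indicator (cball 0 r) x *\<^sub>R w x)"
    using w by (simp add: L1_loc_def set_integrable_def)
  then have "integrable lebesgue (\<lambda>x. B * (indicator (cball 0 r) x *\<^sub>R w x))" by simp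
  then show ?thesis
  proof (rule Bochner_Integration.integrable_bound)
    have "norm (w x * \<psi> x) \<le> norm (B * (indicator (cball 0 r) x *\<^sub>R w x))" for x
    proof (cases "norm x \<le> r")
      case True
      have "\<bar>\<psi> x\<bar> \<le> \<bar>B\<bar>" using B[of x] by linarith
      then have "\<bar>w x\<bar> * \<bar>\<psi> x\<bar> \<le> \<bar>w x\<bar> * \<bar>B\<bar>" by (rule mult_left_mono) simp
      with True show ?thesis by (simp add: abs_mult mult.commute)
    qed (simp add: r)
    then show "AE x in lebesgue. norm (w x * \<psi> x) \<le> norm (B * (indicator (cball 0 r) x *\<^sub>R w x))"
      by simp
  qed measurable
qed

lemma smooth_borel_measurable:
  "smooth \<psi> \<Longrightarrow> \<psi> \<in> borel_measurable borel" "smooth \<psi> \<Longrightarrow> \<psi> \<in> borel_measurable lebesgue"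
  by (auto intro!: borel_measurable_continuous_onI smooth_continuous measurable_completion)

lemma L1_loc_integrable_test:
  fixes w \<phi> :: "'a::euclidean_space \<Rightarrow> real"
  assumes w: "w \<in> L1_loc" and \<phi>: "\<phi> \<in> test_functions"
  shows "integrable lebesgue (\<lambda>x. w x * \<phi> x)"
proof -
  obtain r where r: "\<And>x. norm x > r \<Longrightarrow> \<phi> x = 0" using test_support[OF \<phi>] by blast
  obtain B where B: "\<And>x. norm (\<phi> x) \<le> B" using test_bounded[OF \<phi>] by blast
  show ?thesis
  proof (rule L1_loc_integrable_mult[OF w smooth_borel_measurable(2)[OF test_smooth[OF \<phi>]]])
    show "\<bar>\<phi> x\<bar> \<le> B" for x using B[of x] by simp
  qed (rule r)
qed

lemma continuous_L1_loc:
  fixes w :: "'a::euclidean_space \<Rightarrow> 'b::euclidean_space"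
  assumes "continuous_on UNIV w"
  shows "w \<in> L1_loc"
proof -
  have "set_integrable lebesgue K w" if "compact K" for K
  proof -
    have "integrable lborel (\<lambda>x. indicator K x *\<^sub>R w x)"
      by (rule borel_integrable_compact[OF that]) (use assms continuous_on_subset in blast)
    then show ?thesis
      unfolding set_integrable_def
      by (subst integrable_completion) (auto dest: borel_measurable_integrable)
  qed
  with assms show ?thesis
    by (auto simp: L1_loc_def intro!: borel_measurable_continuous_onI measurable_completion)
qed

section \<open>Differentiation under the integral and integration by parts\<close>

lemma test_lipschitz:
  fixes \<phi> :: "'a::euclidean_space \<Rightarrow> real"
  assumes \<phi>: "\<phi> \<in> test_functions"
  obtains L where "L \<ge> 0" "\<And>x h. \<bar>dderiv h \<phi> x\<bar> \<le> L * norm h"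
    "\<And>x h. \<bar>\<phi> (x + h) - \<phi> x\<bar> \<le> L * norm h"
proof -
  have "\<exists>B. \<forall>x. norm (dderiv b \<phi> x) \<le> B" for b
    using test_bounded[OF test_dderiv[OF \<phi>, of b]] by blast
  then obtain B where B: "\<And>b x. norm (dderiv b \<phi> x) \<le> B b" by metis
  \<comment> \<open>The sum of the bounds of the partial derivatives bounds the operator norm of the
    derivative, and the mean value inequality turns this into a Lipschitz constant.\<close>
  define L where "L = (\<Sum>b\<in>Basis. B b)"
  have B0: "B b \<ge> 0" for b by (rule order_trans[OF norm_ge_zero B])
  then have "L \<ge> 0" by (simp add: L_def sum_nonneg)
  moreover have bd: "\<bar>dderiv h \<phi> x\<bar> \<le> L * norm h" for h x
  proof -
    have "dderiv h \<phi> x = (\<Sum>b\<in>Basis. (h \<bullet> b) * dderiv b \<phi> x)"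
      by (rule dderiv_Basis_sum[OF test_smooth[OF \<phi>]])
    also have "\<bar>\<dots>\<bar> \<le> (\<Sum>b\<in>Basis. \<bar>(h \<bullet> b) * dderiv b \<phi> x\<bar>)" by (rule sum_abs)
    also have "\<dots> \<le> (\<Sum>b\<in>Basis. norm h * B b)"
      using B B0 by (intro sum_mono) (auto simp: abs_mult intro!: mult_mono Basis_le_norm)
    finally show ?thesis by (simp add: L_def sum_distrib_left mult.commute)
  qed
  moreover have "\<bar>\<phi> (x + h) - \<phi> x\<bar> \<le> L * norm h" for x h
  proof -
    have "norm (\<phi> (x + h) - \<phi> x) \<le> L * norm ((x + h) - x)"
    proof (rule differentiable_bound[of UNIV])
      show "(\<phi> has_derivative frechet_derivative \<phi> (at y)) (at y within UNIV)" for y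
        using smooth_has_derivative[OF test_smooth[OF \<phi>]] by simp
      show "onorm (frechet_derivative \<phi> (at y)) \<le> L" for y
        by (rule onorm_bound) (use bd \<open>L \<ge> 0\<close> in auto)
    qed auto
    then show ?thesis by simp
  qed
  ultimately show ?thesis using that by blast
qed

text \<open>The convolution of \<open>w\<close> with the reflection of \<open>\<phi>\<close>: in this form differentiation passes to \<open>\<phi>\<close>
  without a sign.\<close>

definition corr :: "('a::euclidean_space \<Rightarrow> real) \<Rightarrow> ('a \<Rightarrow> real) \<Rightarrow> 'a \<Rightarrow> real" where
  "corr w \<phi> h = (\<integral>y. w y * \<phi> (y + h) \<partial>lebesgue)"

lemma test_translate:
  assumes "\<phi> \<in> test_functions" shows "(\<lambda>y. \<phi> (y + h)) \<in> test_functions"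
proof -
  obtain r where r: "r > 0" "\<And>x. norm x > r \<Longrightarrow> \<phi> x = 0" using test_support[OF assms] by blast
  have "norm (y + h) > r" if "norm y > r + norm h" for y
    using that norm_triangle_ineq4[of "y + h" h] by simp
  with r show ?thesis
    using smooth_compose_affine[OF test_smooth[OF assms] bounded_linear_ident, of h]
    by (intro test_functionsI[of _ "r + norm h"]) auto
qed

text \<open>The normalised Taylor remainders of \<phi> tend to zero pointwise, are bounded by twice
  a Lipschitz constant, and are supported in one ball as long as the increments stay bounded. Local
  integrability of \<open>w\<close> then permits dominated convergence.\<close>

lemma corr_has_derivative:
  assumes w: "w \<in> L1_loc" and \<phi>: "\<phi> \<in> test_functions"
  shows "(corr w \<phi> has_derivative (\<lambda>k. corr w (dderiv k \<phi>) h)) (at h)"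
proof -
  note \<phi>D = smooth_has_derivative[OF test_smooth[OF \<phi>]]
  have [measurable]: "w \<in> borel_measurable lebesgue" using w by (rule L1_loc_measurable)
  have int: "integrable lebesgue (\<lambda>y. w y * \<psi> (y + h))" if "\<psi> \<in> test_functions" for \<psi> h
    using L1_loc_integrable_test[OF w test_translate[OF that]] .
  obtain L where L: "L \<ge> 0" "\<And>x h. \<bar>dderiv h \<phi> x\<bar> \<le> L * norm h"
    "\<And>x h. \<bar>\<phi> (x + h) - \<phi> x\<bar> \<le> L * norm h"
    using test_lipschitz[OF \<phi>] by blast
  obtain r where r: "r > 0" "\<And>x. norm x > r \<Longrightarrow> \<phi> x = 0" using test_support[OF \<phi>] by blast
  have lin: "linear (\<lambda>k. corr w (dderiv k \<phi>) h)"
  proof (rule linearI)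
    fix k l :: 'a and c :: real
    note D = smooth_linear[OF test_smooth[OF \<phi>]]
    show "corr w (dderiv (k + l) \<phi>) h = corr w (dderiv k \<phi>) h + corr w (dderiv l \<phi>) h"
      using Bochner_Integration.integral_add[OF int[OF test_dderiv[OF \<phi>]] int[OF test_dderiv[OF \<phi>]], of h k h l]
      by (simp add: corr_def linear_add[OF D] distrib_left)
    show "corr w (dderiv (c *\<^sub>R k) \<phi>) h = c *\<^sub>R corr w (dderiv k \<phi>) h"
      by (simp add: corr_def linear_scale[OF D] mult.left_commute)
  qed
  \<comment> \<open>The first order Taylor remainder of \<phi> at y + h, divided by the length of
    the increment k.\<close>
  define R where "R k y = (\<phi> (y + h + k) - \<phi> (y + h) - dderiv k \<phi> (y + h)) / norm k" for k y
  have R_test: "(\<lambda>y. \<phi> (y + h + k) - \<phi> (y + h) - dderiv k \<phi> (y + h)) \<in> test_functions" for k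
  proof -
    have "(\<lambda>y. \<phi> (y + (h + k)) + (- \<phi> (y + h)) + (- dderiv k \<phi> (y + h))) \<in> test_functions"
      by (intro test_add test_translate test_bounded_linear[OF bounded_linear_minus[OF bounded_linear_ident]]
          test_dderiv \<phi>)
    then show ?thesis by (simp add: add.assoc)
  qed
  have Rm[measurable]: "R k \<in> borel_measurable lebesgue" for k
    unfolding R_def using smooth_borel_measurable(2)[OF test_smooth[OF R_test]] by simp
  have "((\<lambda>k. norm (corr w \<phi> (h + k) - corr w \<phi> h - corr w (dderiv k \<phi>) h) / norm k) \<longlongrightarrow> 0) (at 0)"
    unfolding tendsto_at_iff_sequentially
  proof (intro allI impI)
    fix k :: "nat \<Rightarrow> 'a" assume k: "\<forall>i. k i \<in> UNIV - {0}" "k \<longlonglongrightarrow> 0"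
    \<comment> \<open>Dominated convergence is available along sequences. A bound on the whole
      sequence of increments fixes the ball of radius r + |h| + K that supports every
      remainder.\<close>
    obtain K where K: "\<And>n. norm (k n) \<le> K"
      using convergent_imp_Bseq[of k] k(2) by (auto simp: convergent_def Bseq_def)
    have eq: "(corr w \<phi> (h + k n) - corr w \<phi> h - corr w (dderiv (k n) \<phi>) h) / norm (k n) =
        (\<integral>y. w y * R (k n) y \<partial>lebesgue)" for n
    proof -
      have "(\<integral>y. w y * \<phi> (y + (h + k n)) - w y * \<phi> (y + h) - w y * dderiv (k n) \<phi> (y + h) \<partial>lebesgue) =
          corr w \<phi> (h + k n) - corr w \<phi> h - corr w (dderiv (k n) \<phi>) h"
        unfolding corr_def
        by (intro Bochner_Integration.integral_diff[THEN trans] arg_cong2[where f=minus]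
            Bochner_Integration.integrable_diff int \<phi> test_dderiv refl)
      moreover have "w y * R (k n) y =
          (w y * \<phi> (y + (h + k n)) - w y * \<phi> (y + h) - w y * dderiv (k n) \<phi> (y + h)) / norm (k n)" for y
        by (simp add: R_def right_diff_distrib add.assoc)
      ultimately show ?thesis by simp
    qed
    have "(\<lambda>n. \<integral>y. w y * R (k n) y \<partial>lebesgue) \<longlonglongrightarrow> (\<integral>y. 0 \<partial>(lebesgue :: 'a measure))"
    proof (rule integral_dominated_convergence[where w="\<lambda>y. norm (w y * (2 * L * indicator (cball 0 (r + norm h + K)) y))"])
      show "integrable lebesgue (\<lambda>y. norm (w y * (2 * L * indicator (cball 0 (r + norm h + K)) y)))"
      proof (intro integrable_norm L1_loc_integrable_mult[OF w, where B="2 * L" and r="r + norm h + K"])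
        show "(\<lambda>y. 2 * L * indicator (cball 0 (r + norm h + K)) y) \<in> borel_measurable lebesgue"
          by (intro borel_measurable_times borel_measurable_const borel_measurable_indicator) simp
      qed (use L(1) in \<open>auto simp: indicator_def\<close>)
      have "norm (w y * R (k n) y) \<le> norm (w y * (2 * L * indicator (cball 0 (r + norm h + K)) y))" for n y
      proof (cases "norm y \<le> r + norm h + K")
        case True
        have "\<bar>\<phi> (y + h + k n) - \<phi> (y + h) - dderiv (k n) \<phi> (y + h)\<bar> \<le> 2 * L * norm (k n)"
          using L(2)[of "y + h" "k n"] L(3)[of "y + h" "k n"] by linarith
        then have "\<bar>R (k n) y\<bar> \<le> 2 * L"
          using k(1) by (simp add: R_def abs_divide pos_divide_le_eq)
        with True show ?thesis
          using L(1) by (simp add: abs_mult mult_left_mono)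
      next
        case False
        have "norm y \<le> norm (y + h + k n) + norm h + norm (k n)"
          using norm_triangle_ineq4[of "y + h" h] norm_triangle_ineq4[of "y + h + k n" "k n"] by simp
        moreover have "norm y \<le> norm (y + h) + norm h"
          using norm_triangle_ineq4[of "y + h" h] by simp
        ultimately have *: "norm (y + h + k n) > r" "norm (y + h) > r"
          using False K[of n] norm_ge_zero[of "k n"] by linarith+
        then have "R (k n) y = 0"
          using dderiv_zero_outside[of r \<phi> "y + h" "k n"] r(2) by (simp add: R_def)
        then show ?thesis by simp
      qed
      then show "AE y in lebesgue. norm (w y * R (k n) y) \<le>
          norm (w y * (2 * L * indicator (cball 0 (r + norm h + K)) y))" for n by simp
      have "(\<lambda>n. w y * R (k n) y) \<longlonglongrightarrow> w y * 0" for y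
      proof (intro tendsto_intros)
        have "((\<lambda>k. norm (\<phi> (y + h + k) - \<phi> (y + h) - dderiv k \<phi> (y + h)) / norm k) \<longlongrightarrow> 0) (at 0)"
          using \<phi>D[of "y + h"] unfolding has_derivative_at by simp
        then have "(\<lambda>n. norm (R (k n) y)) \<longlonglongrightarrow> 0"
          using k unfolding tendsto_at_iff_sequentially by (auto simp: R_def o_def abs_divide)
        then show "(\<lambda>n. R (k n) y) \<longlonglongrightarrow> 0" by (rule tendsto_norm_zero_cancel)
      qed
      then show "AE y in lebesgue. (\<lambda>n. w y * R (k n) y) \<longlonglongrightarrow> 0" by simp
    qed auto
    then have "(\<lambda>n. norm ((corr w \<phi> (h + k n) - corr w \<phi> h - corr w (dderiv (k n) \<phi>) h) / norm (k n))) \<longlonglongrightarrow> 0"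
      unfolding eq by (intro tendsto_norm_zero) simp
    then show "((\<lambda>k. norm (corr w \<phi> (h + k) - corr w \<phi> h - corr w (dderiv k \<phi>) h) / norm k) \<circ> k) \<longlonglongrightarrow> 0"
      by (simp add: o_def abs_divide)
  qed
  then show ?thesis
    unfolding has_derivative_at using lin linear_conv_bounded_linear by blast
qed

lemma dderiv_corr:
  "w \<in> L1_loc \<Longrightarrow> \<phi> \<in> test_functions \<Longrightarrow> dderiv k (corr w \<phi>) = corr w (dderiv k \<phi>)"
  using dderiv_eq[OF corr_has_derivative] by blast

lemma smooth_corr:
  assumes w: "w \<in> L1_loc" and \<phi>: "\<phi> \<in> test_functions"
  shows "smooth (corr w \<phi>)"
proof (rule smooth_coinduct[where P="\<lambda>f. \<exists>\<phi>\<in>test_functions. f = corr w \<phi>"])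
  show "\<exists>\<phi>'\<in>test_functions. corr w \<phi> = corr w \<phi>'" using \<phi> by blast
  show "f differentiable at x" if "\<exists>\<phi>\<in>test_functions. f = corr w \<phi>" for f x
    using that corr_has_derivative[OF w] differentiableI by blast
  show "\<exists>\<phi>\<in>test_functions. dderiv h f = corr w \<phi>" if "\<exists>\<phi>\<in>test_functions. f = corr w \<phi>" for f h
    using that dderiv_corr[OF w] test_dderiv by blast
qed

lemma integral_translate:
  fixes f :: "'a::euclidean_space \<Rightarrow> 'b::{banach,second_countable_topology}"
  assumes [measurable]: "f \<in> borel_measurable borel"
  shows "(\<integral>x. f (x + h) \<partial>lborel) = (\<integral>x. f x \<partial>lborel)"
proof -
  have "(\<integral>x. f x \<partial>distr lborel borel ((+) h)) = (\<integral>x. f (h + x) \<partial>lborel)"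
    by (rule integral_distr) auto
  then show ?thesis by (simp add: lborel_distr_plus add.commute)
qed

text \<open>By translation invariance the correlation of \<phi> with the constant 1 is constant;
  differentiating it under the integral gives the claim.\<close>

lemma integral_dderiv_test:
  assumes "\<phi> \<in> test_functions"
  shows "(\<integral>x. dderiv h \<phi> x \<partial>lebesgue) = (0::real)"
proof -
  have L: "(\<lambda>_. 1) \<in> L1_loc" by (rule continuous_L1_loc) simp
  have "corr (\<lambda>_. 1) \<phi> k = corr (\<lambda>_. 1) \<phi> 0" for k
    using integral_translate[of \<phi> k] smooth_borel_measurable[OF test_smooth[OF assms]]
      smooth_borel_measurable[OF test_smooth[OF test_translate[OF assms, of k]]]
    by (simp add: corr_def integral_completion)
  then have "corr (\<lambda>_. 1) \<phi> = (\<lambda>_. corr (\<lambda>_. 1) \<phi> 0)" by (rule ext)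
  then have "dderiv h (corr (\<lambda>_. 1) \<phi>) 0 = 0"
    by (metis frechet_derivative_const)
  then have "corr (\<lambda>_. 1) (dderiv h \<phi>) 0 = 0"
    using fun_cong[OF dderiv_corr[OF L assms, of h], of 0] by (rule_tac trans[OF sym])
  then show ?thesis by (simp add: corr_def)
qed

text \<open>The product of \<open>f\<close> and \<phi> is a test function, so the integral of its
  derivative vanishes; the Leibniz rule splits that integral.\<close>

lemma integration_by_parts:
  fixes f \<phi> :: "'a::euclidean_space \<Rightarrow> real"
  assumes f: "smooth f" and \<phi>: "\<phi> \<in> test_functions"
  shows "(\<integral>x. f x * dderiv h \<phi> x \<partial>lebesgue) = - (\<integral>x. dderiv h f x * \<phi> x \<partial>lebesgue)"
proof -
  have "(\<lambda>x. \<phi> x * f x) \<in> test_functions" by (rule test_mult[OF \<phi> f])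
  from integral_dderiv_test[OF this, of h]
  have "(\<integral>x. \<phi> x * dderiv h f x + dderiv h \<phi> x * f x \<partial>lebesgue) = 0"
    by (simp only: dderiv_eq[OF dderiv_mult[OF test_smooth[OF \<phi>] f]])
  moreover have "integrable lebesgue (\<lambda>x. dderiv h f x * \<phi> x)" "integrable lebesgue (\<lambda>x. f x * dderiv h \<phi> x)"
    using L1_loc_integrable_test continuous_L1_loc smooth_continuous smooth_dderiv test_dderiv f \<phi> by blast+
  ultimately show ?thesis by (simp add: mult.commute)
qed

section \<open>The fundamental lemma of the calculus of variations\<close>

lemma fundamental_lemma_box:
  fixes F :: "'a::euclidean_space \<Rightarrow> real"
  assumes F: "F \<in> L1_loc"
    and orth: "\<And>\<phi>. \<phi> \<in> test_functions \<Longrightarrow> (\<integral>x. F x * \<phi> x \<partial>lebesgue) = 0"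
  shows "(\<integral>x. F x * indicator (box a b) x \<partial>lebesgue) = 0"
proof -
  have [measurable]: "F \<in> borel_measurable lebesgue" using F by (rule L1_loc_measurable)
  note bm[measurable] = smooth_borel_measurable(2)[OF smooth_box_bump]
  obtain r where r: "\<And>x. x \<in> box a b \<Longrightarrow> norm x \<le> r"
    using bounded_box[of a b] by (auto simp: bounded_iff)
  have ind_meas: "(\<lambda>x. indicator (box a b) x :: real) \<in> borel_measurable lebesgue"
    by (intro borel_measurable_indicator) simp
  have ind: "integrable lebesgue (\<lambda>x. F x * indicator (box a b) x)"
    by (rule L1_loc_integrable_mult[OF F ind_meas, where B=1 and r=r]) (use r in \<open>force simp: indicator_def\<close>)+
  \<comment> \<open>The bumps lie below the indicator and tend to it, so the integrable function F
    times the indicator dominates.\<close>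
  have "(\<lambda>n. \<integral>x. F x * box_bump (real (Suc n)) a b x \<partial>lebesgue) \<longlonglongrightarrow>
      (\<integral>x. F x * indicator (box a b) x \<partial>lebesgue)"
  proof (rule integral_dominated_convergence[where w="\<lambda>x. norm (F x * indicator (box a b) x)"])
    show "AE x in lebesgue. norm (F x * box_bump (real (Suc n)) a b x) \<le> norm (F x * indicator (box a b) x)" for n
    proof (rule AE_I2)
      fix x :: 'a
      have "\<bar>box_bump (real (Suc n)) a b x\<bar> \<le> indicator (box a b) x"
        using box_bump_bounds[of "real (Suc n)" a b x] box_bump_zero[of "real (Suc n)" x a b]
        by (cases "x \<in> box a b") auto
      then show "norm (F x * box_bump (real (Suc n)) a b x) \<le> norm (F x * indicator (box a b) x)"
        by (simp add: abs_mult mult_left_mono)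
    qed
    show "AE x in lebesgue. (\<lambda>n. F x * box_bump (real (Suc n)) a b x) \<longlonglongrightarrow> F x * indicator (box a b) x"
      by (intro AE_I2 tendsto_mult tendsto_const box_bump_tendsto_indicator)
  qed (use ind ind_meas in auto)
  moreover have "(\<integral>x. F x * box_bump (real (Suc n)) a b x \<partial>lebesgue) = 0" for n
    by (rule orth[OF test_box_bump]) simp
  ultimately show ?thesis by (simp add: LIMSEQ_const_iff)
qed

text \<open>Boxes are closed under intersection and generate the Borel sets, so the positive and the
  negative part of g are densities of the same finite measure. Hence they agree almost everywhere,
  and as one of them always vanishes, so do both.\<close>

lemma AE_zero_of_box_integrals:
  fixes g :: "'a::euclidean_space \<Rightarrow> real"
  assumes g: "integrable lborel g"
    and box: "\<And>a b. (\<integral>x. g x * indicator (box a b) x \<partial>lborel) = 0"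
  shows "AE x in lborel. g x = 0"
proof -
  have [measurable]: "g \<in> borel_measurable borel"
    using borel_measurable_integrable[OF g] by simp
  have fin: "(\<integral>\<^sup>+x. ennreal (norm (g x)) \<partial>lborel) < \<infinity>"
    using g by (simp add: integrable_iff_bounded)
  have fin': "(\<integral>\<^sup>+x. ennreal (c * g x) * indicator A x \<partial>lborel) \<noteq> \<infinity>" if "c = 1 \<or> c = -1" for c A
  proof -
    have "(\<integral>\<^sup>+x. ennreal (c * g x) * indicator A x \<partial>lborel) \<le> (\<integral>\<^sup>+x. ennreal (norm (g x)) \<partial>lborel)"
      using that by (intro nn_integral_mono) (auto simp: indicator_def intro!: ennreal_leI)
    with fin show ?thesis by auto
  qed
  \<comment> \<open>The vanishing integral is the difference of these two nonnegative ones;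
    \<open>fin'\<close> makes them finite, so that they can be compared.\<close>
  have eq: "(\<integral>\<^sup>+x. ennreal (g x) * indicator (box a b) x \<partial>lborel) =
      (\<integral>\<^sup>+x. ennreal (- g x) * indicator (box a b) x \<partial>lborel)" for a b
  proof -
    have int: "integrable lborel (\<lambda>x. g x * indicator (box a b) x)"
      by (rule integrable_real_mult_indicator[OF _ g]) simp
    have e: "ennreal (s * (g x * indicator (box a b) x)) = ennreal (s * g x) * indicator (box a b) x" for s x
      by (simp add: indicator_def)
    show ?thesis
      using box[of a b] real_lebesgue_integral_def[OF int] fin'[of 1] fin'[of "-1"]
        e[of 1] e[of "-1"] by (simp add: less_top) (metis ennreal_enn2real)
  qed
  \<comment> \<open>\<open>ennreal\<close> truncates negative reals to 0, so the two densities are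
    the positive and the negative part of g.\<close>
  have "density lborel (\<lambda>x. ennreal (g x)) = density lborel (\<lambda>x. ennreal (- g x))"
  proof (rule measure_eqI_generator_eq[where E="range (\<lambda>(a, b). box a b::'a set)" and \<Omega>=UNIV
        and A="\<lambda>n::nat. box (- (real n *\<^sub>R One)) (real n *\<^sub>R One)"])
    show "Int_stable (range (\<lambda>(a, b). box a b::'a set))"
      by (auto simp: Int_stable_def box_Int_box)
    show "(\<Union>n::nat. box (- (real n *\<^sub>R One)) (real n *\<^sub>R One)::'a set) = UNIV"
      by (rule UN_box_eq_UNIV)
    show "emeasure (density lborel (\<lambda>x. ennreal (g x))) (box (- (real n *\<^sub>R One)) (real n *\<^sub>R One)) \<noteq> \<infinity>" for n :: nat
      using fin'[of 1] by (simp add: emeasure_density)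
    show "emeasure (density lborel (\<lambda>x. ennreal (g x))) X = emeasure (density lborel (\<lambda>x. ennreal (- g x))) X"
      if "X \<in> range (\<lambda>(a, b). box a b::'a set)" for X
      using that eq by (auto simp: emeasure_density)
  qed (auto simp: borel_eq_box)
  moreover have "sigma_finite_measure (density lborel (\<lambda>x. ennreal (g x)))"
  proof -
    have "finite_measure (density lborel (\<lambda>x. ennreal (g x)))"
      using fin'[of 1 UNIV] by (intro finite_measureI) (simp add: emeasure_density)
    then show ?thesis by (simp add: finite_measure_def)
  qed
  ultimately have "AE x in lborel. ennreal (g x) = ennreal (- g x)"
    by (subst (asm) sigma_finite_density_unique) auto
  then show ?thesis
  proof eventually_elim
    case (elim x)
    then show ?case by (cases "g x \<ge> 0") (auto simp: ennreal_neg ennreal_eq_0_iff)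
  qed
qed

text \<open>Multiplying by the indicator of a box makes F integrable, and a Borel representative of
  the product lives on \<open>lborel\<close>, where measures are compared. Its integral over another
  box is the integral of F over the intersection of both, again a box.\<close>

lemma fundamental_lemma:
  fixes F :: "'a::euclidean_space \<Rightarrow> real"
  assumes F: "F \<in> L1_loc"
    and orth: "\<And>\<phi>. \<phi> \<in> test_functions \<Longrightarrow> (\<integral>x. F x * \<phi> x \<partial>lebesgue) = 0"
  shows "AE x in lebesgue. F x = 0"
proof -
  have F_meas: "F \<in> borel_measurable lebesgue" using F by (rule L1_loc_measurable)
  have AE_box: "AE x in lebesgue. x \<in> box a b \<longrightarrow> F x = 0" for a b
  proof -
    obtain r where r: "\<And>x. x \<in> box a b \<Longrightarrow> norm x \<le> r"
      using bounded_box[of a b] by (auto simp: bounded_iff)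
    have ind_meas: "(\<lambda>x. indicator (box c d) x :: real) \<in> borel_measurable lebesgue" for c d :: 'a
      by (intro borel_measurable_indicator) simp
    have ind: "integrable lebesgue (\<lambda>x. F x * indicator (box a b) x)"
      by (rule L1_loc_integrable_mult[OF F ind_meas, where B=1 and r=r]) (use r in \<open>force simp: indicator_def\<close>)+
    then obtain g where [measurable]: "g \<in> borel_measurable lborel"
      and g: "AE x in lborel. F x * indicator (box a b) x = g x"
      using completion_ex_borel_measurable_real[OF borel_measurable_integrable[OF ind]] by blast
    note g' = AE_completion[OF g]
    have g_meas: "g \<in> borel_measurable lebesgue" by (rule measurable_completion) simp
    have "integrable lebesgue g"
      using integrable_cong_AE_imp[OF ind g_meas] g' by simp
    then have "integrable lborel g" by (simp add: integrable_completion)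
    moreover have "(\<integral>x. g x * indicator (box c d) x \<partial>lborel) = 0" for c d
    proof -
      have "(\<integral>x. g x * indicator (box c d) x \<partial>lborel) = (\<integral>x. g x * indicator (box c d) x \<partial>lebesgue)"
        by (rule integral_completion[symmetric]) measurable
      also have "\<dots> = (\<integral>x. (F x * indicator (box a b) x) * indicator (box c d) x \<partial>lebesgue)"
        using g' by (intro integral_cong_AE borel_measurable_times g_meas F_meas ind_meas) auto
      also have "\<dots> = (\<integral>x. F x * indicator (box a b \<inter> box c d) x \<partial>lebesgue)"
        by (simp add: indicator_inter_arith mult.assoc)
      also have "\<dots> = 0"
        unfolding box_Int_box by (rule fundamental_lemma_box[OF F orth])
      finally show ?thesis .
    qed
    ultimately have "AE x in lborel. g x = 0" by (rule AE_zero_of_box_integrals)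
    then have "AE x in lebesgue. g x = 0" by (rule AE_completion)
    with g' show ?thesis by eventually_elim (auto simp: indicator_def split: if_splits)
  qed
  have "AE x in lebesgue. \<forall>n::nat. x \<in> box (- (real n *\<^sub>R One)) (real n *\<^sub>R One) \<longrightarrow> F x = 0"
    by (subst AE_all_countable) (intro allI AE_box)
  then show ?thesis
  proof eventually_elim
    case (elim x)
    have "x \<in> (\<Union>n::nat. box (- (real n *\<^sub>R One)) (real n *\<^sub>R One))" by (simp only: UN_box_eq_UNIV UNIV_I)
    with elim show ?case by blast
  qed
qed

section \<open>Translates, and functions with vanishing weak gradient\<close>

lemma ex_borel_representative:
  fixes w :: "'a::euclidean_space \<Rightarrow> real"
  assumes "w \<in> borel_measurable lebesgue"
  obtains w' where "w' \<in> borel_measurable borel" "AE x in lebesgue. w x = w' x"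
  using completion_ex_borel_measurable_real[OF assms] AE_completion by force

lemma integrable_translate_iff:
  fixes f :: "'a::euclidean_space \<Rightarrow> 'b::{banach,second_countable_topology}"
  assumes [measurable]: "f \<in> borel_measurable borel"
  shows "integrable lborel (\<lambda>x. f (x + h)) \<longleftrightarrow> integrable lborel f"
proof -
  have "integrable (distr lborel borel ((+) h)) f \<longleftrightarrow> integrable lborel (\<lambda>x. f (h + x))"
    by (rule integrable_distr_eq) auto
  then show ?thesis by (simp add: lborel_distr_plus add.commute)
qed

lemma AE_translate_iff:
  fixes P :: "'a::euclidean_space \<Rightarrow> bool"
  assumes "{x. P x} \<in> sets borel"
  shows "(AE x in lborel. P (x + h)) \<longleftrightarrow> (AE x in lborel. P x)"
proof -
  have "(AE x in distr lborel borel ((+) h). P x) \<longleftrightarrow> (AE x in lborel. P (h + x))"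
    by (rule AE_distr_iff) (use assms in auto)
  then show ?thesis unfolding lborel_distr_plus by (simp add: add.commute)
qed

lemma L1_loc_cong_AE:
  assumes w: "w \<in> L1_loc" and w': "w' \<in> borel_measurable lebesgue"
    and eq: "AE x in lebesgue. w x = w' x"
  shows "w' \<in> L1_loc"
proof (rule L1_loc_bound[OF w w'])
  show "AE x in lebesgue. norm (w' x) \<le> norm (w x)" using eq by eventually_elim simp
qed

lemma L1_loc_borel_representative:
  fixes w :: "'a::euclidean_space \<Rightarrow> real"
  assumes w: "w \<in> L1_loc"
  obtains w' where "w' \<in> borel_measurable borel" "w' \<in> L1_loc" "AE x in lebesgue. w x = w' x"
proof -
  obtain w' where w': "w' \<in> borel_measurable borel" "AE x in lebesgue. w x = w' x"
    using ex_borel_representative[OF L1_loc_measurable[OF w]] by blast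
  have "w' \<in> borel_measurable lebesgue" by (rule measurable_completion) (simp add: w'(1))
  then have "w' \<in> L1_loc" by (rule L1_loc_cong_AE[OF w _ w'(2)])
  with w' show ?thesis by (intro that)
qed

lemma L1_loc_translate:
  fixes w :: "'a::euclidean_space \<Rightarrow> 'b::euclidean_space"
  assumes w: "w \<in> L1_loc" and w_meas[measurable]: "w \<in> borel_measurable borel"
  shows "(\<lambda>x. w (x + h)) \<in> L1_loc"
proof -
  have "set_integrable lebesgue K (\<lambda>x. w (x + h))" if K: "compact K" for K
  proof -
    define K' where "K' = (+) h ` K"
    have K': "compact K'" unfolding K'_def by (rule compact_translation[OF K])
    have [measurable]: "K \<in> sets borel" "K' \<in> sets borel" using K K' by (auto simp: borel_compact)
    have "integrable lebesgue (\<lambda>x. indicator K' x *\<^sub>R w x)"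
      using w K' by (simp add: L1_loc_def set_integrable_def)
    then have "integrable lborel (\<lambda>x. indicator K' x *\<^sub>R w x)"
      by (subst (asm) integrable_completion) measurable
    then have "integrable lborel (\<lambda>x. indicator K' (x + h) *\<^sub>R w (x + h))"
      by (subst integrable_translate_iff) measurable
    moreover have "indicator K' (x + h) = (indicator K x :: real)" for x
      by (auto simp: K'_def indicator_def image_iff add.commute)
    ultimately have int: "integrable lborel (\<lambda>x. indicator K x *\<^sub>R w (x + h))" by simp
    show ?thesis
      unfolding set_integrable_def using integrable_completion[OF borel_measurable_integrable[OF int]] int
      by simp
  qed
  moreover have "(\<lambda>x. w (x + h)) \<in> borel_measurable lebesgue"
    by (rule measurable_completion) measurable
  ultimately show ?thesis by (simp add: L1_loc_def)
qed

lemma dderiv_translate: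
  assumes "smooth f"
  shows "dderiv k (\<lambda>y. f (y + h)) = (\<lambda>y. dderiv k f (y + h))"
proof (rule dderiv_eq)
  have "((\<lambda>y. y + h) has_derivative (\<lambda>k. k)) (at y)" for y
    by (auto intro!: derivative_eq_intros)
  from has_derivative_compose[OF this smooth_has_derivative[OF assms]]
  show "((\<lambda>y. f (y + h)) has_derivative frechet_derivative f (at (y + h))) (at y)" for y .
qed

text \<open>The integrals of \<open>w\<close> against all translates of a test function agree, so each translate of \<open>w\<close>
  equals \<open>w\<close> almost everywhere; Fubini then produces one point whose value is the constant.\<close>

lemma AE_const_of_zero_gradient:
  fixes w :: "'a::euclidean_space \<Rightarrow> real"
  assumes w: "w \<in> L1_loc"
    and orth: "\<And>\<phi> h. \<phi> \<in> test_functions \<Longrightarrow> (\<integral>x. w x * dderiv h \<phi> x \<partial>lebesgue) = 0"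
  obtains c where "AE x in lebesgue. w x = c"
proof -
  \<comment> \<open>A Borel representative makes the set of pairs (y, h) with w'(y + h) = w'(y)
    measurable in the product, which the exchange of quantifiers below requires.\<close>
  obtain w' where w'_meas[measurable]: "w' \<in> borel_measurable borel" and w'_L1: "w' \<in> L1_loc"
    and w': "AE x in lebesgue. w x = w' x"
    using L1_loc_borel_representative[OF w] by blast
  note w'_meas2[measurable] = L1_loc_measurable[OF w'_L1]
  note [measurable] = L1_loc_measurable[OF w]
  \<comment> \<open>These are the derivatives of \<open>corr w' \<phi>\<close>: the hypothesis is
    used for the translate of \<phi> by h.\<close>
  have orth': "corr w' (dderiv k \<phi>) h = 0" if \<phi>: "\<phi> \<in> test_functions" for \<phi> h k
  proof -
    from fun_cong[OF dderiv_translate[OF test_smooth[OF \<phi>]]] orth[OF test_translate[OF \<phi>, of h], of k]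
    have 0: "(\<integral>y. w y * dderiv k \<phi> (y + h) \<partial>lebesgue) = 0" by (simp only:)
    have m: "(\<lambda>y. dderiv k \<phi> (y + h)) \<in> borel_measurable lebesgue"
      by (intro smooth_borel_measurable(2) test_smooth test_translate test_dderiv \<phi>)
    have "(\<integral>y. w' y * dderiv k \<phi> (y + h) \<partial>lebesgue) = (\<integral>y. w y * dderiv k \<phi> (y + h) \<partial>lebesgue)"
      by (intro integral_cong_AE borel_measurable_times m w'_meas2 L1_loc_measurable[OF w])
        (use w' in auto)
    with 0 show ?thesis by (simp add: corr_def)
  qed
  have const: "corr w' \<phi> h = corr w' \<phi> 0" if \<phi>: "\<phi> \<in> test_functions" for \<phi> h
  proof -
    have "(corr w' \<phi> has_derivative (\<lambda>k. 0)) (at x)" for x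
      using corr_has_derivative[OF w'_L1 \<phi>, of x] by (simp add: orth'[OF \<phi>])
    then have "\<exists>c. \<forall>x\<in>UNIV. corr w' \<phi> x = c"
      by (intro has_derivative_zero_constant) auto
    then show ?thesis by auto
  qed
  have transl: "AE y in lborel. w' (y + h) = w' y" for h
  proof -
    have L: "(\<lambda>y. w' (y + h)) \<in> L1_loc" by (rule L1_loc_translate[OF w'_L1 w'_meas])
    have "(\<lambda>y. w' (y + h) - w' y) \<in> L1_loc"
      using L w'_L1 by (auto simp: L1_loc_def intro: set_integral_diff)
    moreover have "(\<integral>y. (w' (y + h) - w' y) * \<phi> y \<partial>lebesgue) = 0" if \<phi>: "\<phi> \<in> test_functions" for \<phi>
    proof -
      note m[measurable] = smooth_borel_measurable(1)[OF test_smooth[OF \<phi>]]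
      have "(\<integral>y. w' (y + h) * \<phi> y \<partial>lebesgue) = (\<integral>y. w' (y + h) * \<phi> (y + h + - h) \<partial>lborel)"
        by (simp add: integral_completion)
      also have "\<dots> = (\<integral>y. w' y * \<phi> (y + - h) \<partial>lborel)"
        by (rule integral_translate[where f="\<lambda>y. w' y * \<phi> (y + - h)"]) measurable
      also have "\<dots> = corr w' \<phi> (- h)"
        unfolding corr_def by (rule integral_completion[symmetric]) measurable
      also have "\<dots> = (\<integral>y. w' y * \<phi> y \<partial>lebesgue)"
        using const[OF \<phi>, of "- h"] by (simp add: corr_def)
      finally show ?thesis
        using L1_loc_integrable_test[OF L \<phi>] L1_loc_integrable_test[OF w'_L1 \<phi>]
        by (simp add: left_diff_distrib)
    qed
    ultimately have "AE y in lebesgue. w' (y + h) - w' y = 0" by (rule fundamental_lemma)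
    then show ?thesis by (simp add: AE_completion_iff)
  qed
  \<comment> \<open>The exceptional set of y still depends on h. After the exchange a single good y
    serves almost every h, and one exists because \<open>lborel\<close> is not the zero
    measure.\<close>
  have "AE h in lborel. AE y in lborel. w' (y + h) = w' y" using transl by simp
  then have "AE y in lborel. AE h in lborel. w' (y + h) = w' y"
    by (subst (asm) lborel_pair.AE_commute) measurable
  moreover have "ae_filter lborel \<noteq> (bot :: 'a filter)"
    by (simp add: trivial_limit_def AE_iff_null null_sets_def)
  ultimately obtain y where "AE h in lborel. w' (y + h) = w' y"
    using eventually_happens' by blast
  then have "AE h in lborel. w' (h + y) = w' y" by (simp add: add.commute)
  then have "AE x in lborel. w' x = w' y"
    by (subst (asm) AE_translate_iff[of "\<lambda>x. w' x = w' y"]) measurable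
  then have "AE x in lebesgue. w' x = w' y" by (rule AE_completion)
  with w' have "AE x in lebesgue. w x = w' y" by eventually_elim simp
  then show ?thesis by (rule that)
qed

section \<open>The Poincare inequality for smooth functions\<close>

text \<open>A vector of the domain space, for scalar functions on any Euclidean space. The rows of
  the matrix-valued gradients are treated one at a time in this form.\<close>

definition grad :: "('a::euclidean_space \<Rightarrow> real) \<Rightarrow> 'a \<Rightarrow> 'a" where
  "grad W x = (\<Sum>b\<in>Basis. dderiv b W x *\<^sub>R b)"

lemma grad_inner: "smooth W \<Longrightarrow> grad W x \<bullet> h = dderiv h W x"
  by (subst dderiv_Basis_sum) (simp_all add: grad_def inner_sum_left inner_commute[of h] mult.commute)

lemma continuous_grad: "smooth W \<Longrightarrow> continuous_on S (grad W)"
  unfolding grad_def by (intro continuous_intros smooth_continuous smooth_dderiv)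

lemma grad_borel_measurable: "smooth W \<Longrightarrow> grad W \<in> borel_measurable borel"
  by (intro borel_measurable_continuous_onI continuous_grad)

text \<open>The fundamental theorem of calculus along the segment, followed by Cauchy-Schwarz on the
  unit interval.\<close>

lemma increment_le_line_integral:
  fixes W :: "'a::euclidean_space \<Rightarrow> real"
  assumes W: "smooth W"
  shows "ennreal ((W (x + h) - W x)\<^sup>2) \<le>
    ennreal ((norm h)\<^sup>2) * (\<integral>\<^sup>+t. indicator {0..1} t * ennreal ((norm (grad W (x + t *\<^sub>R h)))\<^sup>2) \<partial>lborel)"
proof -
  define g where "g t = grad W (x + t *\<^sub>R h) \<bullet> h" for t :: real
  define m where "m = W (x + h) - W x"
  have cont: "continuous_on S (\<lambda>t. grad W (x + t *\<^sub>R h))" for S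
    by (rule continuous_on_compose2[OF continuous_grad[OF W, of UNIV]]) (auto intro!: continuous_intros)
  have "((\<lambda>t. W (x + t *\<^sub>R h)) has_vector_derivative g t) (at t)" for t
  proof -
    have "((\<lambda>t. x + t *\<^sub>R h) has_derivative (\<lambda>s. s *\<^sub>R h)) (at t)"
      by (auto intro!: derivative_eq_intros)
    from has_derivative_compose[OF this smooth_has_derivative[OF W]]
    have "((\<lambda>t. W (x + t *\<^sub>R h)) has_derivative (\<lambda>s. dderiv (s *\<^sub>R h) W (x + t *\<^sub>R h))) (at t)" .
    then show ?thesis
      by (simp add: has_vector_derivative_def g_def grad_inner[OF W, symmetric])
  qed
  then have "(g has_integral (W (x + 1 *\<^sub>R h) - W (x + 0 *\<^sub>R h))) {0..1}"
    by (intro fundamental_theorem_of_calculus) (auto intro: has_vector_derivative_at_within)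
  then have gm: "(g has_integral m) {0..1}" by (simp add: m_def)
  define N where "N t = (norm (grad W (x + t *\<^sub>R h)))\<^sup>2" for t :: real
  have "N integrable_on {0..1}"
    unfolding N_def by (intro integrable_continuous_real continuous_intros cont)
  then obtain I where I: "(N has_integral I) {0..1}" by blast
  \<comment> \<open>The integrand is at least (g - m)^2, and since g integrates to m its integral is
    |h|^2 I - m^2. Nonnegativity is the required inequality.\<close>
  have int: "((\<lambda>t. (norm h)\<^sup>2 * N t - 2 * m * g t + m\<^sup>2) has_integral (norm h)\<^sup>2 * I - 2 * m * m + m\<^sup>2) {0..1}"
    using has_integral_const_real[of "m\<^sup>2" 0 1]
    by (intro has_integral_add has_integral_diff has_integral_mult_right I gm) simp
  have "(norm h)\<^sup>2 * N t - 2 * m * g t + m\<^sup>2 \<ge> 0" for t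
  proof -
    have "(g t)\<^sup>2 \<le> (norm h)\<^sup>2 * N t"
      using power_mono[OF Cauchy_Schwarz_ineq2[of "grad W (x + t *\<^sub>R h)" h], of 2]
      by (simp add: g_def N_def power_mult_distrib mult.commute)
    moreover have "(g t - m)\<^sup>2 \<ge> 0" by simp
    ultimately show ?thesis by (simp add: power2_diff mult_ac)
  qed
  with has_integral_nonneg[OF int] have "m\<^sup>2 \<le> (norm h)\<^sup>2 * I"
    by (simp add: power2_eq_square)
  moreover have "(\<integral>\<^sup>+t. indicator {0..1} t * ennreal (N t) \<partial>lborel) = ennreal I"
    using nn_integral_has_integral_lebesgue[of "{0..1}" N I] I
    by (simp add: N_def ennreal_mult' ennreal_indicator)
  moreover have "I \<ge> 0" using has_integral_nonneg[OF I] by (simp add: N_def)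
  ultimately show ?thesis by (simp add: m_def N_def ennreal_mult[symmetric] ennreal_leI)
qed

lemma nn_integral_translate:
  fixes f :: "'a::euclidean_space \<Rightarrow> ennreal"
  assumes [measurable]: "f \<in> borel_measurable borel"
  shows "(\<integral>\<^sup>+x. f (x + h) \<partial>lborel) = (\<integral>\<^sup>+x. f x \<partial>lborel)"
proof -
  have "(\<integral>\<^sup>+x. f x \<partial>distr lborel borel ((+) h)) = (\<integral>\<^sup>+x. f (h + x) \<partial>lborel)"
    by (rule nn_integral_distr) auto
  then show ?thesis unfolding lborel_distr_plus by (simp add: add.commute)
qed

text \<open>Convexity keeps the segment from x to x + h inside \<open>Q\<close>, so only the
  gradient on \<open>Q\<close> is seen. Tonelli and translation invariance then make the parameter t
  along the segment disappear.\<close>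

lemma translation_increment_bound:
  fixes W :: "'a::euclidean_space \<Rightarrow> real"
  assumes W: "smooth W" and Q: "convex Q" and Q_meas[measurable]: "Q \<in> sets borel"
  shows "(\<integral>\<^sup>+x. indicator Q x * indicator Q (x + h) * ennreal ((W (x + h) - W x)\<^sup>2) \<partial>lborel)
    \<le> ennreal ((norm h)\<^sup>2) * (\<integral>\<^sup>+x. indicator Q x * ennreal ((norm (grad W x))\<^sup>2) \<partial>lborel)"
proof -
  note [measurable] = grad_borel_measurable[OF W]
  define G :: "'a \<Rightarrow> ennreal" where "G x = indicator Q x * ennreal ((norm (grad W x))\<^sup>2)" for x
  have [measurable]: "G \<in> borel_measurable borel" unfolding G_def by measurable
  have "(\<integral>\<^sup>+x. indicator Q x * indicator Q (x + h) * ennreal ((W (x + h) - W x)\<^sup>2) \<partial>lborel)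
      \<le> (\<integral>\<^sup>+x. ennreal ((norm h)\<^sup>2) * (\<integral>\<^sup>+t. indicator {0..1} t * G (x + t *\<^sub>R h) \<partial>(lborel::real measure)) \<partial>lborel)"
  proof (rule nn_integral_mono)
    fix x
    show "indicator Q x * indicator Q (x + h) * ennreal ((W (x + h) - W x)\<^sup>2)
        \<le> ennreal ((norm h)\<^sup>2) * (\<integral>\<^sup>+t. indicator {0..1} t * G (x + t *\<^sub>R h) \<partial>(lborel::real measure))"
    proof (cases "x \<in> Q \<and> x + h \<in> Q")
      case True
      have seg: "x + t *\<^sub>R h \<in> Q" if "t \<in> {0..1}" for t
      proof -
        have "(1 - t) *\<^sub>R x + t *\<^sub>R (x + h) \<in> Q"
          using that True by (intro convexD[OF Q]) auto
        then show ?thesis by (simp add: algebra_simps)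
      qed
      have "(\<integral>\<^sup>+t. indicator {0..1} t * ennreal ((norm (grad W (x + t *\<^sub>R h)))\<^sup>2) \<partial>lborel) =
          (\<integral>\<^sup>+t. indicator {0..1} t * G (x + t *\<^sub>R h) \<partial>(lborel::real measure))"
        using seg by (intro nn_integral_cong) (simp add: G_def indicator_def)
      then show ?thesis using True increment_le_line_integral[OF W, of x h] by simp
    qed auto
  qed
  also have "\<dots> = ennreal ((norm h)\<^sup>2) * (\<integral>\<^sup>+x. \<integral>\<^sup>+t. indicator {0..1} t * G (x + t *\<^sub>R h) \<partial>(lborel::real measure) \<partial>lborel)"
    by (rule nn_integral_cmult) measurable
  also have "(\<integral>\<^sup>+x. \<integral>\<^sup>+t. indicator {0..1} t * G (x + t *\<^sub>R h) \<partial>(lborel::real measure) \<partial>lborel) =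
      (\<integral>\<^sup>+t. \<integral>\<^sup>+x. indicator {0..1} t * G (x + t *\<^sub>R h) \<partial>lborel \<partial>(lborel::real measure))"
    by (rule lborel_pair.Fubini'[symmetric]) measurable
  also have "\<dots> = (\<integral>\<^sup>+t. indicator {0..1} t * (\<integral>\<^sup>+x. G x \<partial>lborel) \<partial>(lborel::real measure))"
    by (intro nn_integral_cong) (simp add: nn_integral_cmult nn_integral_translate)
  also have "\<dots> = (\<integral>\<^sup>+x. G x \<partial>lborel)"
    by (simp add: nn_integral_multc)
  finally show ?thesis by (simp add: G_def)
qed

text \<open>Substituting y = x + h, only h with |h| at most 2r occur, because x and y lie in a ball
  of radius r. The translation bound is integrated over this ball of increments, which yields both
  constants.\<close>

lemma double_increment_bound:
  fixes W :: "'a::euclidean_space \<Rightarrow> real" and r :: real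
  assumes W: "smooth W"
  defines "Q \<equiv> cball 0 r"
  shows "(\<integral>\<^sup>+x. \<integral>\<^sup>+y. indicator Q x * indicator Q y * ennreal ((W y - W x)\<^sup>2) \<partial>lborel \<partial>lborel)
    \<le> ennreal ((2 * r)\<^sup>2) * emeasure lborel (cball (0::'a) (2 * r)) *
      (\<integral>\<^sup>+x. indicator Q x * ennreal ((norm (grad W x))\<^sup>2) \<partial>lborel)" (is "_ \<le> ?K * _ * ?G")
proof -
  have [measurable]: "Q \<in> sets borel" by (simp add: Q_def)
  note [measurable] = grad_borel_measurable[OF W] smooth_borel_measurable(1)[OF W]
  have "(\<integral>\<^sup>+x. \<integral>\<^sup>+y. indicator Q x * indicator Q y * ennreal ((W y - W x)\<^sup>2) \<partial>lborel \<partial>lborel) =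
      (\<integral>\<^sup>+x. \<integral>\<^sup>+h. indicator Q x * indicator Q (h + x) * ennreal ((W (h + x) - W x)\<^sup>2) \<partial>lborel \<partial>lborel)"
    by (intro nn_integral_cong nn_integral_translate[symmetric]) measurable
  also have "\<dots> = (\<integral>\<^sup>+h. \<integral>\<^sup>+x. indicator Q x * indicator Q (h + x) * ennreal ((W (h + x) - W x)\<^sup>2) \<partial>lborel \<partial>lborel)"
    by (rule lborel_pair.Fubini'[symmetric]) measurable
  also have "\<dots> \<le> (\<integral>\<^sup>+h. ?K * ?G * indicator (cball (0::'a) (2 * r)) h \<partial>lborel)"
  proof (rule nn_integral_mono)
    fix h :: 'a
    show "(\<integral>\<^sup>+x. indicator Q x * indicator Q (h + x) * ennreal ((W (h + x) - W x)\<^sup>2) \<partial>lborel)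
        \<le> ?K * ?G * indicator (cball 0 (2 * r)) h"
    proof (cases "norm h \<le> 2 * r")
      case True
      have "(\<integral>\<^sup>+x. indicator Q x * indicator Q (h + x) * ennreal ((W (h + x) - W x)\<^sup>2) \<partial>lborel)
          \<le> ennreal ((norm h)\<^sup>2) * ?G"
        using translation_increment_bound[OF W, of Q h] by (simp add: Q_def add.commute)
      also have "\<dots> \<le> ?K * ?G"
        using True by (intro mult_right_mono ennreal_leI power_mono) auto
      finally show ?thesis using True by simp
    next
      case False
      have "indicator Q x * indicator Q (h + x) * ennreal ((W (h + x) - W x)\<^sup>2) = 0" for x
        using False norm_triangle_ineq4[of "h + x" x] by (auto simp: Q_def indicator_def)
      then show ?thesis by (simp only: nn_integral_const mult_zero_left zero_le)
    qed
  qed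
  also have "\<dots> = ?K * ?G * emeasure lborel (cball (0::'a) (2 * r))"
    by (rule nn_integral_cmult_indicator) simp
  finally show ?thesis by (simp add: mult_ac)
qed

text \<open>The radius \<open>s\<close> is kept apart from the radius of the ball in the Poincare
  inequality: the limit argument uses the mean over one fixed unit ball for all larger balls, the
  Liouville theorem the mean over the whole ball.\<close>

definition ball_mean :: "real \<Rightarrow> ('a::euclidean_space \<Rightarrow> real) \<Rightarrow> real" where
  "ball_mean s W = (\<integral>y. indicator (cball 0 s) y * W y \<partial>lborel) / measure lborel (cball (0::'a) s)"

text \<open>Jensen's inequality: the deviation from the mean is an average of increments, and its
  square is at most the average of their squares.\<close>

lemma ball_mean_deviation:
  fixes W :: "'a::euclidean_space \<Rightarrow> real"
  assumes W: "smooth W" and s: "s > 0"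
  shows "ennreal ((W x - ball_mean s W)\<^sup>2 * measure lborel (cball (0::'a) s)) \<le>
    (\<integral>\<^sup>+y. indicator (cball 0 s) y * ennreal ((W y - W x)\<^sup>2) \<partial>lborel)"
proof -
  define A where "A = cball (0::'a) s"
  define \<mu> where "\<mu> = measure lborel A"
  have \<mu>: "\<mu> > 0" using s by (simp add: \<mu>_def A_def)
  have int: "integrable lborel (\<lambda>y. indicator A y * f y)" if "continuous_on UNIV f" for f :: "'a \<Rightarrow> real"
    using borel_integrable_compact[of A f] continuous_on_subset[OF that] by (simp add: A_def)
  note cW = smooth_continuous[OF W, of UNIV]
  define m where "m = ball_mean s W - W x"
  have m: "(\<integral>y. indicator A y * (W y - W x) \<partial>lborel) = m * \<mu>"
  proof -
    have "(\<integral>y. indicator A y * (W y - W x) \<partial>lborel) = (\<integral>y. indicator A y * W y - indicator A y * W x \<partial>lborel)"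
      by (simp add: right_diff_distrib)
    also have "\<dots> = (\<integral>y. indicator A y * W y \<partial>lborel) - (\<integral>y. indicator A y * W x \<partial>lborel)"
      by (intro Bochner_Integration.integral_diff int cW continuous_on_const)
    also have "(\<integral>y. indicator A y * W x \<partial>lborel) = \<mu> * W x"
      by (simp add: \<mu>_def A_def)
    finally show ?thesis using \<mu> by (simp add: m_def ball_mean_def A_def[symmetric] \<mu>_def[symmetric] left_diff_distrib)
  qed
  \<comment> \<open>The variance of the increments over the ball is nonnegative; expanding the
    square with \<open>m\<close> gives the inequality.\<close>
  have "0 \<le> (\<integral>y. indicator A y * ((W y - W x) - m)\<^sup>2 \<partial>lborel)"
    by (intro Bochner_Integration.integral_nonneg) simp
  also have "\<dots> = (\<integral>y. indicator A y * (W y - W x)\<^sup>2 - 2 * m * (indicator A y * (W y - W x)) + indicator A y * m\<^sup>2 \<partial>lborel)"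
    by (intro Bochner_Integration.integral_cong refl) (simp add: power2_eq_square algebra_simps)
  also have "\<dots> = (\<integral>y. indicator A y * (W y - W x)\<^sup>2 \<partial>lborel) - 2 * m * (m * \<mu>) + (\<integral>y. indicator A y * m\<^sup>2 \<partial>lborel)"
    unfolding m[symmetric]
    by (subst Bochner_Integration.integral_add Bochner_Integration.integral_diff,
        (intro Bochner_Integration.integrable_diff integrable_mult_right int continuous_intros cW)+)+ simp
  also have "(\<integral>y. indicator A y * m\<^sup>2 \<partial>lborel) = \<mu> * m\<^sup>2"
    by (simp add: \<mu>_def A_def)
  finally have "m\<^sup>2 * \<mu> \<le> (\<integral>y. indicator A y * (W y - W x)\<^sup>2 \<partial>lborel)"
    by (simp add: power2_eq_square algebra_simps)
  then have "ennreal (m\<^sup>2 * \<mu>) \<le> ennreal (\<integral>y. indicator A y * (W y - W x)\<^sup>2 \<partial>lborel)"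
    by (rule ennreal_leI)
  also have "\<dots> = (\<integral>\<^sup>+y. ennreal (indicator A y * (W y - W x)\<^sup>2) \<partial>lborel)"
    by (intro nn_integral_eq_integral[symmetric] int continuous_intros cW) simp
  also have "\<dots> = (\<integral>\<^sup>+y. indicator A y * ennreal ((W y - W x)\<^sup>2) \<partial>lborel)"
    by (intro nn_integral_cong) (simp add: indicator_def)
  finally show ?thesis by (simp add: m_def A_def \<mu>_def power2_commute)
qed

text \<open>The constant of \<open>double_increment_bound\<close> divided by the volume of the ball
  that carries the mean. The first argument only conveys the space, on whose dimension the volumes
  depend.\<close>

definition poincare_const :: "'a::euclidean_space itself \<Rightarrow> real \<Rightarrow> real \<Rightarrow> real" where
  "poincare_const _ s r =
    (2 * r)\<^sup>2 * measure lborel (cball (0::'a) (2 * r)) / measure lborel (cball (0::'a) s)"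

text \<open>Jensen bounds the deviation by an integral of squared increments over the small ball;
  enlarging that ball to radius r gives the symmetric double integral already estimated.\<close>

lemma Poincare:
  fixes W :: "'a::euclidean_space \<Rightarrow> real"
  assumes W: "smooth W" and s: "0 < s" "s \<le> r"
  shows "(\<integral>\<^sup>+x. indicator (cball 0 r) x * ennreal ((W x - ball_mean s W)\<^sup>2) \<partial>lborel)
    \<le> ennreal (poincare_const TYPE('a) s r) *
      (\<integral>\<^sup>+x. indicator (cball 0 r) x * ennreal ((norm (grad W x))\<^sup>2) \<partial>lborel)"
proof -
  define \<mu> where "\<mu> = measure lborel (cball (0::'a) s)"
  have \<mu>: "\<mu> > 0" using s by (simp add: \<mu>_def)
  note [measurable] = smooth_borel_measurable(1)[OF W]
  define L where "L = (\<integral>\<^sup>+x. indicator (cball 0 r) x * ennreal ((W x - ball_mean s W)\<^sup>2) \<partial>lborel)"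
  define G where "G = (\<integral>\<^sup>+x. indicator (cball 0 r) x * ennreal ((norm (grad W x))\<^sup>2) \<partial>lborel)"
  have [measurable]: "cball (0::'a) r \<in> sets borel" by simp
  have meas: "(\<lambda>x. indicator (cball 0 r) x * ennreal ((W x - c)\<^sup>2)) \<in> borel_measurable lborel" for c
    by measurable
  have "ennreal \<mu> * L =
      (\<integral>\<^sup>+x. indicator (cball 0 r) x * ennreal ((W x - ball_mean s W)\<^sup>2 * \<mu>) \<partial>lborel)"
  proof -
    have "ennreal \<mu> * L = (\<integral>\<^sup>+x. ennreal \<mu> * (indicator (cball 0 r) x * ennreal ((W x - ball_mean s W)\<^sup>2)) \<partial>lborel)"
      unfolding L_def by (rule nn_integral_cmult[symmetric]) (rule meas)
    then show ?thesis
      using \<mu> by (simp add: ennreal_mult mult_ac)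
  qed
  also have "\<dots> \<le> (\<integral>\<^sup>+x. indicator (cball 0 r) x *
      (\<integral>\<^sup>+y. indicator (cball 0 s) y * ennreal ((W y - W x)\<^sup>2) \<partial>lborel) \<partial>lborel)"
    unfolding \<mu>_def by (intro nn_integral_mono mult_left_mono ball_mean_deviation W s) auto
  also have "\<dots> \<le> (\<integral>\<^sup>+x. \<integral>\<^sup>+y. indicator (cball 0 r) x * indicator (cball 0 r) y * ennreal ((W y - W x)\<^sup>2) \<partial>lborel \<partial>lborel)"
  proof (rule nn_integral_mono)
    fix x
    have "(\<integral>\<^sup>+y. indicator (cball 0 s) y * ennreal ((W y - W x)\<^sup>2) \<partial>lborel) \<le>
        (\<integral>\<^sup>+y. indicator (cball 0 r) y * ennreal ((W y - W x)\<^sup>2) \<partial>lborel)"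
      using s by (intro nn_integral_mono mult_right_mono) (auto simp: indicator_def)
    then show "indicator (cball 0 r) x * (\<integral>\<^sup>+y. indicator (cball 0 s) y * ennreal ((W y - W x)\<^sup>2) \<partial>lborel)
        \<le> (\<integral>\<^sup>+y. indicator (cball 0 r) x * indicator (cball 0 r) y * ennreal ((W y - W x)\<^sup>2) \<partial>lborel)"
      by (simp add: indicator_def)
  qed
  also have "\<dots> \<le> ennreal ((2 * r)\<^sup>2) * emeasure lborel (cball (0::'a) (2 * r)) * G"
    unfolding G_def by (rule double_increment_bound[OF W])
  also have "\<dots> = ennreal \<mu> * (ennreal (poincare_const TYPE('a) s r) * G)"
  proof -
    have "emeasure lborel (cball (0::'a) (2 * r)) = ennreal (measure lborel (cball (0::'a) (2 * r)))"
      by (rule emeasure_eq_ennreal_measure) (use s in \<open>simp add: emeasure_cball\<close>)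
    moreover have "ennreal ((2 * r)\<^sup>2) * ennreal (measure lborel (cball (0::'a) (2 * r))) =
        ennreal \<mu> * ennreal (poincare_const TYPE('a) s r)"
      using \<mu> unfolding ennreal_mult[OF zero_le_power2 measure_nonneg, symmetric]
      by (subst ennreal_mult[symmetric]) (auto simp: poincare_const_def \<mu>_def[symmetric])
    ultimately show ?thesis by (simp only: mult.assoc)
  qed
  finally have "ennreal \<mu> * L \<le> ennreal \<mu> * (ennreal (poincare_const TYPE('a) s r) * G)" .
  then show ?thesis
    unfolding L_def[symmetric] G_def[symmetric]
    using \<mu> by (subst (asm) ennreal_mult_le_mult_iff) auto
qed

text \<open>Volumes of balls scale with the power \<open>DIM('a)\<close> of the radius. What matters
  is the growth as r^2: it exactly compensates the decay of the gradient of a rescaled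
  cutoff.\<close>

lemma poincare_const_same:
  "r > 0 \<Longrightarrow> poincare_const TYPE('a::euclidean_space) r r = 4 * 2 ^ DIM('a) * r\<^sup>2"
  using less_imp_neq[OF unit_ball_vol_pos[of "real DIM('a)"]]
  by (simp add: poincare_const_def content_cball power_mult_distrib)

section \<open>Weak gradients\<close>

lemma L2_I_support:
  fixes f :: "'a::euclidean_space \<Rightarrow> 'b::euclidean_space"
  assumes f: "f \<in> borel_measurable lebesgue" and B: "\<And>x. norm (f x) \<le> B"
    and r: "\<And>x. norm x > r \<Longrightarrow> f x = 0"
  shows "f \<in> L2"
proof (rule L2_I[OF f])
  have "integrable lborel (\<lambda>x. indicator (cball (0::'a) r) x *\<^sub>R B\<^sup>2)"
    by (intro borel_integrable_compact continuous_on_const compact_cball)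
  then show "integrable lebesgue (\<lambda>x. indicator (cball (0::'a) r) x *\<^sub>R B\<^sup>2)"
    by (subst integrable_completion) (auto dest: borel_measurable_integrable)
  show "AE x in lebesgue. (norm (f x))\<^sup>2 \<le> indicator (cball (0::'a) r) x *\<^sub>R B\<^sup>2"
  proof (rule AE_I2)
    fix x show "(norm (f x))\<^sup>2 \<le> indicator (cball (0::'a) r) x *\<^sub>R B\<^sup>2"
      using power_mono[OF B[of x], of 2] r[of x] by (cases "norm x \<le> r") auto
  qed
qed

lemma test_L2:
  fixes \<phi> :: "'a::euclidean_space \<Rightarrow> 'b::euclidean_space"
  assumes "\<phi> \<in> test_functions" shows "\<phi> \<in> L2"
proof -
  obtain r where r: "\<And>x. norm x > r \<Longrightarrow> \<phi> x = 0" using test_support[OF assms] by blast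
  obtain B where B: "\<And>x. norm (\<phi> x) \<le> B" using test_bounded[OF assms] by blast
  have "\<phi> \<in> borel_measurable lebesgue"
    by (intro measurable_completion) (simp add: borel_measurable_continuous_onI smooth_continuous test_smooth assms)
  then show ?thesis using B r by (rule L2_I_support)
qed

lemma L2_indicator:
  assumes f: "f \<in> L2" and A: "A \<in> sets lebesgue"
  shows "(\<lambda>x. indicator A x *\<^sub>R f x) \<in> L2"
proof (rule L2_I[OF _ L2_integrable[OF f]])
  show "(\<lambda>x. indicator A x *\<^sub>R f x) \<in> borel_measurable lebesgue"
    by (intro borel_measurable_scaleR borel_measurable_indicator A L2_measurable f)
  show "AE x in lebesgue. (norm (indicator A x *\<^sub>R f x))\<^sup>2 \<le> (norm (f x))\<^sup>2"
    by (intro AE_I2) (simp add: indicator_def)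
qed

lemma L2_loc_iff:
  "f \<in> L2_loc \<longleftrightarrow> f \<in> borel_measurable lebesgue \<and> (\<lambda>x. (norm (f x))\<^sup>2) \<in> L1_loc"
  unfolding L2_loc_def L1_loc_def
  by (auto intro: borel_measurable_power measurable_compose[OF _ borel_measurable_norm])

lemma L2_loc_L1_loc:
  assumes f: "f \<in> L2_loc" shows "f \<in> L1_loc"
proof (rule L1_loc_bound)
  have "(\<lambda>x. 1) \<in> L1_loc" by (rule continuous_L1_loc) simp
  then show "(\<lambda>x. 1 *\<^sub>R 1 + 1 *\<^sub>R (norm (f x))\<^sup>2) \<in> L1_loc"
    using f by (intro L1_loc_lincomb) (auto simp: L2_loc_iff)
  have "norm (f x) \<le> 1 + (norm (f x))\<^sup>2" for x
  proof -
    have "2 * norm (f x) \<le> 1 + (norm (f x))\<^sup>2"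
      using sum_squares_bound[of 1 "norm (f x)"] by simp
    with norm_ge_zero[of "f x"] show ?thesis by linarith
  qed
  then show "AE x in lebesgue. norm (f x) \<le> norm (1 *\<^sub>R 1 + 1 *\<^sub>R (norm (f x))\<^sup>2)" by simp
qed (use f in \<open>simp add: L2_loc_def\<close>)

lemma L2_L2_loc: "f \<in> L2 \<Longrightarrow> f \<in> L2_loc"
  unfolding L2_def L2_loc_def set_integrable_def real_scaleR_def
  by (auto intro!: integrable_mult_indicator[where 'b=real, unfolded real_scaleR_def] simp: borel_compact)

lemma L2_L1_loc: "f \<in> L2 \<Longrightarrow> f \<in> L1_loc"
  by (simp add: L2_L2_loc L2_loc_L1_loc)

lemma smooth_indicator_ball_L2:
  fixes W :: "'a::euclidean_space \<Rightarrow> real"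
  assumes W: "smooth W"
  shows "(\<lambda>x. indicator (cball 0 r) x * W x) \<in> L2"
proof -
  have "compact (W ` cball 0 r)"
    by (intro compact_continuous_image smooth_continuous W compact_cball)
  then obtain B where B: "B > 0" "\<forall>y\<in>W ` cball 0 r. norm y \<le> B"
    using compact_imp_bounded bounded_pos by metis
  show ?thesis
  proof (rule L2_I_support[of _ B r])
    show "(\<lambda>x. indicator (cball 0 r) x * W x) \<in> borel_measurable lebesgue"
      by (intro borel_measurable_times borel_measurable_indicator smooth_borel_measurable W) simp
  qed (use B in \<open>auto simp: indicator_def\<close>)
qed

lemma grad_component: "b \<in> Basis \<Longrightarrow> grad W x \<bullet> b = dderiv b W x"
  by (simp add: grad_def inner_sum_left inner_Basis if_distrib sum.delta' cong: if_cong)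

lemma test_grad_bounded:
  fixes \<phi> :: "'a::euclidean_space \<Rightarrow> real"
  assumes "\<phi> \<in> test_functions"
  obtains B where "B \<ge> 0" "\<And>x. norm (grad \<phi> x) \<le> B"
proof -
  obtain L where L: "L \<ge> 0" "\<And>x h. \<bar>dderiv h \<phi> x\<bar> \<le> L * norm h"
    using test_lipschitz[OF assms] by metis
  have "norm (grad \<phi> x) \<le> (\<Sum>b\<in>(Basis::'a set). L)" for x
    unfolding grad_def
  proof (intro order_trans[OF norm_sum] sum_mono)
    fix b :: 'a assume "b \<in> Basis"
    then show "norm (dderiv b \<phi> x *\<^sub>R b) \<le> L" using L(2)[of x b] by simp
  qed
  moreover have "(\<Sum>b\<in>(Basis::'a set). L) \<ge> 0" using L(1) by simp
  ultimately show ?thesis using that by blast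
qed

lemma grad_test_L2:
  fixes \<phi> :: "'a::euclidean_space \<Rightarrow> real"
  assumes "\<phi> \<in> test_functions" shows "grad \<phi> \<in> L2"
proof -
  obtain r where r: "\<And>x. norm x > r \<Longrightarrow> \<phi> x = 0" using test_support[OF assms] by blast
  obtain B where B: "\<And>x. norm (grad \<phi> x) \<le> B"
    using test_grad_bounded[OF assms] by metis
  show ?thesis
  proof (rule L2_I_support[OF _ B])
    show "grad \<phi> \<in> borel_measurable lebesgue"
      by (intro measurable_completion) (simp add: grad_borel_measurable test_smooth assms)
    show "grad \<phi> x = 0" if "norm x > r" for x
      unfolding grad_def using dderiv_zero_outside[of r \<phi> x] r that by simp
  qed
qed

lemma grad_diff:
  fixes f g :: "'a::euclidean_space \<Rightarrow> real"
  assumes "smooth f" "smooth g"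
  shows "grad (\<lambda>x. f x - g x) x = grad f x - grad g x"
proof -
  have "dderiv h (\<lambda>x. f x - g x) = (\<lambda>x. dderiv h f x - dderiv h g x)" for h
    by (rule dderiv_eq) (intro has_derivative_diff smooth_has_derivative assms)
  from fun_cong[OF this] show ?thesis
    by (simp add: grad_def scaleR_left_diff_distrib sum_subtractf)
qed

lemma smooth_uminus: "smooth f \<Longrightarrow> smooth (\<lambda>x. - f x)"
  by (rule smooth_bounded_linear[OF bounded_linear_minus[OF bounded_linear_ident]])

lemma smooth_diff: "smooth f \<Longrightarrow> smooth g \<Longrightarrow> smooth (\<lambda>x. f x - g x)"
  using smooth_add[of f "\<lambda>x. - g x"] smooth_uminus[of g] by simp

lemma test_diff: "f \<in> test_functions \<Longrightarrow> g \<in> test_functions \<Longrightarrow> (\<lambda>x. f x - g x) \<in> test_functions"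
  using test_add[of f "\<lambda>x. - g x"] test_bounded_linear[OF bounded_linear_minus[OF bounded_linear_ident], of g]
  by simp

lemma grad_minus_const: "smooth f \<Longrightarrow> grad (\<lambda>x. f x - c) x = grad f x"
  using grad_diff[OF _ smooth_const, of f c x] by (simp add: grad_def frechet_derivative_const)

text \<open>The integral identity of \<open>is_weak_gradient\<close> for one scalar component,
  separated from the integrability conditions.\<close>

definition weak_grad :: "('a::euclidean_space \<Rightarrow> real) \<Rightarrow> ('a \<Rightarrow> 'a) \<Rightarrow> bool" where
  "weak_grad w F \<longleftrightarrow> (\<forall>\<phi>\<in>test_functions. \<forall>b\<in>Basis.
     (\<integral>x. w x * dderiv b \<phi> x \<partial>lebesgue) = - (\<integral>x. (F x \<bullet> b) * \<phi> x \<partial>lebesgue))"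

lemma weak_grad_smooth:
  assumes "smooth w" shows "weak_grad w (grad w)"
  unfolding weak_grad_def by (simp add: integration_by_parts assms grad_component)

lemma ball_mean_diff:
  fixes f g :: "'a::euclidean_space \<Rightarrow> real"
  assumes "smooth f" "smooth g"
  shows "ball_mean s (\<lambda>x. f x - g x) = ball_mean s f - ball_mean s g"
proof -
  have "integrable lborel (\<lambda>x. indicator (cball 0 s) x * f x)" if "smooth f" for f :: "'a \<Rightarrow> real"
    using borel_integrable_compact[of "cball 0 s" f] smooth_continuous[OF that] by simp
  then show ?thesis
    unfolding ball_mean_def using assms by (simp add: right_diff_distrib diff_divide_distrib)
qed

text \<open>The inequality in Hilbert space norms, the form in which it shows that sequences are
  Cauchy.\<close>

lemma Poincare_l2:
  fixes W :: "'a::euclidean_space \<Rightarrow> real"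
  assumes W: "smooth W" "grad W \<in> L2" and s: "0 < s" "s \<le> r"
  shows "(norm (abs_l2 (\<lambda>x. indicator (cball 0 r) x * (W x - ball_mean s W))))\<^sup>2
    \<le> poincare_const TYPE('a) s r * (norm (abs_l2 (grad W)))\<^sup>2"
proof -
  define f where "f x = indicator (cball 0 r) x * (W x - ball_mean s W)" for x
  have fL: "f \<in> L2"
    unfolding f_def by (intro smooth_indicator_ball_L2 smooth_diff W smooth_const)
  have pc: "poincare_const TYPE('a) s r \<ge> 0" by (simp add: poincare_const_def)
  have "ennreal ((norm (abs_l2 f))\<^sup>2) = (\<integral>\<^sup>+x. ennreal ((norm (f x))\<^sup>2) \<partial>lborel)"
    by (simp add: nn_integral_norm_power2[OF fL, symmetric] nn_integral_completion)
  also have "\<dots> = (\<integral>\<^sup>+x. indicator (cball 0 r) x * ennreal ((W x - ball_mean s W)\<^sup>2) \<partial>lborel)"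
    by (intro nn_integral_cong) (simp add: f_def indicator_def)
  also have "\<dots> \<le> ennreal (poincare_const TYPE('a) s r) *
      (\<integral>\<^sup>+x. indicator (cball 0 r) x * ennreal ((norm (grad W x))\<^sup>2) \<partial>lborel)"
    by (rule Poincare[OF W(1) s])
  also have "\<dots> \<le> ennreal (poincare_const TYPE('a) s r) * (\<integral>\<^sup>+x. ennreal ((norm (grad W x))\<^sup>2) \<partial>lborel)"
    by (intro mult_left_mono nn_integral_mono) (auto simp: indicator_def)
  also have "(\<integral>\<^sup>+x. ennreal ((norm (grad W x))\<^sup>2) \<partial>lborel) = ennreal ((norm (abs_l2 (grad W)))\<^sup>2)"
    by (simp add: nn_integral_norm_power2[OF W(2), symmetric] nn_integral_completion)
  finally have "ennreal ((norm (abs_l2 f))\<^sup>2) \<le> ennreal (poincare_const TYPE('a) s r * (norm (abs_l2 (grad W)))\<^sup>2)"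
    using pc by (simp add: ennreal_mult)
  then show ?thesis using pc by (simp add: f_def[abs_def])
qed

lemma norm_abs_l2_indicator_le:
  assumes f: "f \<in> L2" and A: "A \<in> sets lebesgue"
  shows "norm (abs_l2 (\<lambda>x. indicator A x *\<^sub>R f x)) \<le> norm (abs_l2 f)"
proof (rule power2_le_imp_le)
  show "(norm (abs_l2 (\<lambda>x. indicator A x *\<^sub>R f x)))\<^sup>2 \<le> (norm (abs_l2 f))\<^sup>2"
    unfolding norm_power2_abs_l2[OF f] norm_power2_abs_l2[OF L2_indicator[OF f A]]
    by (intro integral_mono L2_integrable L2_indicator f A) (simp add: indicator_def)
qed simp

text \<open>At almost every point the values \<open>v k x\<close> are eventually constant in k, so
  their pointwise limit coincides on each ball with the piece given there.\<close>

lemma L2_loc_of_balls: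
  fixes v :: "nat \<Rightarrow> 'a::euclidean_space \<Rightarrow> real"
  assumes v: "\<And>k. v k \<in> L2"
    and compat: "\<And>k k'. k \<le> k' \<Longrightarrow> AE x in lebesgue. indicator (cball 0 (real (Suc k))) x * v k' x = v k x"
  obtains w where "w \<in> L2_loc" "\<And>k. AE x in lebesgue. indicator (cball 0 (real (Suc k))) x * w x = v k x"
proof -
  note [measurable] = L2_measurable[OF v]
  define w where "w x = lim (\<lambda>k. v k x)" for x
  have w_meas[measurable]: "w \<in> borel_measurable lebesgue"
    unfolding w_def by (rule borel_measurable_lim_metric) simp
  have "AE x in lebesgue. \<forall>k. \<forall>k'\<in>{k..}. indicator (cball 0 (real (Suc k))) x * v k' x = v k x"
    using compat by (simp add: AE_all_countable AE_ball_countable)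
  then have AE: "AE x in lebesgue. \<forall>k. indicator (cball 0 (real (Suc k))) x * w x = v k x"
  proof eventually_elim
    case (elim x)
    show ?case
    proof
      fix k
      show "indicator (cball 0 (real (Suc k))) x * w x = v k x"
      proof (cases "norm x \<le> real (Suc k)")
        case True
        have ev: "v k' x = v k x" if "k' \<ge> k" for k'
          using elim[rule_format, of k' k] that True by simp
        have "(\<lambda>k. v k x) \<longlonglongrightarrow> v k x"
          by (intro tendsto_eventually eventually_sequentiallyI[of k]) (rule ev)
        then show ?thesis using True by (simp add: w_def limI)
      next
        case False
        \<comment> \<open>The case k' = k of the compatibility says that \<open>v k\<close> vanishes
          outside its own ball.\<close>
        then show ?thesis using elim[rule_format, of k k] by simp
      qed
    qed
  qed
  have "w \<in> L2_loc"
  proof -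
    have "set_integrable lebesgue K (\<lambda>x. (norm (w x))\<^sup>2)" if K: "compact K" for K
    proof -
      obtain r where r: "\<forall>x\<in>K. norm x \<le> r" using compact_imp_bounded[OF K] bounded_iff by blast
      obtain k :: nat where "r \<le> real k" using real_arch_simple by blast
      then have k: "r \<le> real (Suc k)" by simp
      have [measurable]: "K \<in> sets lebesgue" using K by (simp add: borel_compact)
      show ?thesis
        unfolding set_integrable_def
      proof (rule Bochner_Integration.integrable_bound[OF L2_integrable[OF v[of k]]])
        show "AE x in lebesgue. norm (indicator K x *\<^sub>R (norm (w x))\<^sup>2) \<le> norm ((norm (v k x))\<^sup>2)"
          using AE
        proof eventually_elim
          case (elim x)
          have "x \<in> K \<Longrightarrow> norm x \<le> real (Suc k)" using r k by force
          then show ?case using elim[rule_format, of k] by (auto simp: indicator_def)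
        qed
      qed measurable
    qed
    then show ?thesis by (simp add: L2_loc_def)
  qed
  moreover have "AE x in lebesgue. indicator (cball 0 (real (Suc k))) x * w x = v k x" for k
    using AE by eventually_elim simp
  ultimately show ?thesis using that by blast
qed

text \<open>The functions themselves may diverge while their gradients converge. Normalised by their
  means they converge in \<open>L2\<close> on every ball; the limits are glued, and integration by
  parts survives the limit as an identity of inner products.\<close>

lemma weak_grad_limit:
  fixes \<phi> :: "nat \<Rightarrow> 'a::euclidean_space \<Rightarrow> real"
  assumes \<phi>: "\<And>n. \<phi> n \<in> test_functions" and F: "F \<in> L2"
    and lim: "(\<lambda>n. abs_l2 (grad (\<phi> n))) \<longlonglongrightarrow> abs_l2 F"
  obtains w where "w \<in> L2_loc" "weak_grad w F"
proof -
  \<comment> \<open>The mean is taken over the unit ball whatever k is, so truncations to different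
    balls are compatible and their limits can be glued. The radius \<open>Suc k\<close> is at least
    1, as the Poincare inequality demands.\<close>
  define f where "f k n x = indicator (cball 0 (real (Suc k))) x * (\<phi> n x - ball_mean 1 (\<phi> n))" for k n x
  note sm = test_smooth[OF \<phi>]
  have fL: "f k n \<in> L2" for k n
    unfolding f_def by (intro smooth_indicator_ball_L2 smooth_diff sm smooth_const)
  have f_cut: "indicator (cball 0 (real (Suc k))) x * f k' n x = f k n x" if "k \<le> k'" for k k' n x
    using that by (auto simp: f_def indicator_def)
  have ball_sets: "cball (0::'a) r \<in> sets lebesgue" for r by simp
  have "convergent (\<lambda>n. abs_l2 (f k n))" for k
  proof -
    define P where "P = poincare_const TYPE('a) 1 (real (Suc k))"
    have P: "P \<ge> 0" by (simp add: P_def poincare_const_def)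
    have bd: "norm (abs_l2 (f k n) - abs_l2 (f k m)) \<le> sqrt P * norm (abs_l2 (grad (\<phi> n)) - abs_l2 (grad (\<phi> m)))" for n m
    proof -
      have gr: "grad (\<lambda>x. \<phi> n x - \<phi> m x) = (\<lambda>x. grad (\<phi> n) x - grad (\<phi> m) x)"
        by (intro ext grad_diff sm)
      have ff: "(\<lambda>x. f k n x - f k m x) = (\<lambda>x. indicator (cball 0 (real (Suc k))) x *
          ((\<phi> n x - \<phi> m x) - ball_mean 1 (\<lambda>x. \<phi> n x - \<phi> m x)))"
        unfolding ball_mean_diff[OF sm[of n] sm[of m]] by (intro ext) (simp add: f_def indicator_def)
      have "(norm (abs_l2 (\<lambda>x. f k n x - f k m x)))\<^sup>2 \<le> P * (norm (abs_l2 (grad (\<lambda>x. \<phi> n x - \<phi> m x))))\<^sup>2"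
        unfolding ff P_def
        by (intro Poincare_l2 smooth_diff sm grad_test_L2 test_diff \<phi>) auto
      then have "(norm (abs_l2 (f k n) - abs_l2 (f k m)))\<^sup>2 \<le>
          (sqrt P * norm (abs_l2 (grad (\<phi> n)) - abs_l2 (grad (\<phi> m))))\<^sup>2"
        unfolding gr using P by (simp add: abs_l2_diff fL grad_test_L2 \<phi> power_mult_distrib)
      then show ?thesis by (rule power2_le_imp_le) (use P in auto)
    qed
    have "Cauchy (\<lambda>n. abs_l2 (f k n))"
    proof (rule metric_CauchyI)
      fix e :: real assume e: "e > 0"
      have "Cauchy (\<lambda>n. abs_l2 (grad (\<phi> n)))" using lim convergent_Cauchy convergentI by blast
      \<comment> \<open>Adding 1 to sqrt P avoids a division by zero and makes the final inequality
        strict.\<close>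
      then obtain N where N: "\<And>m n. m \<ge> N \<Longrightarrow> n \<ge> N \<Longrightarrow>
          dist (abs_l2 (grad (\<phi> m))) (abs_l2 (grad (\<phi> n))) < e / (sqrt P + 1)"
        using metric_CauchyD[of _ "e / (sqrt P + 1)"] e P by (metis add_nonneg_pos divide_pos_pos real_sqrt_ge_zero zero_less_one)
      have "dist (abs_l2 (f k m)) (abs_l2 (f k n)) < e" if "m \<ge> N" "n \<ge> N" for m n
      proof -
        have "dist (abs_l2 (f k m)) (abs_l2 (f k n)) \<le> sqrt P * dist (abs_l2 (grad (\<phi> m))) (abs_l2 (grad (\<phi> n)))"
          using bd by (simp add: dist_norm)
        also have "\<dots> \<le> sqrt P * (e / (sqrt P + 1))"
          using N[OF that] P by (intro mult_left_mono) auto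
        also have "\<dots> < e"
        proof -
          have "sqrt P + 1 > 0" using P by (simp add: add_nonneg_pos)
          then show ?thesis using e by (simp add: pos_divide_less_eq distrib_left mult.commute)
        qed
        finally show ?thesis .
      qed
      then show "\<exists>M. \<forall>m\<ge>M. \<forall>n\<ge>M. dist (abs_l2 (f k m)) (abs_l2 (f k n)) < e" by blast
    qed
    then show ?thesis by (rule Cauchy_convergent)
  qed
  then obtain V where V: "(\<lambda>n. abs_l2 (f k n)) \<longlonglongrightarrow> V k" for k
    unfolding convergent_def by metis
  define v where "v k = rep_l2 (V k)" for k
  have v: "v k \<in> L2" "abs_l2 (v k) = V k" for k by (simp_all add: v_def rep_l2_in_L2 abs_rep_l2)
  have compat: "AE x in lebesgue. indicator (cball 0 (real (Suc k))) x * v k' x = v k x" if le: "k \<le> k'" for k k'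
  proof -
    define c where "c x = indicator (cball 0 (real (Suc k))) x *\<^sub>R v k' x" for x
    have cL: "c \<in> L2" unfolding c_def by (rule L2_indicator[OF v(1) ball_sets])
    \<comment> \<open>Truncation to the smaller ball does not increase the norm, so it commutes with
      the limit; uniqueness of limits identifies the two pieces.\<close>
    have "(\<lambda>n. abs_l2 (f k n) - abs_l2 c) \<longlonglongrightarrow> 0"
    proof (rule Lim_null_comparison[OF always_eventually])
      show "\<forall>n. norm (abs_l2 (f k n) - abs_l2 c) \<le> norm (abs_l2 (f k' n) - V k')"
      proof
        fix n
        have "(\<lambda>x. f k n x - c x) = (\<lambda>x. indicator (cball 0 (real (Suc k))) x *\<^sub>R (f k' n x - v k' x))"
          using f_cut[OF le] by (simp add: c_def right_diff_distrib)
        then show "norm (abs_l2 (f k n) - abs_l2 c) \<le> norm (abs_l2 (f k' n) - V k')"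
          using norm_abs_l2_indicator_le[OF L2_diff[OF fL[of k' n] v(1)[of k']] ball_sets[of "real (Suc k)"]]
          unfolding abs_l2_diff[OF fL cL, symmetric] v(2)[symmetric] abs_l2_diff[OF fL v(1), symmetric]
          by (simp only:)
      qed
      show "(\<lambda>n. norm (abs_l2 (f k' n) - V k')) \<longlonglongrightarrow> 0"
        using V[of k'] by (simp add: LIM_zero tendsto_norm_zero)
    qed
    then have "(\<lambda>n. abs_l2 (f k n)) \<longlonglongrightarrow> abs_l2 c" by (simp add: LIM_zero_iff)
    then have "abs_l2 c = abs_l2 (v k)" using V[of k] LIMSEQ_unique v(2) by metis
    then show ?thesis by (simp add: abs_l2_eq_iff cL v(1) c_def)
  qed
  obtain w where w: "w \<in> L2_loc" "\<And>k. AE x in lebesgue. indicator (cball 0 (real (Suc k))) x * w x = v k x"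
    using L2_loc_of_balls[OF v(1) compat] by blast
  have w_meas: "w \<in> borel_measurable lebesgue" using w(1) by (simp add: L2_loc_def)
  have "weak_grad w F"
    unfolding weak_grad_def
  proof (intro ballI)
    fix \<psi> :: "'a \<Rightarrow> real" and b :: 'a assume \<psi>: "\<psi> \<in> test_functions" and b: "b \<in> Basis"
    obtain r where r: "\<And>x. norm x > r \<Longrightarrow> \<psi> x = 0" using test_support[OF \<psi>] by blast
    \<comment> \<open>On a ball containing the support of \<psi> the truncation in
      \<open>f k n\<close> is invisible after multiplication by a derivative of \<psi>.\<close>
    obtain k :: nat where "r \<le> real k" using real_arch_simple by blast
    then have k: "r \<le> real (Suc k)" by simp
    note d\<psi> = test_dderiv[OF \<psi>, of b]
    have ind: "indicator (cball 0 (real (Suc k))) x * dderiv b \<psi> x = dderiv b \<psi> x" for x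
      using dderiv_zero_outside[of r \<psi> x b] r k by (cases "norm x \<le> real (Suc k)") auto
    have parts: "(\<integral>x. f k n x \<bullet> dderiv b \<psi> x \<partial>lebesgue) = - (\<integral>x. grad (\<phi> n) x \<bullet> (\<psi> x *\<^sub>R b) \<partial>lebesgue)" for n
    proof -
      have "(\<integral>x. f k n x \<bullet> dderiv b \<psi> x \<partial>lebesgue) =
          (\<integral>x. (\<phi> n x - ball_mean 1 (\<phi> n)) * dderiv b \<psi> x \<partial>lebesgue)"
        by (intro Bochner_Integration.integral_cong refl)
          (use ind in \<open>simp add: f_def mult.assoc mult.left_commute[of "indicator _ _"]\<close>)
      also have "\<dots> = - (\<integral>x. (grad (\<lambda>x. \<phi> n x - ball_mean 1 (\<phi> n)) x \<bullet> b) * \<psi> x \<partial>lebesgue)"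
        using weak_grad_smooth[OF smooth_diff[OF sm smooth_const], of n "ball_mean 1 (\<phi> n)"] \<psi> b
        by (simp add: weak_grad_def)
      also have "\<dots> = - (\<integral>x. grad (\<phi> n) x \<bullet> (\<psi> x *\<^sub>R b) \<partial>lebesgue)"
        by (simp add: grad_minus_const sm mult.commute)
      finally show ?thesis .
    qed
    have \<psi>b: "(\<lambda>x. \<psi> x *\<^sub>R b) \<in> L2"
      by (intro test_L2 test_bounded_linear[OF bounded_linear_scaleR_left \<psi>])
    have "(\<lambda>n. abs_l2 (f k n) \<bullet> abs_l2 (dderiv b \<psi>)) \<longlonglongrightarrow> V k \<bullet> abs_l2 (dderiv b \<psi>)"
      by (intro tendsto_intros V)
    moreover have "(\<lambda>n. - (abs_l2 (grad (\<phi> n)) \<bullet> abs_l2 (\<lambda>x. \<psi> x *\<^sub>R b))) \<longlonglongrightarrow> - (abs_l2 F \<bullet> abs_l2 (\<lambda>x. \<psi> x *\<^sub>R b))"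
      by (intro tendsto_intros lim)
    moreover have "abs_l2 (f k n) \<bullet> abs_l2 (dderiv b \<psi>) = - (abs_l2 (grad (\<phi> n)) \<bullet> abs_l2 (\<lambda>x. \<psi> x *\<^sub>R b))" for n
      using parts[of n] by (simp add: inner_abs_l2 fL test_L2 d\<psi> grad_test_L2 \<phi> \<psi>b)
    ultimately have "V k \<bullet> abs_l2 (dderiv b \<psi>) = - (abs_l2 F \<bullet> abs_l2 (\<lambda>x. \<psi> x *\<^sub>R b))"
      using LIMSEQ_unique by simp
    then have *: "(\<integral>x. v k x * dderiv b \<psi> x \<partial>lebesgue) = - (\<integral>x. (F x \<bullet> b) * \<psi> x \<partial>lebesgue)"
      unfolding v(2)[symmetric] by (simp add: inner_abs_l2 v(1) test_L2 d\<psi> F \<psi>b mult.commute)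
    have "(\<integral>x. w x * dderiv b \<psi> x \<partial>lebesgue) = (\<integral>x. v k x * dderiv b \<psi> x \<partial>lebesgue)"
    proof (rule integral_cong_AE)
      show "AE x in lebesgue. w x * dderiv b \<psi> x = v k x * dderiv b \<psi> x"
        using w(2)[of k]
      proof eventually_elim
        case (elim x)
        then show ?case using ind[of x] by (metis mult.assoc mult.left_commute)
      qed
    qed (intro borel_measurable_times w_meas L2_measurable v(1) test_L2 d\<psi>)+
    with * show "(\<integral>x. w x * dderiv b \<psi> x \<partial>lebesgue) = - (\<integral>x. (F x \<bullet> b) * \<psi> x \<partial>lebesgue)" by simp
  qed
  with w(1) show ?thesis by (rule that)
qed

section \<open>A Liouville theorem\<close>

lemma L2_Cauchy_Schwarz:
  fixes f g :: "'a::euclidean_space \<Rightarrow> 'b::euclidean_space"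
  assumes "f \<in> L2" "g \<in> L2"
  shows "(\<integral>x. f x \<bullet> g x \<partial>lebesgue)\<^sup>2 \<le> (\<integral>x. (norm (f x))\<^sup>2 \<partial>lebesgue) * (\<integral>x. (norm (g x))\<^sup>2 \<partial>lebesgue)"
proof -
  have "\<bar>abs_l2 f \<bullet> abs_l2 g\<bar> \<le> norm (abs_l2 f) * norm (abs_l2 g)"
    by (rule Cauchy_Schwarz_ineq2)
  then have "\<bar>abs_l2 f \<bullet> abs_l2 g\<bar>\<^sup>2 \<le> (norm (abs_l2 f) * norm (abs_l2 g))\<^sup>2"
    by (rule power_mono) simp
  then show ?thesis
    by (simp add: power_mult_distrib norm_power2_abs_l2 inner_abs_l2 assms)
qed

lemma L2_mult_bounded:
  fixes f :: "'a::euclidean_space \<Rightarrow> 'b::euclidean_space"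
  assumes f: "f \<in> L2" and h: "h \<in> borel_measurable lebesgue" "\<And>x. norm (h x) \<le> B * norm (f x)"
  shows "h \<in> L2"
proof (rule L2_I[OF h(1)])
  show "integrable lebesgue (\<lambda>x. B\<^sup>2 * (norm (f x))\<^sup>2)"
    using L2_integrable[OF f] by simp
  show "AE x in lebesgue. (norm (h x))\<^sup>2 \<le> B\<^sup>2 * (norm (f x))\<^sup>2"
    using power_mono[OF h(2), of _ 2] by (simp add: power_mult_distrib)
qed

text \<open>The set where f is nonzero is open and negligible, hence empty.\<close>

lemma continuous_AE_zero:
  fixes f :: "'a::euclidean_space \<Rightarrow> 'b::real_normed_vector"
  assumes f: "continuous_on UNIV f" and ae: "AE x in lebesgue. f x = 0"
  shows "f x = 0"
proof (rule ccontr)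
  assume "f x \<noteq> 0"
  have "open {x. f x \<noteq> 0}" by (intro open_Collect_neq f continuous_on_const)
  moreover have "negligible {x. f x \<noteq> 0}"
  proof -
    obtain N where "N \<in> null_sets lebesgue" "{x \<in> space lebesgue. f x \<noteq> 0} \<subseteq> N"
      using ae unfolding eventually_ae_filter by blast
    then show ?thesis by (auto simp: negligible_iff_null_sets[symmetric] intro: negligible_subset)
  qed
  ultimately have "{x. f x \<noteq> 0} = {}" using open_not_negligible by blast
  with \<open>f x \<noteq> 0\<close> show False by blast
qed

lemma grad_mult:
  fixes f g :: "'a::euclidean_space \<Rightarrow> real"
  assumes "smooth f" "smooth g"
  shows "grad (\<lambda>x. f x * g x) x = f x *\<^sub>R grad g x + g x *\<^sub>R grad f x"
proof -
  have "dderiv h (\<lambda>x. f x * g x) = (\<lambda>x. f x * dderiv h g x + dderiv h f x * g x)" for h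
    by (rule dderiv_eq) (rule dderiv_mult[OF assms])
  from fun_cong[OF this] show ?thesis
    by (simp add: grad_def scaleR_add_left sum.distrib scaleR_sum_right mult.commute)
qed

lemma smooth_scale_arg:
  fixes f :: "'a::euclidean_space \<Rightarrow> real"
  assumes "smooth f"
  shows "smooth (\<lambda>x. f (c *\<^sub>R x))" "grad (\<lambda>x. f (c *\<^sub>R x)) x = c *\<^sub>R grad f (c *\<^sub>R x)"
proof -
  show "smooth (\<lambda>x. f (c *\<^sub>R x))"
    using smooth_compose_affine[OF assms bounded_linear_scaleR_right[of c], of 0] by simp
  have "((\<lambda>y. c *\<^sub>R y) has_derivative (\<lambda>k. c *\<^sub>R k)) (at y)" for y :: 'a
    by (auto intro!: derivative_eq_intros)
  from has_derivative_compose[OF this smooth_has_derivative[OF assms]]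
  have "dderiv h (\<lambda>x. f (c *\<^sub>R x)) = (\<lambda>x. dderiv (c *\<^sub>R h) f (c *\<^sub>R x))" for h
    by (rule dderiv_eq)
  from fun_cong[OF this] show "grad (\<lambda>x. f (c *\<^sub>R x)) x = c *\<^sub>R grad f (c *\<^sub>R x)"
    by (simp add: grad_def scaleR_sum_right
        linear_scale[OF smooth_linear[OF assms]])
qed

text \<open>Caccioppoli's argument: test with \<open>\<eta>(x/n) (W - c\<^sub>n)\<close>, where \<open>c\<^sub>n\<close> is the mean of \<open>W\<close> over a
  ball of radius proportional to \<open>n\<close>. By the Poincare inequality the error is at most a constant
  times the \<open>L\<^sup>2\<close> norm of \<open>\<nabla>\<eta>(x/n) \<nabla>W\<close>, which vanishes in the limit because \<open>\<nabla>\<eta>(0) = 0\<close>.\<close>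

lemma smooth_Liouville:
  fixes W :: "'a::euclidean_space \<Rightarrow> real"
  assumes W: "smooth W" and L2: "grad W \<in> L2"
    and orth: "\<And>v. v \<in> test_functions \<Longrightarrow> (\<integral>x. grad W x \<bullet> grad v x \<partial>lebesgue) = 0"
  shows "grad W x = 0"
proof -
  obtain \<eta> :: "'a \<Rightarrow> real" where \<eta>: "\<eta> \<in> test_functions" "\<eta> 0 = 1" "\<And>h. dderiv h \<eta> 0 = 0"
    using ex_centred_bump by blast
  obtain r where r: "r > 0" "\<And>x. norm x > r \<Longrightarrow> \<eta> x = 0" using test_support[OF \<eta>(1)] by blast
  obtain B where B: "\<And>x. norm (\<eta> x) \<le> B" using test_bounded[OF \<eta>(1)] by blast
  note s\<eta> = test_smooth[OF \<eta>(1)]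
  have g0: "grad \<eta> 0 = 0" by (simp add: grad_def \<eta>(3))
  obtain B' where B': "B' \<ge> 0" "\<And>x. norm (grad \<eta> x) \<le> B'"
    using test_grad_bounded[OF \<eta>(1)] by metis
  define N where "N = (\<integral>x. (norm (grad W x))\<^sup>2 \<partial>lebesgue)"
  \<comment> \<open>The Poincare constant on the ball of radius r / t is 4 2^d r^2 / t^2; K collects
    everything except the power of t.\<close>
  define K where "K = 4 * 2 ^ DIM('a) * r\<^sup>2 * N"
  define t where "t n = inverse (real (Suc n))" for n
  have t: "t n > 0" "t \<longlonglongrightarrow> 0" for n
    using LIMSEQ_inverse_real_of_nat by (simp_all add: t_def[abs_def])
  have tx: "(\<lambda>n. t n *\<^sub>R x) \<longlonglongrightarrow> 0" for x :: 'a
    using tendsto_scaleR[OF t(2) tendsto_const[of x]] by simp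
  have N0: "N \<ge> 0" by (simp add: N_def Bochner_Integration.integral_nonneg)
  have gW[measurable]: "grad W \<in> borel_measurable lebesgue" by (rule L2_measurable[OF L2])
  define e where "e n x = \<eta> (t n *\<^sub>R x)" for n x
  have se: "smooth (e n)" and ge: "grad (e n) x = t n *\<^sub>R grad \<eta> (t n *\<^sub>R x)" for n x
    unfolding e_def by (rule smooth_scale_arg[OF s\<eta>])+
  have em[measurable]: "e n \<in> borel_measurable lebesgue" for n
    by (rule smooth_borel_measurable[OF se])
  have e_test: "e n \<in> test_functions" for n
  proof (rule test_functionsI[OF se])
    fix x :: 'a assume "norm x > r / t n"
    then show "e n x = 0"
      unfolding e_def using t(1)[of n] by (intro r(2)) (simp add: pos_divide_less_eq mult.commute)
  qed
  have e_zero: "e n x = 0" "grad (e n) x = 0" if "norm x > r / t n" for n x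
  proof -
    have "norm (t n *\<^sub>R x) > r" using that t(1)[of n] by (simp add: pos_divide_less_eq mult.commute)
    then have "e n x = 0" "grad \<eta> (t n *\<^sub>R x) = 0"
      unfolding e_def grad_def using r(2) dderiv_zero_outside[of r \<eta> "t n *\<^sub>R x"] by auto
    then show "e n x = 0" "grad (e n) x = 0" by (simp_all add: ge)
  qed
  define c where "c n = ball_mean (r / t n) W" for n
  \<comment> \<open>The indicator puts W - c n into \<open>L2\<close> and changes nothing in the
    pairing, since the cutoff and its gradient vanish outside this ball.\<close>
  define f where "f n x = indicator (cball 0 (r / t n)) x * (W x - c n)" for n x
  define g where "g n x = grad \<eta> (t n *\<^sub>R x) \<bullet> grad W x" for n x
  have fL: "f n \<in> L2" for n
    unfolding f_def by (intro smooth_indicator_ball_L2 smooth_diff W smooth_const)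
  have g\<eta>m: "(\<lambda>x. grad \<eta> (t n *\<^sub>R x)) \<in> borel_measurable lebesgue" for n
  proof (rule measurable_completion)
    have "continuous_on UNIV (\<lambda>x. grad \<eta> (t n *\<^sub>R x))"
      by (rule continuous_on_compose2[OF continuous_grad[OF s\<eta>, of UNIV]]) (auto intro!: continuous_intros)
    then show "(\<lambda>x. grad \<eta> (t n *\<^sub>R x)) \<in> borel_measurable lborel"
      by (simp add: borel_measurable_continuous_onI)
  qed
  have gm: "g n \<in> borel_measurable lebesgue" for n
    unfolding g_def by (intro borel_measurable_inner g\<eta>m gW)
  have gB: "norm (g n x) \<le> B' * norm (grad W x)" for n x
  proof -
    have "norm (g n x) \<le> norm (grad \<eta> (t n *\<^sub>R x)) * norm (grad W x)"
      by (simp add: g_def Cauchy_Schwarz_ineq2)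
    also have "\<dots> \<le> B' * norm (grad W x)" by (intro mult_right_mono B') simp
    finally show ?thesis .
  qed
  have gL: "g n \<in> L2" for n by (rule L2_mult_bounded[OF L2 gm gB])
  \<comment> \<open>The growth as the inverse square of t n is matched by the factor t n in the
    gradient of the cutoff \<open>e n\<close>.\<close>
  have fK: "(\<integral>x. (norm (f n x))\<^sup>2 \<partial>lebesgue) \<le> K / (t n)\<^sup>2" for n
  proof -
    have "r / t n > 0" using r t by simp
    then show ?thesis
      using Poincare_l2[OF W L2, of "r / t n" "r / t n"] fL[of n]
      by (simp add: norm_power2_abs_l2[OF L2] norm_power2_abs_l2[OF fL, unfolded f_def c_def]
          poincare_const_same f_def c_def K_def N_def power_divide)
  qed
  have e2: "integrable lebesgue (\<lambda>x. e n x * (norm (grad W x))\<^sup>2)" for n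
  proof (rule Bochner_Integration.integrable_bound)
    show "integrable lebesgue (\<lambda>x. B * (norm (grad W x))\<^sup>2)" using L2_integrable[OF L2] by simp
    have "\<bar>e n x\<bar> \<le> \<bar>B\<bar>" for x using B[of "t n *\<^sub>R x"] by (simp add: e_def)
    then show "AE x in lebesgue. norm (e n x * (norm (grad W x))\<^sup>2) \<le> norm (B * (norm (grad W x))\<^sup>2)"
      by (simp add: abs_mult mult_right_mono)
  qed measurable
  \<comment> \<open>The orthogonality hypothesis tested with e n (W - c n): the Leibniz rule yields
    the weighted energy and an error in which the gradient of the cutoff meets that of W.\<close>
  have id: "(\<integral>x. e n x * (norm (grad W x))\<^sup>2 \<partial>lebesgue) = - t n * (\<integral>x. f n x \<bullet> g n x \<partial>lebesgue)" for n
  proof -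
    have sWc: "smooth (\<lambda>x. W x - c n)" by (intro smooth_diff W smooth_const)
    have eq: "grad W x \<bullet> grad (\<lambda>x. e n x * (W x - c n)) x =
        e n x * (norm (grad W x))\<^sup>2 + t n * (f n x \<bullet> g n x)" for x
    proof (cases "norm x > r / t n")
      case True
      then show ?thesis
        unfolding grad_mult[OF se sWc] by (simp add: e_zero f_def)
    next
      case False
      then show ?thesis
        unfolding grad_mult[OF se sWc] grad_minus_const[OF W] ge
        by (simp add: inner_add_right power2_norm_eq_inner f_def g_def inner_commute)
    qed
    have "(\<lambda>x. e n x * (W x - c n)) \<in> test_functions" by (rule test_mult[OF e_test sWc])
    from orth[OF this] have "0 = (\<integral>x. e n x * (norm (grad W x))\<^sup>2 + t n * (f n x \<bullet> g n x) \<partial>lebesgue)"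
      unfolding eq by simp
    also have "\<dots> = (\<integral>x. e n x * (norm (grad W x))\<^sup>2 \<partial>lebesgue) + (\<integral>x. t n * (f n x \<bullet> g n x) \<partial>lebesgue)"
      by (rule Bochner_Integration.integral_add[OF e2]) (intro integrable_mult_right L2_integrable_inner fL gL)
    finally show ?thesis by simp
  qed
  \<comment> \<open>The error is controlled by q, and q tends to zero because the gradient of \<eta>
    at t n x tends to its value at 0, which is zero, with the squared gradient of W as integrable
    majorant.\<close>
  define q where "q n = (\<integral>x. (norm (g n x))\<^sup>2 \<partial>lebesgue)" for n
  have "q \<longlonglongrightarrow> (\<integral>x. 0 \<partial>(lebesgue :: 'a measure))"
    unfolding q_def
  proof (rule integral_dominated_convergence[where w="\<lambda>x. B'\<^sup>2 * (norm (grad W x))\<^sup>2"])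
    show "AE x in lebesgue. norm ((norm (g n x))\<^sup>2) \<le> B'\<^sup>2 * (norm (grad W x))\<^sup>2" for n
      using power_mono[OF gB, of n _ 2] by (simp add: power_mult_distrib)
    have "(\<lambda>n. (norm (g n x))\<^sup>2) \<longlonglongrightarrow> (norm (0 \<bullet> grad W x))\<^sup>2" for x
    proof -
      have "isCont (grad \<eta>) 0"
        using continuous_grad[OF s\<eta>, of UNIV] by (simp add: continuous_on_eq_continuous_at)
      from isCont_tendsto_compose[OF this tx[of x]] show ?thesis
        unfolding g_def g0 by (intro tendsto_intros)
    qed
    then show "AE x in lebesgue. (\<lambda>n. (norm (g n x))\<^sup>2) \<longlonglongrightarrow> 0" by simp
  qed (use L2_integrable[OF L2] gm in auto)
  then have q0: "q \<longlonglongrightarrow> 0" by simp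
  have le: "(\<integral>x. e n x * (norm (grad W x))\<^sup>2 \<partial>lebesgue)\<^sup>2 \<le> K * q n" for n
  proof -
    have "(\<integral>x. e n x * (norm (grad W x))\<^sup>2 \<partial>lebesgue)\<^sup>2 = (t n)\<^sup>2 * (\<integral>x. f n x \<bullet> g n x \<partial>lebesgue)\<^sup>2"
      unfolding id by (simp only: power_mult_distrib power2_minus)
    also have "\<dots> \<le> (t n)\<^sup>2 * (K / (t n)\<^sup>2 * q n)"
    proof (rule mult_left_mono)
      have "(\<integral>x. f n x \<bullet> g n x \<partial>lebesgue)\<^sup>2 \<le> (\<integral>x. (norm (f n x))\<^sup>2 \<partial>lebesgue) * q n"
        unfolding q_def by (rule L2_Cauchy_Schwarz[OF fL gL])
      also have "\<dots> \<le> K / (t n)\<^sup>2 * q n"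
        by (rule mult_right_mono[OF fK]) (simp add: q_def Bochner_Integration.integral_nonneg)
      finally show "(\<integral>x. f n x \<bullet> g n x \<partial>lebesgue)\<^sup>2 \<le> K / (t n)\<^sup>2 * q n" .
    qed simp
    also have "\<dots> = K * q n" using t(1)[of n] by simp
    finally show ?thesis .
  qed
  \<comment> \<open>The cutoffs tend to \<eta>(0) = 1, so the weighted energies tend to the full
    energy N, which the estimate \<open>le\<close> forces to vanish.\<close>
  have "(\<lambda>n. \<integral>x. e n x * (norm (grad W x))\<^sup>2 \<partial>lebesgue) \<longlonglongrightarrow> (\<integral>x. 1 * (norm (grad W x))\<^sup>2 \<partial>lebesgue)"
  proof (rule integral_dominated_convergence[where w="\<lambda>x. B * (norm (grad W x))\<^sup>2"])
    show "AE x in lebesgue. norm (e n x * (norm (grad W x))\<^sup>2) \<le> B * (norm (grad W x))\<^sup>2" for n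
      using B by (simp add: e_def abs_mult mult_right_mono)
    have "(\<lambda>n. e n x) \<longlonglongrightarrow> 1" for x
    proof -
      have "isCont \<eta> 0"
        using smooth_continuous[OF s\<eta>, of UNIV] by (simp add: continuous_on_eq_continuous_at)
      from isCont_tendsto_compose[OF this tx[of x]] show ?thesis by (simp add: e_def \<eta>(2))
    qed
    then show "AE x in lebesgue. (\<lambda>n. e n x * (norm (grad W x))\<^sup>2) \<longlonglongrightarrow> 1 * (norm (grad W x))\<^sup>2"
      by (intro AE_I2 tendsto_intros)
  qed (use L2_integrable[OF L2] in auto)
  then have "(\<lambda>n. (\<integral>x. e n x * (norm (grad W x))\<^sup>2 \<partial>lebesgue)\<^sup>2) \<longlonglongrightarrow> N\<^sup>2"
    unfolding N_def by (intro tendsto_power) simp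
  moreover have "(\<lambda>n. K * q n) \<longlonglongrightarrow> K * 0" by (intro tendsto_intros q0)
  ultimately have "N\<^sup>2 \<le> K * 0" by (rule LIMSEQ_le) (use le in blast)
  then have "N = 0" by simp
  then have "AE x in lebesgue. (norm (grad W x))\<^sup>2 = 0"
    unfolding N_def by (subst (asm) integral_nonneg_eq_0_iff_AE[OF L2_integrable[OF L2]]) simp_all
  then have "AE x in lebesgue. grad W x = 0" by simp
  then show ?thesis by (rule continuous_AE_zero[OF continuous_grad[OF W]])
qed

section \<open>Regularisation and the Liouville theorem for weak gradients\<close>

lemma corr_cong_AE:
  assumes "w \<in> borel_measurable lebesgue" "w' \<in> borel_measurable lebesgue"
    and \<phi>: "\<phi> \<in> test_functions" and eq: "AE x in lebesgue. w x = w' x"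
  shows "corr w \<phi> h = corr w' \<phi> h"
  unfolding corr_def
proof (rule integral_cong_AE)
  show "AE y in lebesgue. w y * \<phi> (y + h) = w' y * \<phi> (y + h)"
    using eq by eventually_elim simp
qed (intro borel_measurable_times assms smooth_borel_measurable(2) test_smooth test_translate \<phi>)+

lemma corr_eq_lborel:
  assumes [measurable]: "w \<in> borel_measurable borel" and \<phi>: "\<phi> \<in> test_functions"
  shows "corr w \<phi> h = (\<integral>y. w y * \<phi> (y + h) \<partial>lborel)"
proof -
  have [measurable]: "\<phi> \<in> borel_measurable borel"
    by (rule smooth_borel_measurable(1)[OF test_smooth[OF \<phi>]])
  show ?thesis unfolding corr_def by (rule integral_completion) measurable
qed

lemma test_nn_integral_finite:
  fixes \<phi> :: "'a::euclidean_space \<Rightarrow> real"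
  assumes "\<phi> \<in> test_functions"
  shows "(\<integral>\<^sup>+y. ennreal \<bar>\<phi> y\<bar> \<partial>lborel) < \<infinity>"
proof -
  have "(\<lambda>_. 1) \<in> L1_loc" by (rule continuous_L1_loc) simp
  from L1_loc_integrable_test[OF this assms]
  have "(\<integral>\<^sup>+y. ennreal \<bar>\<phi> y\<bar> \<partial>lebesgue) < \<infinity>" by (simp add: integrable_iff_bounded)
  then show ?thesis by (simp add: nn_integral_completion)
qed

text \<open>Young's inequality: Cauchy--Schwarz with the weight \<open>\<bar>\<phi>\<bar>\<close>, followed by Tonelli.\<close>

lemma corr_L2:
  fixes w \<phi> :: "'a::euclidean_space \<Rightarrow> real"
  assumes w: "w \<in> L2" and \<phi>: "\<phi> \<in> test_functions"
  shows "corr w \<phi> \<in> L2"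
proof -
  obtain w' where [measurable]: "w' \<in> borel_measurable borel" and w': "AE x in lebesgue. w x = w' x"
    using ex_borel_representative[OF L2_measurable[OF w]] by blast
  have w'_meas: "w' \<in> borel_measurable lebesgue" by (rule measurable_completion) simp
  have w'_L2: "w' \<in> L2" by (rule L2_cong_AE[OF w w'_meas w'])
  have eq: "corr w \<phi> = corr w' \<phi>"
    by (intro ext corr_cong_AE L2_measurable w w'_meas \<phi> w')
  note m[measurable] = smooth_borel_measurable(1)[OF test_smooth[OF \<phi>]]
  define I where "I = (\<integral>\<^sup>+y. ennreal \<bar>\<phi> y\<bar> \<partial>lborel)"
  have I_fin: "I < \<infinity>" unfolding I_def by (rule test_nn_integral_finite[OF \<phi>])
  have pt: "ennreal ((norm (corr w' \<phi> h))\<^sup>2) \<le> I * (\<integral>\<^sup>+y. ennreal ((w' y)\<^sup>2) * ennreal \<bar>\<phi> (y + h)\<bar> \<partial>lborel)" for h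
  proof -
    have int: "integrable lborel (\<lambda>y. w' y * \<phi> (y + h))"
      using L1_loc_integrable_test[OF L2_L1_loc[OF w'_L2] test_translate[OF \<phi>, of h]]
      by (subst (asm) integrable_completion) measurable
    have "ennreal (norm (corr w' \<phi> h)) \<le> (\<integral>\<^sup>+y. ennreal (norm (w' y * \<phi> (y + h))) \<partial>lborel)"
      unfolding corr_eq_lborel[OF \<open>w' \<in> borel_measurable borel\<close> \<phi>] by (rule integral_norm_bound_ennreal[OF int])
    also have "\<dots> = (\<integral>\<^sup>+y. ennreal (sqrt \<bar>\<phi> (y + h)\<bar>) * ennreal (\<bar>w' y\<bar> * sqrt \<bar>\<phi> (y + h)\<bar>) \<partial>lborel)"
      by (intro nn_integral_cong) (simp add: ennreal_mult[symmetric] abs_mult)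
    finally have "(ennreal (norm (corr w' \<phi> h)))\<^sup>2 \<le>
        (\<integral>\<^sup>+y. ennreal (sqrt \<bar>\<phi> (y + h)\<bar>) * ennreal (\<bar>w' y\<bar> * sqrt \<bar>\<phi> (y + h)\<bar>) \<partial>lborel)\<^sup>2"
      by (rule power_mono) simp
    also have "\<dots> \<le> (\<integral>\<^sup>+y. (ennreal (sqrt \<bar>\<phi> (y + h)\<bar>))\<^sup>2 \<partial>lborel) *
        (\<integral>\<^sup>+y. (ennreal (\<bar>w' y\<bar> * sqrt \<bar>\<phi> (y + h)\<bar>))\<^sup>2 \<partial>lborel)"
      by (rule Cauchy_Schwarz_nn_integral) measurable
    also have "(\<integral>\<^sup>+y. (ennreal (sqrt \<bar>\<phi> (y + h)\<bar>))\<^sup>2 \<partial>lborel) = (\<integral>\<^sup>+y. ennreal \<bar>\<phi> (y + h)\<bar> \<partial>lborel)"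
      by (simp add: ennreal_power)
    also have "\<dots> = I" unfolding I_def by (rule nn_integral_translate[where f="\<lambda>y. ennreal \<bar>\<phi> y\<bar>"]) measurable
    also have "(\<integral>\<^sup>+y. (ennreal (\<bar>w' y\<bar> * sqrt \<bar>\<phi> (y + h)\<bar>))\<^sup>2 \<partial>lborel) =
        (\<integral>\<^sup>+y. ennreal ((w' y)\<^sup>2) * ennreal \<bar>\<phi> (y + h)\<bar> \<partial>lborel)"
      by (intro nn_integral_cong) (simp add: ennreal_power ennreal_mult[symmetric] power_mult_distrib)
    finally show ?thesis by (simp add: ennreal_power)
  qed
  have cm: "corr w' \<phi> \<in> borel_measurable borel"
    by (rule smooth_borel_measurable(1)[OF smooth_corr[OF L2_L1_loc[OF w'_L2] \<phi>]])
  have "(\<integral>\<^sup>+h. ennreal ((norm (corr w' \<phi> h))\<^sup>2) \<partial>lborel) \<le>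
      (\<integral>\<^sup>+h. I * (\<integral>\<^sup>+y. ennreal ((w' y)\<^sup>2) * ennreal \<bar>\<phi> (y + h)\<bar> \<partial>lborel) \<partial>lborel)"
    by (intro nn_integral_mono pt)
  also have "\<dots> = I * (\<integral>\<^sup>+h. \<integral>\<^sup>+y. ennreal ((w' y)\<^sup>2) * ennreal \<bar>\<phi> (y + h)\<bar> \<partial>lborel \<partial>lborel)"
    by (rule nn_integral_cmult) measurable
  also have "(\<integral>\<^sup>+h. \<integral>\<^sup>+y. ennreal ((w' y)\<^sup>2) * ennreal \<bar>\<phi> (y + h)\<bar> \<partial>lborel \<partial>lborel) =
      (\<integral>\<^sup>+y. \<integral>\<^sup>+h. ennreal ((w' y)\<^sup>2) * ennreal \<bar>\<phi> (y + h)\<bar> \<partial>lborel \<partial>lborel)"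
    by (rule lborel_pair.Fubini'[symmetric]) measurable
  also have "\<dots> = (\<integral>\<^sup>+y. ennreal ((w' y)\<^sup>2) * I \<partial>lborel)"
  proof (rule nn_integral_cong)
    fix y :: 'a
    have "(\<integral>\<^sup>+h. ennreal ((w' y)\<^sup>2) * ennreal \<bar>\<phi> (y + h)\<bar> \<partial>lborel) =
        ennreal ((w' y)\<^sup>2) * (\<integral>\<^sup>+h. ennreal \<bar>\<phi> (h + y)\<bar> \<partial>lborel)"
      by (subst nn_integral_cmult[symmetric]) (measurable, simp add: add.commute)
    also have "(\<integral>\<^sup>+h. ennreal \<bar>\<phi> (h + y)\<bar> \<partial>lborel) = I"
      unfolding I_def by (rule nn_integral_translate[where f="\<lambda>y. ennreal \<bar>\<phi> y\<bar>"]) measurable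
    finally show "(\<integral>\<^sup>+h. ennreal ((w' y)\<^sup>2) * ennreal \<bar>\<phi> (y + h)\<bar> \<partial>lborel) = ennreal ((w' y)\<^sup>2) * I" .
  qed
  also have "\<dots> = (\<integral>\<^sup>+y. ennreal ((norm (w' y))\<^sup>2) \<partial>lborel) * I"
    by (simp add: nn_integral_multc)
  also have "(\<integral>\<^sup>+y. ennreal ((norm (w' y))\<^sup>2) \<partial>lborel) = ennreal ((norm (abs_l2 w'))\<^sup>2)"
    by (simp add: nn_integral_norm_power2[OF w'_L2, symmetric] nn_integral_completion)
  also have "I * (ennreal ((norm (abs_l2 w'))\<^sup>2) * I) < \<infinity>"
    using I_fin by (simp add: ennreal_mult_less_top)
  finally have "(\<integral>\<^sup>+h. ennreal ((norm (corr w' \<phi> h))\<^sup>2) \<partial>lborel) < \<infinity>" .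
  then show ?thesis
    unfolding eq by (intro L2_I_nn) (simp_all add: nn_integral_completion cm measurable_completion)
qed

text \<open>The kernel \<phi>(y + h) is symmetric in y and h, so correlating with \<phi> is its own
  transpose, by Fubini. This moves the regularisation from a weak gradient onto the test
  function.\<close>

lemma integral_corr_swap:
  fixes w \<phi> \<psi> :: "'a::euclidean_space \<Rightarrow> real"
  assumes w: "w \<in> L1_loc" and \<phi>: "\<phi> \<in> test_functions" and \<psi>: "\<psi> \<in> test_functions"
  shows "(\<integral>h. corr w \<phi> h * \<psi> h \<partial>lebesgue) = (\<integral>y. w y * corr \<psi> \<phi> y \<partial>lebesgue)"
proof -
  obtain w' where w'_borel[measurable]: "w' \<in> borel_measurable borel" and w'_L1: "w' \<in> L1_loc"
    and w': "AE x in lebesgue. w x = w' x"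
    using L1_loc_borel_representative[OF w] by blast
  note w'_meas = L1_loc_measurable[OF w'_L1]
  have eq: "corr w \<phi> = corr w' \<phi>"
    by (intro ext corr_cong_AE L1_loc_measurable w w'_meas \<phi> w')
  note m[measurable] = smooth_borel_measurable(1)[OF test_smooth[OF \<phi>]]
    smooth_borel_measurable(1)[OF test_smooth[OF \<psi>]]
  obtain r where r: "\<And>x. norm x > r \<Longrightarrow> \<phi> x = 0" using test_support[OF \<phi>] by blast
  obtain B where B: "B > 0" "\<And>x. norm (\<phi> x) \<le> B" using test_bounded[OF \<phi>] by blast
  obtain s where s: "\<And>x. norm x > s \<Longrightarrow> \<psi> x = 0" using test_support[OF \<psi>] by blast
  \<comment> \<open>Where the integrand is nonzero, y = (y + h) - h has norm at most r + s, so local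
    integrability of w' suffices for integrability in the product.\<close>
  define A where "A = cball (0::'a) (r + s)"
  have [measurable]: "A \<in> sets borel" by (simp add: A_def)
  have "integrable lebesgue (\<lambda>y. w' y * (B * indicator A y))"
  proof (rule L1_loc_integrable_mult[OF w'_L1, where B=B and r="r + s"])
    show "(\<lambda>y. B * indicator A y) \<in> borel_measurable lebesgue"
      by (intro borel_measurable_times borel_measurable_const borel_measurable_indicator) simp
  qed (use B(1) in \<open>auto simp: A_def indicator_def\<close>)
  then have "(\<integral>\<^sup>+y. ennreal (norm (w' y * (B * indicator A y))) \<partial>lebesgue) < \<infinity>"
    by (simp add: integrable_iff_bounded)
  then have fin1: "(\<integral>\<^sup>+y. ennreal (norm (w' y * (B * indicator A y))) \<partial>lborel) < \<infinity>"
    by (simp add: nn_integral_completion)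
  have meas: "(\<lambda>(y, h). w' y * \<phi> (y + h) * \<psi> h) \<in> borel_measurable (lborel \<Otimes>\<^sub>M lborel)"
    by measurable
  have int: "integrable (lborel \<Otimes>\<^sub>M lborel) (\<lambda>(y, h). w' y * \<phi> (y + h) * \<psi> h)"
  proof (rule integrableI_bounded)
    have "(\<integral>\<^sup>+z. ennreal (norm (case z of (y, h) \<Rightarrow> w' y * \<phi> (y + h) * \<psi> h)) \<partial>(lborel \<Otimes>\<^sub>M lborel)) =
        (\<integral>\<^sup>+y. \<integral>\<^sup>+h. ennreal (norm (w' y * \<phi> (y + h) * \<psi> h)) \<partial>lborel \<partial>lborel)"
      using lborel.nn_integral_fst[OF measurable_compose[OF measurable_compose[OF meas borel_measurable_norm] measurable_ennreal]]
      by (simp only: case_prod_conv)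
    also have "\<dots> \<le> (\<integral>\<^sup>+y. \<integral>\<^sup>+h. ennreal (norm (w' y * (B * indicator A y))) * ennreal \<bar>\<psi> h\<bar> \<partial>lborel \<partial>lborel)"
    proof (intro nn_integral_mono)
      fix y h :: 'a
      have "\<bar>w' y * \<phi> (y + h) * \<psi> h\<bar> \<le> \<bar>w' y * (B * indicator A y)\<bar> * \<bar>\<psi> h\<bar>"
      proof (cases "norm h \<le> s \<and> norm (y + h) \<le> r")
        case True
        then have "y \<in> A" using norm_triangle_ineq4[of "y + h" h] by (auto simp: A_def)
        then show ?thesis
          using B(1) B(2)[of "y + h"] by (simp add: abs_mult mult_mono)
      qed (use r s in \<open>auto simp: not_le\<close>)
      then show "ennreal (norm (w' y * \<phi> (y + h) * \<psi> h)) \<le> ennreal (norm (w' y * (B * indicator A y))) * ennreal \<bar>\<psi> h\<bar>"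
        by (simp add: ennreal_mult[symmetric] ennreal_leI)
    qed
    also have "\<dots> = (\<integral>\<^sup>+y. ennreal (norm (w' y * (B * indicator A y))) \<partial>lborel) * (\<integral>\<^sup>+h. ennreal \<bar>\<psi> h\<bar> \<partial>lborel)"
      by (simp add: nn_integral_cmult nn_integral_multc)
    also have "\<dots> < \<infinity>"
      using fin1 test_nn_integral_finite[OF \<psi>] by (simp add: ennreal_mult_less_top)
    finally show "(\<integral>\<^sup>+z. ennreal (norm (case z of (y, h) \<Rightarrow> w' y * \<phi> (y + h) * \<psi> h)) \<partial>(lborel \<Otimes>\<^sub>M lborel)) < \<infinity>" .
  qed (rule meas)
  have cm: "corr w' \<phi> \<in> borel_measurable borel" "corr \<psi> \<phi> \<in> borel_measurable borel"
    using smooth_borel_measurable(1)[OF smooth_corr[OF w'_L1 \<phi>]]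
      smooth_borel_measurable(1)[OF smooth_corr[OF L2_L1_loc[OF test_L2[OF \<psi>]] \<phi>]] by auto
  have "(\<integral>h. corr w' \<phi> h * \<psi> h \<partial>lebesgue) = (\<integral>h. corr w' \<phi> h * \<psi> h \<partial>lborel)"
    using cm by (intro integral_completion) simp
  also have "\<dots> = (\<integral>h. \<integral>y. w' y * \<phi> (y + h) * \<psi> h \<partial>lborel \<partial>lborel)"
    by (simp add: corr_eq_lborel[OF w'_borel \<phi>])
  also have "\<dots> = (\<integral>y. \<integral>h. w' y * \<phi> (y + h) * \<psi> h \<partial>lborel \<partial>lborel)"
    by (rule lborel_pair.Fubini_integral[OF int])
  also have "\<dots> = (\<integral>y. w' y * corr \<psi> \<phi> y \<partial>lborel)"
  proof (rule Bochner_Integration.integral_cong[OF refl])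
    fix y :: 'a
    have "(\<integral>h. w' y * \<phi> (y + h) * \<psi> h \<partial>lborel) = (\<integral>h. w' y * (\<psi> h * \<phi> (h + y)) \<partial>lborel)"
      by (simp add: mult_ac add.commute)
    then show "(\<integral>h. w' y * \<phi> (y + h) * \<psi> h \<partial>lborel) = w' y * corr \<psi> \<phi> y"
      by (simp add: corr_eq_lborel[OF m(2) \<phi>])
  qed
  also have "\<dots> = (\<integral>y. w' y * corr \<psi> \<phi> y \<partial>lebesgue)"
    using cm by (intro integral_completion[symmetric]) simp
  also have "\<dots> = (\<integral>y. w y * corr \<psi> \<phi> y \<partial>lebesgue)"
    using w' by (intro integral_cong_AE borel_measurable_times w'_meas L1_loc_measurable[OF w]
        measurable_completion[where N=borel]) (auto simp: cm)
  finally show ?thesis unfolding eq .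
qed

text \<open>The support lies in a ball whose radius is the sum of the two radii. Hence the
  regularised test function is admissible in the orthogonality hypothesis of
  \<open>Liouville\<close>.\<close>

lemma test_corr:
  assumes v: "v \<in> test_functions" and \<phi>: "\<phi> \<in> test_functions"
  shows "corr v \<phi> \<in> test_functions"
proof -
  obtain r where r: "\<And>x. norm x > r \<Longrightarrow> \<phi> x = 0" using test_support[OF \<phi>] by blast
  obtain s where s: "\<And>x. norm x > s \<Longrightarrow> v x = 0" using test_support[OF v] by blast
  show ?thesis
  proof (rule test_functionsI)
    show "smooth (corr v \<phi>)" by (rule smooth_corr[OF L2_L1_loc[OF test_L2[OF v]] \<phi>])
    show "corr v \<phi> h = 0" if "norm h > r + s" for h
    proof -
      have "v y * \<phi> (y + h) = 0" for y
      proof (cases "norm y \<le> s")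
        case True
        then have "norm (y + h) > r" using that norm_triangle_ineq4[of "y + h" y] by simp
        then show ?thesis by (simp add: r)
      qed (simp add: s)
      then show ?thesis unfolding corr_def by (simp only: Bochner_Integration.integral_zero)
    qed
  qed
qed

lemma L2_sum:
  "(\<And>i. f i \<in> L2) \<Longrightarrow> (\<lambda>x. \<Sum>i\<in>I. f i x) \<in> L2"
  by (induction I rule: infinite_finite_induct) (auto intro: L2_add simp: L2_zero)

text \<open>The correlation of \<open>w\<close> with \<phi> is smooth, has a square integrable
  gradient and inherits the orthogonality, so its gradient vanishes. At the point 0 this says that F
  integrates to zero against every \<phi>; no limit of regularisations is taken.\<close>

lemma Liouville:
  fixes w :: "'a::euclidean_space \<Rightarrow> real"
  assumes w: "w \<in> L1_loc" and F: "F \<in> L2" and wF: "weak_grad w F"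
    and orth: "\<And>v. v \<in> test_functions \<Longrightarrow> (\<integral>x. F x \<bullet> grad v x \<partial>lebesgue) = 0"
  shows "AE x in lebesgue. F x = 0"
proof -
  have Fb: "(\<lambda>x. F x \<bullet> b) \<in> L2" for b
    by (rule L2_bounded_linear[OF bounded_linear_inner_left F])
  have zero: "corr (\<lambda>x. F x \<bullet> b) \<phi> h = 0" if \<phi>: "\<phi> \<in> test_functions" and b: "b \<in> Basis" for \<phi> b h
  proof -
    \<comment> \<open>The derivative falls on a translate of \<phi>, itself a test function, and the
      definition of the weak gradient moves it onto w with a minus sign.\<close>
    have d: "dderiv b (corr w \<phi>) h = - corr (\<lambda>x. F x \<bullet> b) \<phi> h" if b: "b \<in> Basis" for b h
    proof -
      have "dderiv b (corr w \<phi>) h = (\<integral>y. w y * dderiv b (\<lambda>y. \<phi> (y + h)) y \<partial>lebesgue)"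
        using fun_cong[OF dderiv_corr[OF w \<phi>, of b], of h]
        by (simp only: corr_def fun_cong[OF dderiv_translate[OF test_smooth[OF \<phi>]]])
      also have "\<dots> = - corr (\<lambda>x. F x \<bullet> b) \<phi> h"
        using wF test_translate[OF \<phi>, of h] b by (simp add: weak_grad_def corr_def)
      finally show ?thesis .
    qed
    have sW: "smooth (corr w \<phi>)" by (rule smooth_corr[OF w \<phi>])
    have gW: "grad (corr w \<phi>) = (\<lambda>h. \<Sum>b\<in>Basis. (- corr (\<lambda>x. F x \<bullet> b) \<phi> h) *\<^sub>R b)"
      by (intro ext) (simp add: grad_def d)
    have bL: "(\<lambda>h. (- corr (\<lambda>x. F x \<bullet> b) \<phi> h) *\<^sub>R b) \<in> L2" for b
      by (intro L2_bounded_linear[OF bounded_linear_scaleR_left, of "\<lambda>h. - corr (\<lambda>x. F x \<bullet> b) \<phi> h"]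
          L2_uminus corr_L2 Fb \<phi>)
    have gL: "grad (corr w \<phi>) \<in> L2"
      unfolding gW by (rule L2_sum[OF bL])
    have "(\<integral>h. grad (corr w \<phi>) h \<bullet> grad v h \<partial>lebesgue) = 0" if v: "v \<in> test_functions" for v
    proof -
      have vL: "v \<in> L1_loc" by (rule L2_L1_loc[OF test_L2[OF v]])
      have dv: "dderiv b v \<in> test_functions" for b by (rule test_dderiv[OF v])
      \<comment> \<open>A second integration by parts returns the derivative to \<phi>; its sign
        cancels the one from \<open>d\<close>.\<close>
      have parts: "corr (dderiv b v) \<phi> y = - dderiv b (corr v \<phi>) y" for b y
      proof -
        have "(\<integral>h. \<phi> (h + y) * dderiv b v h \<partial>lebesgue) = - (\<integral>h. dderiv b \<phi> (h + y) * v h \<partial>lebesgue)"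
          using integration_by_parts[OF test_smooth[OF test_translate[OF \<phi>, of y]] v, of b]
          by (simp only: fun_cong[OF dderiv_translate[OF test_smooth[OF \<phi>]]])
        then show ?thesis
          using fun_cong[OF dderiv_corr[OF vL \<phi>, of b], of y] by (simp add: corr_def mult.commute)
      qed
      have i1: "integrable lebesgue (\<lambda>h. corr (\<lambda>x. F x \<bullet> b) \<phi> h * dderiv b v h)" for b
        using L2_integrable_inner[OF corr_L2[OF Fb \<phi>] test_L2[OF dv]] by simp
      have i2: "integrable lebesgue (\<lambda>y. (F y \<bullet> b) * dderiv b (corr v \<phi>) y)" for b
        using L2_integrable_inner[OF Fb test_L2[OF test_dderiv[OF test_corr[OF v \<phi>]]]] by simp
      have "(\<integral>h. grad (corr w \<phi>) h \<bullet> grad v h \<partial>lebesgue) =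
          (\<integral>h. (\<Sum>b\<in>Basis. - (corr (\<lambda>x. F x \<bullet> b) \<phi> h * dderiv b v h)) \<partial>lebesgue)"
        by (intro Bochner_Integration.integral_cong refl)
          (subst euclidean_inner, simp add: grad_component d)
      also have "\<dots> = (\<Sum>b\<in>Basis. - (\<integral>h. corr (\<lambda>x. F x \<bullet> b) \<phi> h * dderiv b v h \<partial>lebesgue))"
        by (subst Bochner_Integration.integral_sum) (auto intro: i1)
      also have "\<dots> = (\<Sum>b\<in>Basis. \<integral>y. (F y \<bullet> b) * dderiv b (corr v \<phi>) y \<partial>lebesgue)"
        by (simp add: integral_corr_swap[OF L2_L1_loc[OF Fb] \<phi> dv] parts)
      also have "\<dots> = (\<integral>y. (\<Sum>b\<in>Basis. (F y \<bullet> b) * dderiv b (corr v \<phi>) y) \<partial>lebesgue)"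
        by (rule Bochner_Integration.integral_sum[symmetric]) (rule i2)
      also have "\<dots> = (\<integral>y. F y \<bullet> grad (corr v \<phi>) y \<partial>lebesgue)"
        by (intro Bochner_Integration.integral_cong refl)
          (subst euclidean_inner[of "F _" "grad _ _"], simp add: grad_component)
      also have "\<dots> = 0" by (rule orth[OF test_corr[OF v \<phi>]])
      finally show ?thesis .
    qed
    from smooth_Liouville[OF sW gL this] have "grad (corr w \<phi>) h = 0" .
    then show ?thesis using d[OF b, of h] by (simp add: grad_component[OF b, symmetric])
  qed
  have "AE x in lebesgue. F x \<bullet> b = 0" if b: "b \<in> Basis" for b
  proof (rule fundamental_lemma[OF L2_L1_loc[OF Fb]])
    fix \<phi> :: "'a \<Rightarrow> real" assume "\<phi> \<in> test_functions"
    from zero[OF this b, of 0] show "(\<integral>x. (F x \<bullet> b) * \<phi> x \<partial>lebesgue) = 0" by (simp add: corr_def)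
  qed
  then have "AE x in lebesgue. \<forall>b\<in>Basis. F x \<bullet> b = 0"
    by (simp add: AE_ball_countable countable_finite)
  then show ?thesis by eventually_elim (simp add: euclidean_all_zero_iff)
qed

section \<open>Vector-valued weak gradients\<close>

lemma vec_nth_measurable:
  fixes f :: "'a \<Rightarrow> 'b::euclidean_space^'n"
  assumes "f \<in> borel_measurable M" shows "(\<lambda>x. f x $ i) \<in> borel_measurable M"
  using measurable_compose[OF assms borel_measurable_continuous_onI[OF linear_continuous_on[OF bounded_linear_vec_nth]]] .

lemma vec_lambda_measurable:
  fixes f :: "'n::finite \<Rightarrow> 'a \<Rightarrow> 'b::euclidean_space"
  assumes "\<And>i. f i \<in> borel_measurable M" shows "(\<lambda>x. \<chi> i. f i x) \<in> borel_measurable M"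
proof (subst borel_measurable_euclidean_space, intro ballI)
  fix e :: "'b^'n" assume "e \<in> Basis"
  then obtain i b where "e = axis i b" by (auto simp: Basis_vec_def)
  then show "(\<lambda>x. (\<chi> i. f i x) \<bullet> e) \<in> borel_measurable M"
    using assms[of i] by (simp add: inner_axis)
qed

lemma norm_power2_vec: "(norm (x :: 'b::real_inner^'n))\<^sup>2 = (\<Sum>i\<in>UNIV. (norm (x $ i))\<^sup>2)"
  by (simp add: power2_norm_eq_inner inner_vec_def)

lemma L2_vec_nth: "f \<in> L2 \<Longrightarrow> (\<lambda>x. f x $ i) \<in> L2"
  by (rule L2_bounded_linear[OF bounded_linear_vec_nth])

lemma L2_vec_lambda:
  fixes f :: "'n::finite \<Rightarrow> 'a::euclidean_space \<Rightarrow> 'b::euclidean_space"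
  assumes "\<And>i. f i \<in> L2" shows "(\<lambda>x. \<chi> i. f i x) \<in> L2"
proof (rule L2_I)
  show "(\<lambda>x. \<chi> i. f i x) \<in> borel_measurable lebesgue"
    by (intro vec_lambda_measurable L2_measurable assms)
  show "integrable lebesgue (\<lambda>x. \<Sum>i\<in>UNIV. (norm (f i x))\<^sup>2)"
    by (intro Bochner_Integration.integrable_sum L2_integrable assms)
qed (simp add: norm_power2_vec)

lemma L2_loc_vec_lambda:
  fixes f :: "'n::finite \<Rightarrow> 'a::euclidean_space \<Rightarrow> 'b::euclidean_space"
  assumes "\<And>i. f i \<in> L2_loc" shows "(\<lambda>x. \<chi> i. f i x) \<in> L2_loc"
proof -
  have "set_integrable lebesgue K (\<lambda>x. (norm (\<chi> i. f i x))\<^sup>2)" if K: "compact K" for K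
  proof -
    have "integrable lebesgue (\<lambda>x. \<Sum>i\<in>UNIV. indicator K x * (norm (f i x))\<^sup>2)"
      using assms K by (intro Bochner_Integration.integrable_sum) (simp add: L2_loc_def set_integrable_def)
    then show ?thesis by (simp add: set_integrable_def norm_power2_vec sum_distrib_left)
  qed
  moreover have "(\<lambda>x. \<chi> i. f i x) \<in> borel_measurable lebesgue"
    using assms by (intro vec_lambda_measurable) (simp add: L2_loc_def)
  ultimately show ?thesis by (simp add: L2_loc_def)
qed

lemma L1_loc_vec_nth: "f \<in> L1_loc \<Longrightarrow> (\<lambda>x. f x $ i) \<in> L1_loc"
  for f :: "'a::euclidean_space \<Rightarrow> 'b::euclidean_space^'n"
  by (rule L1_loc_bounded_linear[OF bounded_linear_vec_nth])

lemma L2_loc_lincomb: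
  assumes "u \<in> L2_loc" "w \<in> L2_loc" shows "(\<lambda>x. s *\<^sub>R u x + t *\<^sub>R w x) \<in> L2_loc"
proof -
  have c: "(\<lambda>x. s *\<^sub>R u x + t *\<^sub>R w x) \<in> borel_measurable lebesgue"
    using assms by (intro borel_measurable_add borel_measurable_scaleR borel_measurable_const) (auto simp: L2_loc_def)
  have "(\<lambda>x. (norm (s *\<^sub>R u x + t *\<^sub>R w x))\<^sup>2) \<in> L1_loc"
  proof (rule L1_loc_bound)
    show "(\<lambda>x. (2 * s\<^sup>2) *\<^sub>R (norm (u x))\<^sup>2 + (2 * t\<^sup>2) *\<^sub>R (norm (w x))\<^sup>2) \<in> L1_loc"
      using assms by (intro L1_loc_lincomb) (auto simp: L2_loc_iff)
    have "(norm (s *\<^sub>R u x + t *\<^sub>R w x))\<^sup>2 \<le> 2 * s\<^sup>2 * (norm (u x))\<^sup>2 + 2 * t\<^sup>2 * (norm (w x))\<^sup>2" for x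
      using norm_add_power2_le[of "s *\<^sub>R u x" "t *\<^sub>R w x"] by (simp add: power_mult_distrib)
    then show "AE x in lebesgue. norm ((norm (s *\<^sub>R u x + t *\<^sub>R w x))\<^sup>2) \<le>
        norm ((2 * s\<^sup>2) *\<^sub>R (norm (u x))\<^sup>2 + (2 * t\<^sup>2) *\<^sub>R (norm (w x))\<^sup>2)" by simp
  qed (intro borel_measurable_power measurable_compose[OF c borel_measurable_norm])
  with c show ?thesis by (simp add: L2_loc_iff)
qed

lemma L2_loc_cong_AE:
  assumes f: "f \<in> L2_loc" and eq: "AE x in lebesgue. f x = g x"
  shows "g \<in> L2_loc"
proof -
  have g: "g \<in> borel_measurable lebesgue"
    by (rule borel_measurable_AE[OF _ eq]) (use f in \<open>simp add: L2_loc_def\<close>)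
  have "(\<lambda>x. (norm (g x))\<^sup>2) \<in> L1_loc"
  proof (rule L1_loc_cong_AE)
    show "(\<lambda>x. (norm (f x))\<^sup>2) \<in> L1_loc" using f by (simp add: L2_loc_iff)
    show "AE x in lebesgue. (norm (f x))\<^sup>2 = (norm (g x))\<^sup>2" using eq by eventually_elim simp
  qed (intro borel_measurable_power measurable_compose[OF g borel_measurable_norm])
  with g show ?thesis by (simp add: L2_loc_iff)
qed

lemma partial_deriv_eq: "partial_deriv \<alpha> \<phi> = dderiv (axis \<alpha> 1) \<phi>"
  by (intro ext) (simp add: partial_deriv_def)

lemma Ball_Basis_vec: "(\<forall>b\<in>(Basis :: (real^'n) set). P b) \<longleftrightarrow> (\<forall>\<alpha>. P (axis \<alpha> 1))"
  by (auto simp: Basis_vec_def)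

lemma is_weak_gradient_iff:
  "is_weak_gradient u G \<longleftrightarrow> u \<in> L1_loc \<and> G \<in> L1_loc \<and>
    (\<forall>i. weak_grad (\<lambda>x. u x $ i) (\<lambda>x. G x $ i))"
  unfolding is_weak_gradient_def weak_grad_def partial_deriv_eq Ball_Basis_vec
  by (auto simp: inner_axis)

text \<open>Local integrability is required to split the integrals: otherwise the integral of a sum
  need not be the sum of the integrals.\<close>

lemma weak_grad_lincomb:
  assumes w: "weak_grad w F" "weak_grad w' F'"
    and L: "w \<in> L1_loc" "w' \<in> L1_loc" "F \<in> L1_loc" "F' \<in> L1_loc"
  shows "weak_grad (\<lambda>x. s * w x + t * w' x) (\<lambda>x. s *\<^sub>R F x + t *\<^sub>R F' x)"
  unfolding weak_grad_def
proof (intro ballI)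
  fix \<phi> :: "'a \<Rightarrow> real" and b :: 'a assume \<phi>: "\<phi> \<in> test_functions" and b: "b \<in> Basis"
  note Fb = L1_loc_bounded_linear[OF bounded_linear_inner_left]
  note i = L1_loc_integrable_test[OF L(1) test_dderiv[OF \<phi>]] L1_loc_integrable_test[OF L(2) test_dderiv[OF \<phi>]]
    L1_loc_integrable_test[OF Fb[OF L(3)] \<phi>] L1_loc_integrable_test[OF Fb[OF L(4)] \<phi>]
  have "(\<integral>x. (s * w x + t * w' x) * dderiv b \<phi> x \<partial>lebesgue) =
      (\<integral>x. s * (w x * dderiv b \<phi> x) + t * (w' x * dderiv b \<phi> x) \<partial>lebesgue)"
    by (simp add: algebra_simps)
  also have "\<dots> = s * (\<integral>x. w x * dderiv b \<phi> x \<partial>lebesgue) + t * (\<integral>x. w' x * dderiv b \<phi> x \<partial>lebesgue)"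
    using i by simp
  also have "\<dots> = - (s * (\<integral>x. (F x \<bullet> b) * \<phi> x \<partial>lebesgue) + t * (\<integral>x. (F' x \<bullet> b) * \<phi> x \<partial>lebesgue))"
    using w \<phi> b by (simp add: weak_grad_def)
  also have "\<dots> = - (\<integral>x. s * ((F x \<bullet> b) * \<phi> x) + t * ((F' x \<bullet> b) * \<phi> x) \<partial>lebesgue)"
    using i by simp
  also have "\<dots> = - (\<integral>x. ((s *\<^sub>R F x + t *\<^sub>R F' x) \<bullet> b) * \<phi> x \<partial>lebesgue)"
    by (simp add: inner_add_left algebra_simps)
  finally show "(\<integral>x. (s * w x + t * w' x) * dderiv b \<phi> x \<partial>lebesgue) =
      - (\<integral>x. ((s *\<^sub>R F x + t *\<^sub>R F' x) \<bullet> b) * \<phi> x \<partial>lebesgue)" .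
qed

lemma is_weak_gradient_lincomb:
  assumes "is_weak_gradient u G" "is_weak_gradient u' G'"
  shows "is_weak_gradient (\<lambda>x. s *\<^sub>R u x + t *\<^sub>R u' x) (\<lambda>x. s *\<^sub>R G x + t *\<^sub>R G' x)"
  using assms unfolding is_weak_gradient_iff
  by (auto intro!: L1_loc_lincomb weak_grad_lincomb L1_loc_vec_nth)

lemma weak_grad_AE_zero:
  fixes w :: "'a::euclidean_space \<Rightarrow> real"
  assumes F: "F \<in> L1_loc" and w: "AE x in lebesgue. w x = 0" "w \<in> borel_measurable lebesgue"
    and wF: "weak_grad w F"
  shows "AE x in lebesgue. F x = 0"
proof -
  have "AE x in lebesgue. F x \<bullet> b = 0" if b: "b \<in> Basis" for b
  proof (rule fundamental_lemma)
    show "(\<lambda>x. F x \<bullet> b) \<in> L1_loc" by (rule L1_loc_bounded_linear[OF bounded_linear_inner_left F])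
    fix \<phi> :: "'a \<Rightarrow> real" assume \<phi>: "\<phi> \<in> test_functions"
    have "(\<integral>x. w x * dderiv b \<phi> x \<partial>lebesgue) = (\<integral>x. 0 \<partial>(lebesgue :: 'a measure))"
    proof (rule integral_cong_AE)
      show "AE x in lebesgue. w x * dderiv b \<phi> x = 0" using w(1) by eventually_elim simp
    qed (intro borel_measurable_times borel_measurable_const w(2)
        smooth_borel_measurable(2)[OF test_smooth[OF test_dderiv[OF \<phi>]]])+
    then show "(\<integral>x. (F x \<bullet> b) * \<phi> x \<partial>lebesgue) = 0"
      using wF \<phi> b by (simp add: weak_grad_def)
  qed
  then have "AE x in lebesgue. \<forall>b\<in>Basis. F x \<bullet> b = 0"
    by (simp add: AE_ball_countable countable_finite)
  then show ?thesis by eventually_elim (simp add: euclidean_all_zero_iff)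
qed

text \<open>The difference is a weak gradient of the zero function, hence zero by the fundamental
  lemma. The choice made in \<open>weak_gradient\<close> is thereby harmless.\<close>

lemma is_weak_gradient_unique:
  assumes "is_weak_gradient u G" "is_weak_gradient u G'"
  shows "AE x in lebesgue. G x = G' x"
proof -
  have D: "is_weak_gradient (\<lambda>x. 1 *\<^sub>R u x + (- 1) *\<^sub>R u x) (\<lambda>x. 1 *\<^sub>R G x + (- 1) *\<^sub>R G' x)"
    by (rule is_weak_gradient_lincomb[OF assms])
  then have DL: "(\<lambda>x. 1 *\<^sub>R G x + (- 1) *\<^sub>R G' x) \<in> L1_loc" by (simp only: is_weak_gradient_iff)
  have "AE x in lebesgue. (1 *\<^sub>R G x + (- 1) *\<^sub>R G' x) $ i = 0" for i
  proof (rule weak_grad_AE_zero[OF L1_loc_vec_nth[OF DL]])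
    show "weak_grad (\<lambda>x. (1 *\<^sub>R u x + (- 1) *\<^sub>R u x) $ i) (\<lambda>x. (1 *\<^sub>R G x + (- 1) *\<^sub>R G' x) $ i)"
      using D by (simp only: is_weak_gradient_iff)
  qed auto
  then have "AE x in lebesgue. \<forall>i. (1 *\<^sub>R G x + (- 1) *\<^sub>R G' x) $ i = 0"
    by (simp add: AE_all_countable)
  then show ?thesis by eventually_elim (simp add: vec_eq_iff)
qed

section \<open>Classes modulo constants and their gradients\<close>

lemma const_class_refl: "u \<in> const_class u"
  by (auto simp: const_class_def intro!: exI[of _ 0])

lemma const_class_eq_iff: "const_class w = const_class u \<longleftrightarrow> w \<in> const_class u"
proof
  assume "w \<in> const_class u"
  then obtain c where c: "AE x in lebesgue. w x = u x + c" by (auto simp: const_class_def)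
  show "const_class w = const_class u"
  proof (intro set_eqI iffI)
    fix v assume "v \<in> const_class w"
    then obtain d where "AE x in lebesgue. v x = w x + d" by (auto simp: const_class_def)
    with c have "AE x in lebesgue. v x = u x + (c + d)" by eventually_elim simp
    then show "v \<in> const_class u" by (auto simp: const_class_def)
  next
    fix v assume "v \<in> const_class u"
    then obtain d where "AE x in lebesgue. v x = u x + d" by (auto simp: const_class_def)
    with c have "AE x in lebesgue. v x = w x + (d - c)" by eventually_elim simp
    then show "v \<in> const_class w" by (auto simp: const_class_def)
  qed
qed (use const_class_refl in blast)

text \<open>Derivatives of test functions integrate to zero, so an additive constant is not seen;
  neither is a change on a null set.\<close>

lemma is_weak_gradient_const_class:
  fixes u :: "real^'d::finite \<Rightarrow> real^'m::finite"
  assumes u: "is_weak_gradient u G" and w: "w \<in> const_class u"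
  shows "is_weak_gradient w G"
proof -
  obtain c where c: "AE x in lebesgue. w x = u x + c" using w by (auto simp: const_class_def)
  have uL: "u \<in> L1_loc" and GL: "G \<in> L1_loc" using u by (auto simp: is_weak_gradient_iff)
  have cL: "(\<lambda>x. c) \<in> L1_loc" by (rule continuous_L1_loc) simp
  have ucL: "(\<lambda>x. u x + c) \<in> L1_loc" using L1_loc_lincomb[OF uL cL, of 1 1] by simp
  have wm: "w \<in> borel_measurable lebesgue"
    by (rule borel_measurable_AE[OF L1_loc_measurable[OF ucL]]) (use c in auto)
  have wL: "w \<in> L1_loc" by (rule L1_loc_cong_AE[OF ucL wm]) (use c in auto)
  have "weak_grad (\<lambda>x. w x $ i) (\<lambda>x. G x $ i)" for i
    unfolding weak_grad_def
  proof (intro ballI)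
    fix \<phi> :: "real^'d \<Rightarrow> real" and b :: "real^'d" assume \<phi>: "\<phi> \<in> test_functions" and b: "b \<in> Basis"
    have "(\<integral>x. w x $ i * dderiv b \<phi> x \<partial>lebesgue) = (\<integral>x. u x $ i * dderiv b \<phi> x + c $ i * dderiv b \<phi> x \<partial>lebesgue)"
    proof (rule integral_cong_AE)
      show "AE x in lebesgue. w x $ i * dderiv b \<phi> x = u x $ i * dderiv b \<phi> x + c $ i * dderiv b \<phi> x"
        using c by eventually_elim (simp add: distrib_right)
    qed (intro borel_measurable_add borel_measurable_times borel_measurable_const vec_nth_measurable wm
        L1_loc_measurable[OF uL] smooth_borel_measurable(2) test_smooth test_dderiv \<phi>)+
    also have "\<dots> = (\<integral>x. u x $ i * dderiv b \<phi> x \<partial>lebesgue) + c $ i * (\<integral>x. dderiv b \<phi> x \<partial>lebesgue)"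
      using L1_loc_integrable_test[OF L1_loc_vec_nth[OF uL] test_dderiv[OF \<phi>]]
        L1_loc_integrable_test[OF L1_loc_vec_nth[OF cL] test_dderiv[OF \<phi>]]
      by (subst Bochner_Integration.integral_add) auto
    also have "\<dots> = - (\<integral>x. (G x $ i \<bullet> b) * \<phi> x \<partial>lebesgue)"
      using u \<phi> b by (simp add: integral_dderiv_test is_weak_gradient_iff weak_grad_def)
    finally show "(\<integral>x. w x $ i * dderiv b \<phi> x \<partial>lebesgue) = - (\<integral>x. (G x $ i \<bullet> b) * \<phi> x \<partial>lebesgue)" .
  qed
  with wL GL show ?thesis by (simp add: is_weak_gradient_iff)
qed

lemma weak_gradient_works: "is_weak_gradient u G \<Longrightarrow> is_weak_gradient u (weak_gradient u)"
  unfolding weak_gradient_def by (rule someI[of "is_weak_gradient u"])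

text \<open>\<open>class_gradient\<close> chooses twice, a representative of the class and then a
  weak gradient of it. Both choices are immaterial up to a null set.\<close>

lemma class_gradient_AE:
  assumes "is_weak_gradient u G"
  shows "class_gradient (const_class u) \<in> borel_measurable lebesgue"
    "AE x in lebesgue. G x = class_gradient (const_class u) x"
proof -
  define w where "w = (SOME w. w \<in> const_class u)"
  have "w \<in> const_class u" unfolding w_def by (rule someI[of "\<lambda>w. w \<in> const_class u", OF const_class_refl])
  then have w: "is_weak_gradient w G" by (rule is_weak_gradient_const_class[OF assms])
  note wg = weak_gradient_works[OF w]
  have eq: "class_gradient (const_class u) = weak_gradient w" by (simp add: class_gradient_def w_def)
  show "class_gradient (const_class u) \<in> borel_measurable lebesgue"
    unfolding eq using wg by (auto simp: is_weak_gradient_iff L1_loc_measurable)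
  show "AE x in lebesgue. G x = class_gradient (const_class u) x"
    unfolding eq by (rule is_weak_gradient_unique[OF w wg])
qed

text \<open>As an element of \<open>l2\<close> the gradient of a class no longer depends on choices.
  This is the isometric embedding of \<open>H1_dot\<close> into a Hilbert space.\<close>

definition l2_grad :: "(real^'d::finite \<Rightarrow> real^'m::finite) set \<Rightarrow> (real^'d, real^'d^'m) l2" where
  "l2_grad U = abs_l2 (class_gradient U)"

lemma
  assumes "is_weak_gradient u G" "G \<in> L2"
  shows class_gradient_L2: "class_gradient (const_class u) \<in> L2"
    and l2_grad_eq: "l2_grad (const_class u) = abs_l2 G"
proof -
  note cg = class_gradient_AE[OF assms(1)]
  show L: "class_gradient (const_class u) \<in> L2" by (rule L2_cong_AE[OF assms(2) cg])
  have "AE x in lebesgue. class_gradient (const_class u) x = G x"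
    using cg(2) by eventually_elim simp
  then show "l2_grad (const_class u) = abs_l2 G"
    by (simp add: l2_grad_def abs_l2_eq_iff L assms(2))
qed

lemma H1_dotI:
  assumes "u \<in> L2_loc" "is_weak_gradient u G" "G \<in> L2"
  shows "const_class u \<in> H1_dot"
proof -
  note wg = weak_gradient_works[OF assms(2)]
  have "weak_gradient u \<in> borel_measurable lebesgue"
    using wg by (auto simp: is_weak_gradient_iff L1_loc_measurable)
  then have "weak_gradient u \<in> L2"
    by (rule L2_cong_AE[OF assms(3) _ is_weak_gradient_unique[OF assms(2) wg]])
  then show ?thesis
    using assms L2_L2_loc by (auto simp: H1_dot_def W12_loc_def)
qed

lemma H1_dotE:
  assumes "U \<in> H1_dot"
  obtains u G where "U = const_class u" "u \<in> L2_loc" "is_weak_gradient u G" "G \<in> L2"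
  using assms weak_gradient_works by (fastforce simp: H1_dot_def W12_loc_def)

text \<open>Membership in \<open>H1_dot\<close> provides only some representative with the required
  properties; they pass to the given \<open>u\<close> because constants are locally square
  integrable.\<close>

lemma const_class_H1_dotE:
  fixes u :: "real^'d::finite \<Rightarrow> real^'m::finite"
  assumes "const_class u \<in> H1_dot"
  obtains G where "u \<in> L2_loc" "is_weak_gradient u G" "G \<in> L2"
proof -
  obtain w G where w: "const_class u = const_class w" "w \<in> L2_loc" "is_weak_gradient w G" "G \<in> L2"
    using H1_dotE[OF assms] by blast
  then have uw: "u \<in> const_class w" by (simp add: const_class_eq_iff)
  then obtain c where c: "AE x in lebesgue. u x = w x + c" by (auto simp: const_class_def)
  have "(\<lambda>x::real^'d. (norm c)\<^sup>2) \<in> L1_loc" by (rule continuous_L1_loc) simp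
  then have cL: "(\<lambda>x::real^'d. c) \<in> L2_loc" by (simp add: L2_loc_iff)
  have wc: "(\<lambda>x. w x + c) \<in> L2_loc" using L2_loc_lincomb[OF w(2) cL, of 1 1] by simp
  have "AE x in lebesgue. w x + c = u x" using c by eventually_elim simp
  then have "u \<in> L2_loc" by (rule L2_loc_cong_AE[OF wc])
  moreover have "is_weak_gradient u G" by (rule is_weak_gradient_const_class[OF w(3) uw])
  ultimately show ?thesis using that w(4) by blast
qed

text \<open>Each component of the difference has vanishing weak gradient and is therefore constant
  almost everywhere; the constants form the vector that relates the classes.\<close>

lemma const_class_eqI_gradients_eq:
  fixes u w :: "real^'d::finite \<Rightarrow> real^'m::finite"
  assumes u: "is_weak_gradient u G" "is_weak_gradient w G'" and eq: "AE x in lebesgue. G x = G' x"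
  shows "const_class u = const_class w"
proof -
  define d where "d x = 1 *\<^sub>R u x + (- 1) *\<^sub>R w x" for x
  define D where "D x = 1 *\<^sub>R G x + (- 1) *\<^sub>R G' x" for x
  have D: "is_weak_gradient d D" unfolding d_def D_def by (rule is_weak_gradient_lincomb[OF u])
  have D0: "AE x in lebesgue. D x = 0" using eq by eventually_elim (simp add: D_def)
  have "\<exists>c. AE x in lebesgue. d x $ i = c" for i
  proof -
    have dL: "d \<in> L1_loc" and DL: "D \<in> L1_loc" using D by (auto simp: is_weak_gradient_iff)
    have "(\<integral>x. d x $ i * dderiv h \<phi> x \<partial>lebesgue) = 0" if \<phi>: "\<phi> \<in> test_functions" for \<phi> h
    proof -
      \<comment> \<open>A weak gradient speaks of the basis directions only; an arbitrary direction
        is expanded in them afterwards.\<close>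
      have basis: "(\<integral>x. d x $ i * dderiv b \<phi> x \<partial>lebesgue) = 0" if b: "b \<in> Basis" for b
      proof -
        have "(\<integral>x. (D x $ i \<bullet> b) * \<phi> x \<partial>lebesgue) = (\<integral>x. 0 \<partial>(lebesgue :: (real^'d) measure))"
        proof (rule integral_cong_AE)
          show "AE x in lebesgue. (D x $ i \<bullet> b) * \<phi> x = 0" using D0 by eventually_elim simp
        qed (intro borel_measurable_times borel_measurable_inner vec_nth_measurable borel_measurable_const
            L1_loc_measurable[OF DL] smooth_borel_measurable(2) test_smooth \<phi>)+
        then show ?thesis using D \<phi> b by (simp add: is_weak_gradient_iff weak_grad_def)
      qed
      have "(\<integral>x. d x $ i * dderiv h \<phi> x \<partial>lebesgue) =
          (\<integral>x. (\<Sum>b\<in>Basis. (h \<bullet> b) * (d x $ i * dderiv b \<phi> x)) \<partial>lebesgue)"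
      proof (intro Bochner_Integration.integral_cong refl)
        fix x
        have "dderiv h \<phi> x = (\<Sum>b\<in>Basis. (grad \<phi> x \<bullet> b) * (h \<bullet> b))"
          unfolding grad_inner[OF test_smooth[OF \<phi>], symmetric] by (rule euclidean_inner)
        then show "d x $ i * dderiv h \<phi> x = (\<Sum>b\<in>Basis. (h \<bullet> b) * (d x $ i * dderiv b \<phi> x))"
          by (simp add: grad_component sum_distrib_left mult_ac)
      qed
      also have "\<dots> = (\<Sum>b\<in>Basis. (h \<bullet> b) * (\<integral>x. d x $ i * dderiv b \<phi> x \<partial>lebesgue))"
        using L1_loc_integrable_test[OF L1_loc_vec_nth[OF dL] test_dderiv[OF \<phi>]]
        by (subst Bochner_Integration.integral_sum) auto
      finally show ?thesis by (simp add: basis)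
    qed
    from AE_const_of_zero_gradient[OF L1_loc_vec_nth[OF dL] this] show ?thesis by blast
  qed
  then obtain c where c: "\<And>i. AE x in lebesgue. d x $ i = c i" by metis
  then have "AE x in lebesgue. \<forall>i. d x $ i = c i" by (simp add: AE_all_countable)
  then have "AE x in lebesgue. u x = w x + (\<chi> i. c i)"
    by eventually_elim (auto simp: d_def vec_eq_iff algebra_simps)
  then have "u \<in> const_class w" by (auto simp: const_class_def)
  then show ?thesis by (simp add: const_class_eq_iff)
qed

section \<open>Density of test gradients\<close>

definition test_grad :: "(real^'d::finite \<Rightarrow> real^'m::finite) \<Rightarrow> real^'d \<Rightarrow> real^'d^'m" where
  "test_grad v x = (\<chi> i. grad (\<lambda>y. v y $ i) x)"

definition test_gradients :: "(real^'d::finite, real^'d^'m::finite) l2 set" where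
  "test_gradients = (\<lambda>v. abs_l2 (test_grad v)) ` test_functions"

lemma test_vec_nth: "v \<in> test_functions \<Longrightarrow> (\<lambda>x. v x $ i) \<in> test_functions"
  by (rule test_bounded_linear[OF bounded_linear_vec_nth])

lemma test_grad_L2: "v \<in> test_functions \<Longrightarrow> test_grad v \<in> L2"
  unfolding test_grad_def by (intro L2_vec_lambda grad_test_L2 test_vec_nth)

lemma is_weak_gradient_test: "v \<in> test_functions \<Longrightarrow> is_weak_gradient v (test_grad v)"
  unfolding is_weak_gradient_iff
proof (intro conjI allI)
  assume v: "v \<in> test_functions"
  show "v \<in> L1_loc" by (rule L2_L1_loc[OF test_L2[OF v]])
  show "test_grad v \<in> L1_loc" by (rule L2_L1_loc[OF test_grad_L2[OF v]])
  show "weak_grad (\<lambda>x. v x $ i) (\<lambda>x. test_grad v x $ i)" for i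
    using weak_grad_smooth[OF test_smooth[OF test_vec_nth[OF v]], of i] by (simp add: test_grad_def)
qed

lemma const_class_test_H1_dot: "v \<in> test_functions \<Longrightarrow> const_class v \<in> H1_dot"
  by (intro H1_dotI[OF L2_L2_loc[OF test_L2] is_weak_gradient_test test_grad_L2])

lemma l2_grad_test: "v \<in> test_functions \<Longrightarrow> l2_grad (const_class v) = abs_l2 (test_grad v)"
  by (intro l2_grad_eq is_weak_gradient_test test_grad_L2)

lemma test_lincomb:
  assumes "v \<in> test_functions" "w \<in> test_functions"
  shows "(\<lambda>x. s *\<^sub>R v x + t *\<^sub>R w x) \<in> test_functions"
  by (intro test_add test_bounded_linear[OF bounded_linear_scaleR_right] assms)

text \<open>Both sides are weak gradients of the same function, so uniqueness replaces a computation
  with derivatives.\<close>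

lemma abs_l2_test_grad_lincomb:
  assumes "v \<in> test_functions" "w \<in> test_functions"
  shows "abs_l2 (test_grad (\<lambda>x. s *\<^sub>R v x + t *\<^sub>R w x)) =
    s *\<^sub>R abs_l2 (test_grad v) + t *\<^sub>R abs_l2 (test_grad w)"
proof -
  note L = test_grad_L2[OF assms(1)] test_grad_L2[OF assms(2)]
  have "AE x in lebesgue. test_grad (\<lambda>x. s *\<^sub>R v x + t *\<^sub>R w x) x = s *\<^sub>R test_grad v x + t *\<^sub>R test_grad w x"
    by (intro is_weak_gradient_unique[OF is_weak_gradient_test is_weak_gradient_lincomb]
        is_weak_gradient_test test_lincomb assms)
  then have "abs_l2 (test_grad (\<lambda>x. s *\<^sub>R v x + t *\<^sub>R w x)) = abs_l2 (\<lambda>x. s *\<^sub>R test_grad v x + t *\<^sub>R test_grad w x)"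
    by (subst abs_l2_eq_iff) (auto intro!: test_grad_L2 test_lincomb assms L2_add L2_scaleR L)
  then show ?thesis by (simp add: abs_l2_add abs_l2_scaleR L2_scaleR L)
qed

lemma test_zero: "(\<lambda>x. 0) \<in> test_functions"
  by (rule test_functionsI[OF smooth_const, of 0]) simp

lemma subspace_test_gradients: "subspace test_gradients"
proof (rule subspaceI)
  have "abs_l2 (test_grad (\<lambda>x. 0 *\<^sub>R 0 + 0 *\<^sub>R 0)) = 0"
    using abs_l2_test_grad_lincomb[OF test_zero test_zero, of 0 0] by simp
  then show "0 \<in> test_gradients"
    unfolding test_gradients_def using test_zero by force
  fix p q :: "(real^'a, real^'a^'b) l2" and c :: real assume "p \<in> test_gradients"
  then obtain v where v: "v \<in> test_functions" "p = abs_l2 (test_grad v)" by (auto simp: test_gradients_def)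
  have "c *\<^sub>R p = abs_l2 (test_grad (\<lambda>x. c *\<^sub>R v x + 0 *\<^sub>R v x))"
    unfolding abs_l2_test_grad_lincomb[OF v(1) v(1)] by (simp add: v)
  then show "c *\<^sub>R p \<in> test_gradients"
    unfolding test_gradients_def using test_lincomb[OF v(1) v(1)] by blast
  assume "q \<in> test_gradients"
  then obtain w where w: "w \<in> test_functions" "q = abs_l2 (test_grad w)" by (auto simp: test_gradients_def)
  have "p + q = abs_l2 (test_grad (\<lambda>x. 1 *\<^sub>R v x + 1 *\<^sub>R w x))"
    unfolding abs_l2_test_grad_lincomb[OF v(1) w(1)] by (simp add: v w)
  then show "p + q \<in> test_gradients"
    unfolding test_gradients_def using test_lincomb[OF v(1) w(1)] by blast
qed

lemma subspace_closure:
  fixes S :: "'h::real_normed_vector set"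
  assumes "subspace S" shows "subspace (closure S)"
proof (rule subspaceI)
  show "0 \<in> closure S" by (rule subsetD[OF closure_subset subspace_0[OF assms]])
  fix x y :: 'h and c :: real assume "x \<in> closure S"
  then obtain f where f: "\<And>n. f n \<in> S" "f \<longlonglongrightarrow> x" by (auto simp: closure_sequential)
  have "(\<lambda>n. c *\<^sub>R f n) \<longlonglongrightarrow> c *\<^sub>R x" by (intro tendsto_intros f)
  moreover have "c *\<^sub>R f n \<in> S" for n using f(1) by (rule subspace_scale[OF assms])
  ultimately show "c *\<^sub>R x \<in> closure S"
    unfolding closure_sequential by (intro exI[of _ "\<lambda>n. c *\<^sub>R f n"]) simp
  assume "y \<in> closure S"
  then obtain g where g: "\<And>n. g n \<in> S" "g \<longlonglongrightarrow> y" by (auto simp: closure_sequential)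
  have "(\<lambda>n. f n + g n) \<longlonglongrightarrow> x + y" by (intro tendsto_intros f g)
  moreover have "f n + g n \<in> S" for n using f(1) g(1) by (rule subspace_add[OF assms])
  ultimately show "x + y \<in> closure S"
    unfolding closure_sequential by (intro exI[of _ "\<lambda>n. f n + g n"]) simp
qed

text \<open>Taking a row does not increase the norm, so the rows converge as well. The scalar limit
  lemma is applied to each, and the functions found are assembled into a vector.\<close>

lemma closure_test_gradients_imp_l2_grad:
  fixes p :: "(real^'d::finite, real^'d^'m::finite) l2"
  assumes "p \<in> closure test_gradients"
  obtains U where "U \<in> H1_dot" "l2_grad U = p"
proof -
  obtain q where q: "\<And>n. q n \<in> test_gradients" "q \<longlonglongrightarrow> p" using assms by (auto simp: closure_sequential)
  then obtain v where v: "\<And>n. v n \<in> test_functions" "\<And>n. q n = abs_l2 (test_grad (v n))"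
    unfolding test_gradients_def image_iff by metis
  define G where "G = rep_l2 p"
  have G: "G \<in> L2" "abs_l2 G = p" by (simp_all add: G_def rep_l2_in_L2 abs_rep_l2)
  have "\<exists>w. w \<in> L2_loc \<and> weak_grad w (\<lambda>x. G x $ i)" for i
  proof -
    have "(\<lambda>n. abs_l2 (grad (\<lambda>x. v n x $ i)) - abs_l2 (\<lambda>x. G x $ i)) \<longlonglongrightarrow> 0"
    proof (rule Lim_null_comparison[OF always_eventually])
      show "(\<lambda>n. norm (q n - p)) \<longlonglongrightarrow> 0" using q(2) by (simp add: LIM_zero tendsto_norm_zero)
      show "\<forall>n. norm (abs_l2 (grad (\<lambda>x. v n x $ i)) - abs_l2 (\<lambda>x. G x $ i)) \<le> norm (q n - p)"
      proof
        fix n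
        define D where "D x = test_grad (v n) x - G x" for x
        have D: "D \<in> L2" unfolding D_def by (intro L2_diff test_grad_L2 v G)
        have "abs_l2 (grad (\<lambda>x. v n x $ i)) - abs_l2 (\<lambda>x. G x $ i) = abs_l2 (\<lambda>x. D x $ i)"
          by (subst abs_l2_diff[symmetric]) (simp_all add: grad_test_L2 test_vec_nth v L2_vec_nth G D_def test_grad_def)
        moreover have "q n - p = abs_l2 D"
          unfolding v(2) G(2)[symmetric] D_def by (rule abs_l2_diff[symmetric, OF test_grad_L2[OF v(1)] G(1)])
        moreover have "(norm (abs_l2 (\<lambda>x. D x $ i)))\<^sup>2 \<le> (norm (abs_l2 D))\<^sup>2"
          unfolding norm_power2_abs_l2[OF D] norm_power2_abs_l2[OF L2_vec_nth[OF D]]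
          by (intro integral_mono L2_integrable L2_vec_nth D) (simp add: Finite_Cartesian_Product.norm_nth_le power_mono)
        ultimately show "norm (abs_l2 (grad (\<lambda>x. v n x $ i)) - abs_l2 (\<lambda>x. G x $ i)) \<le> norm (q n - p)"
          using power2_le_imp_le norm_ge_zero by metis
      qed
    qed
    then have "(\<lambda>n. abs_l2 (grad (\<lambda>x. v n x $ i))) \<longlonglongrightarrow> abs_l2 (\<lambda>x. G x $ i)"
      by (simp only: LIM_zero_iff)
    from weak_grad_limit[OF test_vec_nth[OF v(1)] L2_vec_nth[OF G(1)] this] show ?thesis by blast
  qed
  then obtain w where w: "\<And>i. w i \<in> L2_loc" "\<And>i. weak_grad (w i) (\<lambda>x. G x $ i)" by metis
  define u where "u x = (\<chi> i. w i x)" for x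
  have u: "u \<in> L2_loc" unfolding u_def by (rule L2_loc_vec_lambda[OF w(1)])
  have uG: "is_weak_gradient u G"
    unfolding is_weak_gradient_iff using L2_loc_L1_loc[OF u] L2_L1_loc[OF G(1)] w(2) by (simp add: u_def)
  show ?thesis
    using that[OF H1_dotI[OF u uG G(1)]] l2_grad_eq[OF uG G(1)] G(2) by simp
qed

text \<open>The component of a gradient orthogonal to all test gradients is itself a gradient, and by
  Liouville's theorem it vanishes.\<close>

lemma l2_grad_in_closure:
  fixes U :: "(real^'d::finite \<Rightarrow> real^'m::finite) set"
  assumes "U \<in> H1_dot"
  shows "l2_grad U \<in> closure test_gradients"
proof -
  obtain p where p: "p \<in> closure test_gradients"
    "\<And>q. q \<in> closure test_gradients \<Longrightarrow> (l2_grad U - p) \<bullet> q = 0"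
    using closed_subspace_projection[OF subspace_closure[OF subspace_test_gradients] closed_closure] by metis
  obtain V where V: "V \<in> H1_dot" "l2_grad V = p" using closure_test_gradients_imp_l2_grad[OF p(1)] by blast
  obtain u G where u: "U = const_class u" "u \<in> L2_loc" "is_weak_gradient u G" "G \<in> L2"
    using H1_dotE[OF assms] by blast
  obtain v H where v: "V = const_class v" "v \<in> L2_loc" "is_weak_gradient v H" "H \<in> L2"
    using H1_dotE[OF V(1)] by blast
  define D where "D x = 1 *\<^sub>R G x + (- 1) *\<^sub>R H x" for x
  define d where "d x = 1 *\<^sub>R u x + (- 1) *\<^sub>R v x" for x
  have dD: "is_weak_gradient d D" unfolding d_def D_def by (rule is_weak_gradient_lincomb[OF u(3) v(3)])
  have DL: "D \<in> L2" using L2_diff[OF u(4) v(4)] by (simp add: D_def[abs_def])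
  have "l2_grad U - p = abs_l2 D"
    unfolding V(2)[symmetric] u(1) v(1) l2_grad_eq[OF u(3,4)] l2_grad_eq[OF v(3,4)]
    using abs_l2_diff[OF u(4) v(4)] by (simp add: D_def[abs_def])
  then have orth: "abs_l2 D \<bullet> q = 0" if "q \<in> closure test_gradients" for q using p(2)[OF that] by simp
  have "AE x in lebesgue. D x $ i = 0" for i
  proof (rule Liouville)
    show "(\<lambda>x. d x $ i) \<in> L1_loc" "weak_grad (\<lambda>x. d x $ i) (\<lambda>x. D x $ i)"
      using dD by (auto simp: is_weak_gradient_iff L1_loc_vec_nth)
    show "(\<lambda>x. D x $ i) \<in> L2" by (rule L2_vec_nth[OF DL])
    fix \<phi> :: "real^'d \<Rightarrow> real" assume \<phi>: "\<phi> \<in> test_functions"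
    \<comment> \<open>A test function in the i-th component alone, so that its gradient meets only
      row i of D.\<close>
    define e where "e x = \<phi> x *\<^sub>R (axis i 1 :: real^'m)" for x
    have e: "e \<in> test_functions"
      unfolding e_def by (rule test_bounded_linear[OF bounded_linear_scaleR_left \<phi>])
    have ei: "(\<lambda>y. e y $ j) = (if j = i then \<phi> else (\<lambda>y. 0))" for j
      by (intro ext) (simp add: e_def axis_def)
    have ge: "D x \<bullet> test_grad e x = D x $ i \<bullet> grad \<phi> x" for x
    proof -
      have "D x \<bullet> test_grad e x = (\<Sum>j\<in>UNIV. D x $ j \<bullet> grad (if j = i then \<phi> else (\<lambda>y. 0)) x)"
        by (simp add: inner_vec_def test_grad_def ei)
      also have "\<dots> = (\<Sum>j\<in>UNIV. if j = i then D x $ j \<bullet> grad \<phi> x else 0)"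
        by (intro sum.cong refl) (simp add: grad_def frechet_derivative_const)
      finally show ?thesis by simp
    qed
    have "abs_l2 (test_grad e) \<in> closure test_gradients"
      by (rule subsetD[OF closure_subset]) (simp add: test_gradients_def e)
    from orth[OF this] have "(\<integral>x. D x \<bullet> test_grad e x \<partial>lebesgue) = 0"
      by (simp add: inner_abs_l2 DL test_grad_L2 e)
    then show "(\<integral>x. D x $ i \<bullet> grad \<phi> x \<partial>lebesgue) = 0" by (simp add: ge)
  qed
  then have "AE x in lebesgue. \<forall>i. D x $ i = 0" by (simp add: AE_all_countable)
  then have "AE x in lebesgue. D x = 0" by eventually_elim (simp add: vec_eq_iff)
  then have "abs_l2 D = 0" by (simp add: abs_l2_zero[symmetric] abs_l2_eq_iff DL L2_zero)
  with \<open>l2_grad U - p = abs_l2 D\<close> p(1) show ?thesis by simp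
qed

text \<open>Functions with the same weak gradient differ by a constant, which is what the classes
  divide out; this makes the solution unique.\<close>

lemma l2_grad_inj:
  assumes "U \<in> H1_dot" "V \<in> H1_dot" "l2_grad U = l2_grad V"
  shows "U = V"
proof -
  obtain u G where u: "U = const_class u" "u \<in> L2_loc" "is_weak_gradient u G" "G \<in> L2"
    using H1_dotE[OF assms(1)] by blast
  obtain v H where v: "V = const_class v" "v \<in> L2_loc" "is_weak_gradient v H" "H \<in> L2"
    using H1_dotE[OF assms(2)] by blast
  have "abs_l2 G = abs_l2 H"
    using assms(3) l2_grad_eq[OF u(3,4)] l2_grad_eq[OF v(3,4)] by (simp add: u v)
  then have "AE x in lebesgue. G x = H x" by (simp add: abs_l2_eq_iff u v)
  then show ?thesis using const_class_eqI_gradients_eq[OF u(3) v(3)] by (simp add: u v)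
qed

lemma class_gradient_in_L2: "U \<in> H1_dot \<Longrightarrow> class_gradient U \<in> L2"
  by (metis H1_dotE class_gradient_L2)

lemma H1_dot_norm_eq: "U \<in> H1_dot \<Longrightarrow> H1_dot_norm U = norm (l2_grad U)"
  by (simp add: H1_dot_norm_def l2_grad_def norm_abs_l2 class_gradient_in_L2)

lemma l2_grad_lincomb:
  assumes "const_class u \<in> H1_dot" "const_class w \<in> H1_dot"
  shows "const_class (\<lambda>x. s *\<^sub>R u x + t *\<^sub>R w x) \<in> H1_dot" (is ?A)
    and "l2_grad (const_class (\<lambda>x. s *\<^sub>R u x + t *\<^sub>R w x)) =
      s *\<^sub>R l2_grad (const_class u) + t *\<^sub>R l2_grad (const_class w)" (is ?B)
proof -
  obtain G where u: "u \<in> L2_loc" "is_weak_gradient u G" "G \<in> L2"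
    using const_class_H1_dotE[OF assms(1)] by blast
  obtain H where w: "w \<in> L2_loc" "is_weak_gradient w H" "H \<in> L2"
    using const_class_H1_dotE[OF assms(2)] by blast
  note g = is_weak_gradient_lincomb[OF u(2) w(2), of s t]
  have L: "(\<lambda>x. s *\<^sub>R G x + t *\<^sub>R H x) \<in> L2" by (intro L2_add L2_scaleR u w)
  show ?A by (rule H1_dotI[OF L2_loc_lincomb[OF u(1) w(1)] g L])
  show ?B
    unfolding l2_grad_eq[OF g L] l2_grad_eq[OF u(2,3)] l2_grad_eq[OF w(2,3)]
    by (simp add: abs_l2_add abs_l2_scaleR L2_scaleR u w)
qed

section \<open>The right-hand side\<close>

text \<open>The description in \<open>functional_of\<close> is resolved here: minus the inner
  product of g with the gradient is a bounded extension, and density of test gradients excludes any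
  other.\<close>

lemma functional_of_test:
  fixes f :: "real^'d::finite \<Rightarrow> real^'m::finite" and g :: "real^'d \<Rightarrow> real^'d^'m"
  assumes f: "f \<in> L1_loc" and g: "g \<in> L2" and div: "is_weak_divergence f g"
    and v: "v \<in> test_functions"
  shows "functional_of f (const_class v) = - (abs_l2 g \<bullet> abs_l2 (test_grad v))"
proof -
  have div_test: "(\<integral>x. f x \<bullet> v x \<partial>lebesgue) = - (abs_l2 g \<bullet> abs_l2 (test_grad v))"
    if v: "v \<in> test_functions" for v
  proof -
    note vi = test_vec_nth[OF v]
    have i1: "integrable lebesgue (\<lambda>x. f x $ i * v x $ i)" for i
      by (rule L1_loc_integrable_test[OF L1_loc_vec_nth[OF f] vi])
    have i2: "integrable lebesgue (\<lambda>x. g x $ i \<bullet> grad (\<lambda>y. v y $ i) x)" for i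
      by (rule L2_integrable_inner[OF L2_vec_nth[OF g] grad_test_L2[OF vi]])
    have "(\<integral>x. f x \<bullet> v x \<partial>lebesgue) = (\<Sum>i\<in>UNIV. \<integral>x. f x $ i * v x $ i \<partial>lebesgue)"
      by (simp add: inner_vec_def i1)
    also have "\<dots> = (\<Sum>i\<in>UNIV. - (\<integral>x. g x $ i \<bullet> grad (\<lambda>y. v y $ i) x \<partial>lebesgue))"
    proof (rule sum.cong[OF refl])
      fix i
      have "grad (\<lambda>y. v y $ i) x $ \<alpha> = partial_deriv \<alpha> (\<lambda>y. v y $ i) x" for x \<alpha>
        using grad_component[of "axis \<alpha> 1" "\<lambda>y. v y $ i" x]
        by (simp add: partial_deriv_def cart_eq_inner_axis axis_in_Basis_iff)
      then show "(\<integral>x. f x $ i * v x $ i \<partial>lebesgue) = - (\<integral>x. g x $ i \<bullet> grad (\<lambda>y. v y $ i) x \<partial>lebesgue)"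
        using div vi[of i] by (simp add: is_weak_divergence_def inner_vec_def)
    qed
    also have "\<dots> = - (\<integral>x. g x \<bullet> test_grad v x \<partial>lebesgue)"
      by (simp add: inner_vec_def[of "g _"] test_grad_def i2 sum_negf)
    finally show ?thesis by (simp add: inner_abs_l2 g test_grad_L2 v)
  qed
  \<comment> \<open>The value \<open>undefined\<close> outside \<open>H1_dot\<close> is the one that
    membership in \<open>extensional\<close> prescribes.\<close>
  define L where "L U = (if U \<in> H1_dot then - (abs_l2 g \<bullet> l2_grad U) else undefined)"
    for U :: "(real^'d \<Rightarrow> real^'m) set"
  define P where "P L \<longleftrightarrow> L \<in> extensional H1_dot \<and> bounded_linear_functional L \<and>
     (\<forall>V\<in>D_dot. \<forall>v\<in>V \<inter> test_functions. L V = (\<integral>x. f x \<bullet> v x \<partial>lebesgue))"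
    for L :: "(real^'d \<Rightarrow> real^'m) set \<Rightarrow> real"
  have "P L"
    unfolding P_def
  proof (intro conjI)
    show "L \<in> extensional H1_dot" by (simp add: extensional_def L_def)
    show "bounded_linear_functional L"
      unfolding bounded_linear_functional_def
    proof (intro conjI allI impI)
      fix u w :: "real^'d \<Rightarrow> real^'m" and r :: real assume u: "const_class u \<in> H1_dot"
      show "L (const_class (\<lambda>x. r *\<^sub>R u x)) = r * L (const_class u)"
        using l2_grad_lincomb[OF u u, of r 0] u by (simp add: L_def)
      assume w: "const_class w \<in> H1_dot"
      show "L (const_class (\<lambda>x. u x + w x)) = L (const_class u) + L (const_class w)"
        using l2_grad_lincomb[OF u w, of 1 1] u w by (simp add: L_def inner_add_right)
    next
      show "\<exists>M. \<forall>U\<in>H1_dot. \<bar>L U\<bar> \<le> M * H1_dot_norm U"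
        by (rule exI[of _ "norm (abs_l2 g)"]) (simp add: L_def H1_dot_norm_eq Cauchy_Schwarz_ineq2)
    qed
    show "\<forall>V\<in>D_dot. \<forall>v\<in>V \<inter> test_functions. L V = (\<integral>x. f x \<bullet> v x \<partial>lebesgue)"
    proof (intro ballI)
      fix V :: "(real^'d \<Rightarrow> real^'m) set" and v assume "V \<in> D_dot" "v \<in> V \<inter> test_functions"
      then have "V = const_class v" and v: "v \<in> test_functions"
        using const_class_eq_iff by (auto simp: D_dot_def)
      then show "L V = (\<integral>x. f x \<bullet> v x \<partial>lebesgue)"
        by (simp add: div_test L_def const_class_test_H1_dot l2_grad_test)
    qed
  qed
  moreover have "L' = L" if P': "P L'" for L'
  proof (rule extensionalityI)
    show "L' \<in> extensional H1_dot" "L \<in> extensional H1_dot" using P' \<open>P L\<close> by (auto simp: P_def)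
    fix U :: "(real^'d \<Rightarrow> real^'m) set" assume U: "U \<in> H1_dot"
    then obtain u where u: "U = const_class u" using H1_dotE by metis
    note uH = U[unfolded u]
    obtain q where q: "\<And>n. q n \<in> test_gradients" "q \<longlonglongrightarrow> l2_grad U"
      using l2_grad_in_closure[OF U] by (auto simp: closure_sequential)
    then obtain v where v: "\<And>n. v n \<in> test_functions" "\<And>n. q n = abs_l2 (test_grad (v n))"
      unfolding test_gradients_def image_iff by metis
    \<comment> \<open>Every bounded functional is continuous along test functions whose gradients
      approach that of U; applied to both candidates this forces them to agree.\<close>
    have lim: "(\<lambda>n. K (const_class (v n))) \<longlonglongrightarrow> K U" if K: "bounded_linear_functional K" for K
    proof -
      obtain M where M: "\<And>U. U \<in> H1_dot \<Longrightarrow> \<bar>K U\<bar> \<le> M * H1_dot_norm U"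
        using K unfolding bounded_linear_functional_def by blast
      have bd: "norm (K (const_class (v n)) - K U) \<le> \<bar>M\<bar> * norm (q n - l2_grad U)" for n
      proof -
        note vH = const_class_test_H1_dot[OF v(1)[of n]]
        \<comment> \<open>Linearity is stated for representatives, so the difference of classes is
          formed as the class of v n - u.\<close>
        define w where "w x = 1 *\<^sub>R v n x + (- 1) *\<^sub>R u x" for x
        have wH: "const_class w \<in> H1_dot" and wl: "l2_grad (const_class w) = q n - l2_grad U"
          using l2_grad_lincomb[OF vH uH, of 1 "- 1"]
          by (simp_all add: w_def[abs_def] u v(2) l2_grad_test[OF v(1)])
        have "K (const_class (\<lambda>x. w x + u x)) = K (const_class w) + K (const_class u)"
          using K wH uH by (simp add: bounded_linear_functional_def)
        moreover have "(\<lambda>x. w x + u x) = v n" by (simp add: w_def)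
        ultimately have "norm (K (const_class (v n)) - K U) = \<bar>K (const_class w)\<bar>" by (simp add: u)
        also have "\<dots> \<le> M * norm (q n - l2_grad U)"
          using M[OF wH] by (simp add: H1_dot_norm_eq[OF wH] wl)
        \<comment> \<open>Nothing is known about the sign of the bound \<open>M\<close>.\<close>
        also have "\<dots> \<le> \<bar>M\<bar> * norm (q n - l2_grad U)" by (intro mult_right_mono) auto
        finally show ?thesis .
      qed
      have "(\<lambda>n. \<bar>M\<bar> * norm (q n - l2_grad U)) \<longlonglongrightarrow> 0"
        by (intro tendsto_mult_right_zero tendsto_norm_zero LIM_zero q(2))
      with bd have "(\<lambda>n. K (const_class (v n)) - K U) \<longlonglongrightarrow> 0"
        by (rule Lim_null_comparison[OF always_eventually[OF allI]])
      then show ?thesis by (simp only: LIM_zero_iff)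
    qed
    have "L' (const_class (v n)) = L (const_class (v n))" for n
    proof -
      have "K (const_class (v n)) = (\<integral>x. f x \<bullet> v n x \<partial>lebesgue)" if "P K" for K
        using that v(1)[of n] const_class_refl[of "v n"] by (simp add: P_def D_dot_def)
      from this[OF P'] this[OF \<open>P L\<close>] show ?thesis by (rule trans[OF _ sym])
    qed
    then have "(\<lambda>n. L (const_class (v n))) \<longlonglongrightarrow> L' U"
      using lim[of L'] P' by (simp add: P_def)
    moreover have "(\<lambda>n. L (const_class (v n))) \<longlonglongrightarrow> L U"
      using lim[of L] \<open>P L\<close> by (simp add: P_def)
    ultimately show "L' U = L U" by (rule LIMSEQ_unique)
  qed
  ultimately have "functional_of f = L"
    unfolding functional_of_def P_def[symmetric] by (rule the_equality)
  then show ?thesis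
    by (simp add: L_def const_class_test_H1_dot l2_grad_test v)
qed

section \<open>The bilinear form\<close>

text \<open>The coefficient tensor contracted in its lower pair of indices, so that the integrand of
  the bilinear form is an inner product with the second gradient.\<close>

definition coeff_apply ::
  "real^'d^'m^'d^'m \<Rightarrow> real^'d^'m \<Rightarrow> real^'d::finite^'m::finite" where
  "coeff_apply c P = (\<chi> j \<beta>. \<Sum>i\<in>UNIV. \<Sum>\<alpha>\<in>UNIV. c $ i $ \<alpha> $ j $ \<beta> * P $ i $ \<alpha>)"

lemma coeff_apply_inner:
  "coeff_apply c P \<bullet> Q = (\<Sum>i\<in>UNIV. \<Sum>\<alpha>\<in>UNIV. \<Sum>j\<in>UNIV. \<Sum>\<beta>\<in>UNIV.
     c $ i $ \<alpha> $ j $ \<beta> * P $ i $ \<alpha> * Q $ j $ \<beta>)"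
proof -
  have "coeff_apply c P \<bullet> Q = (\<Sum>j\<in>UNIV. \<Sum>\<beta>\<in>UNIV. \<Sum>i\<in>UNIV. \<Sum>\<alpha>\<in>UNIV.
      c $ i $ \<alpha> $ j $ \<beta> * P $ i $ \<alpha> * Q $ j $ \<beta>)"
    by (simp add: inner_vec_def coeff_apply_def sum_distrib_right)
  also have "\<dots> = (\<Sum>j\<in>UNIV. \<Sum>i\<in>UNIV. \<Sum>\<beta>\<in>UNIV. \<Sum>\<alpha>\<in>UNIV.
      c $ i $ \<alpha> $ j $ \<beta> * P $ i $ \<alpha> * Q $ j $ \<beta>)"
    by (intro sum.cong refl sum.swap)
  also have "\<dots> = (\<Sum>i\<in>UNIV. \<Sum>j\<in>UNIV. \<Sum>\<beta>\<in>UNIV. \<Sum>\<alpha>\<in>UNIV.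
      c $ i $ \<alpha> $ j $ \<beta> * P $ i $ \<alpha> * Q $ j $ \<beta>)"
    by (rule sum.swap)
  also have "\<dots> = (\<Sum>i\<in>UNIV. \<Sum>j\<in>UNIV. \<Sum>\<alpha>\<in>UNIV. \<Sum>\<beta>\<in>UNIV.
      c $ i $ \<alpha> $ j $ \<beta> * P $ i $ \<alpha> * Q $ j $ \<beta>)"
    by (intro sum.cong refl sum.swap)
  also have "\<dots> = (\<Sum>i\<in>UNIV. \<Sum>\<alpha>\<in>UNIV. \<Sum>j\<in>UNIV. \<Sum>\<beta>\<in>UNIV.
      c $ i $ \<alpha> $ j $ \<beta> * P $ i $ \<alpha> * Q $ j $ \<beta>)"
    by (intro sum.cong refl sum.swap)
  finally show ?thesis .
qed

lemma norm_vec_le: "(\<And>i. norm (x $ i) \<le> B) \<Longrightarrow> norm (x :: 'b::real_normed_vector^'n::finite) \<le> real CARD('n) * B"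
  unfolding norm_vec_def using L2_set_le_sum[of UNIV "\<lambda>i. norm (x $ i)"] sum_bounded_above[of UNIV "\<lambda>i. norm (x $ i)" B]
  by (auto intro: order_trans)

text \<open>One factor m d counts the summands of an entry, the other comes from bounding the norm
  of a matrix by its m d entries through \<open>norm_vec_le\<close>.\<close>

lemma norm_coeff_apply_le:
  fixes c :: "real^'d::finite^'m::finite^'d^'m"
  shows "norm (coeff_apply c P) \<le> (real CARD('m) * real CARD('d))\<^sup>2 * norm c * norm P"
proof -
  have "norm (coeff_apply c P $ j $ \<beta>) \<le> real CARD('m) * (real CARD('d) * (norm c * norm P))" for j \<beta>
  proof -
    have "norm (coeff_apply c P $ j $ \<beta>) \<le> (\<Sum>i\<in>(UNIV::'m set). \<Sum>\<alpha>\<in>(UNIV::'d set). norm c * norm P)"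
      unfolding coeff_apply_def vec_lambda_beta
    proof (intro order_trans[OF norm_sum] sum_mono)
      fix i \<alpha>
      have "norm (c $ i $ \<alpha> $ j $ \<beta>) \<le> norm c" "norm (P $ i $ \<alpha>) \<le> norm P"
        by (meson Finite_Cartesian_Product.norm_nth_le order_trans)+
      then show "norm (c $ i $ \<alpha> $ j $ \<beta> * P $ i $ \<alpha>) \<le> norm c * norm P"
        unfolding norm_mult by (intro mult_mono) auto
    qed
    then show ?thesis by simp
  qed
  then have "norm (coeff_apply c P) \<le> real CARD('m) * (real CARD('d) * (real CARD('m) * (real CARD('d) * (norm c * norm P))))"
    by (intro norm_vec_le)
  then show ?thesis by (simp add: power2_eq_square mult_ac)
qed

lemma coeff_apply_L2:
  fixes C :: "real^'d::finite \<Rightarrow> real^'d^'m::finite^'d^'m"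
  assumes C: "C \<in> borel_measurable lebesgue" "AE x in lebesgue. norm (C x) \<le> K" and P: "P \<in> L2"
  shows "(\<lambda>x. coeff_apply (C x) (P x)) \<in> L2"
    and "norm (abs_l2 (\<lambda>x. coeff_apply (C x) (P x))) \<le> (real CARD('m) * real CARD('d))\<^sup>2 * \<bar>K\<bar> * norm (abs_l2 P)"
proof -
  \<comment> \<open>The absolute value spares an argument that an almost everywhere bound of norms
    is nonnegative.\<close>
  define B where "B = (real CARD('m) * real CARD('d))\<^sup>2 * \<bar>K\<bar>"
  have B0: "B \<ge> 0" by (simp add: B_def)
  have le: "AE x in lebesgue. (norm (coeff_apply (C x) (P x)))\<^sup>2 \<le> B\<^sup>2 * (norm (P x))\<^sup>2"
    using C(2)
  proof eventually_elim
    case (elim x)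
    have "norm (coeff_apply (C x) (P x)) \<le> (real CARD('m) * real CARD('d))\<^sup>2 * norm (C x) * norm (P x)"
      by (rule norm_coeff_apply_le)
    also have "\<dots> \<le> B * norm (P x)"
      unfolding B_def using elim by (intro mult_right_mono mult_left_mono) auto
    finally show ?case using power_mono[of "norm (coeff_apply (C x) (P x))" "B * norm (P x)" 2]
      by (simp add: power_mult_distrib)
  qed
  have m: "(\<lambda>x. coeff_apply (C x) (P x)) \<in> borel_measurable lebesgue"
    unfolding coeff_apply_def
    by (intro vec_lambda_measurable borel_measurable_sum borel_measurable_times vec_nth_measurable C(1) L2_measurable P)
  have i: "integrable lebesgue (\<lambda>x. B\<^sup>2 * (norm (P x))\<^sup>2)" using L2_integrable[OF P] by simp
  show L: "(\<lambda>x. coeff_apply (C x) (P x)) \<in> L2" by (rule L2_I[OF m i le])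
  have "(norm (abs_l2 (\<lambda>x. coeff_apply (C x) (P x))))\<^sup>2 \<le> (\<integral>x. B\<^sup>2 * (norm (P x))\<^sup>2 \<partial>lebesgue)"
    unfolding norm_power2_abs_l2[OF L] by (rule integral_mono_AE[OF L2_integrable[OF L] i le])
  also have "\<dots> = (B * norm (abs_l2 P))\<^sup>2"
    by (simp add: norm_power2_abs_l2[OF P] power_mult_distrib)
  finally show "norm (abs_l2 (\<lambda>x. coeff_apply (C x) (P x))) \<le> (real CARD('m) * real CARD('d))\<^sup>2 * \<bar>K\<bar> * norm (abs_l2 P)"
    unfolding B_def[symmetric] by (rule power2_le_imp_le) (simp add: B0)
qed

text \<open>Pointwise application of the coefficients acts on all of \<open>L2\<close> and in
  general leads out of the gradients, which is why \<open>Lax_Milgram\<close> projects back onto the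
  subspace.\<close>

lemma bilinear_form_operator:
  fixes C :: "real^'d::finite \<Rightarrow> real^'d^'m::finite^'d^'m"
  assumes C: "C \<in> L_infinity"
  obtains A :: "(real^'d, real^'d^'m) l2 \<Rightarrow> (real^'d, real^'d^'m) l2" where "bounded_linear A"
    "\<And>U V. U \<in> H1_dot \<Longrightarrow> V \<in> H1_dot \<Longrightarrow> bilinear_form C U V = A (l2_grad U) \<bullet> l2_grad V"
proof -
  obtain K where C': "C \<in> borel_measurable lebesgue" "AE x in lebesgue. norm (C x) \<le> K"
    using C by (auto simp: L_infinity_def)
  note CL = coeff_apply_L2[OF C']
  define A where "A p = abs_l2 (\<lambda>x. coeff_apply (C x) (rep_l2 p x))" for p :: "(real^'d, real^'d^'m) l2"
  \<comment> \<open>Independence of the representative chosen by \<open>rep_l2\<close>; linearity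
    and boundedness are then read off on functions.\<close>
  have A_abs: "A (abs_l2 P) = abs_l2 (\<lambda>x. coeff_apply (C x) (P x))" if P: "P \<in> L2" for P
  proof -
    have "AE x in lebesgue. coeff_apply (C x) (rep_l2 (abs_l2 P) x) = coeff_apply (C x) (P x)"
      using rep_abs_l2[OF P] by eventually_elim simp
    then show ?thesis by (simp add: A_def abs_l2_eq_iff CL rep_l2_in_L2 P)
  qed
  have "bounded_linear A"
  proof (rule bounded_linear_intro)
    fix p q :: "(real^'d, real^'d^'m) l2" and r :: real
    define P where "P = rep_l2 p"
    define Q where "Q = rep_l2 q"
    have PQ: "P \<in> L2" "Q \<in> L2" "p = abs_l2 P" "q = abs_l2 Q"
      by (simp_all add: P_def Q_def rep_l2_in_L2 abs_rep_l2)
    have "coeff_apply (C x) (P x + Q x) = coeff_apply (C x) (P x) + coeff_apply (C x) (Q x)" for x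
      by (simp add: coeff_apply_def vec_eq_iff distrib_left sum.distrib)
    then show "A (p + q) = A p + A q"
      using abs_l2_add[OF CL(1)[OF PQ(1)] CL(1)[OF PQ(2)]]
      by (simp add: PQ(3,4) abs_l2_add[OF PQ(1,2), symmetric] A_abs[OF L2_add[OF PQ(1,2)]] A_abs[OF PQ(1)] A_abs[OF PQ(2)])
    have "coeff_apply (C x) (r *\<^sub>R P x) = r *\<^sub>R coeff_apply (C x) (P x)" for x
      by (simp add: coeff_apply_def vec_eq_iff sum_distrib_left mult_ac)
    then show "A (r *\<^sub>R p) = r *\<^sub>R A p"
      using abs_l2_scaleR[OF CL(1)[OF PQ(1)], of r]
      by (simp add: PQ(3) abs_l2_scaleR[OF PQ(1), symmetric] A_abs[OF L2_scaleR[OF PQ(1)]] A_abs[OF PQ(1)])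
    show "norm (A p) \<le> norm p * ((real CARD('m) * real CARD('d))\<^sup>2 * \<bar>K\<bar>)"
      unfolding PQ(3) A_abs[OF PQ(1)] using CL(2)[OF PQ(1)] by (simp add: mult.commute)
  qed
  moreover have "bilinear_form C U V = A (l2_grad U) \<bullet> l2_grad V" if "U \<in> H1_dot" "V \<in> H1_dot" for U V
    using that by (simp add: l2_grad_def A_abs inner_abs_l2 CL class_gradient_in_L2 bilinear_form_def coeff_apply_inner)
  ultimately show ?thesis by (rule that)
qed

theorem theorem5:
  fixes C :: "real^'d::finite \<Rightarrow> real^'d^'m^'d^'m::finite"
    and f :: "real^'d \<Rightarrow> real^'m"
    and g :: "real^'d \<Rightarrow> real^'d^'m"
  assumes "C \<in> L_infinity"
    and "f \<in> L1_loc"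
    and "g \<in> L2"
    and "is_weak_divergence f g"
    and "coercive_form (bilinear_form C)"
  shows "\<exists>!U. U \<in> H1_dot \<and>
    (\<forall>v\<in>test_functions. bilinear_form C U (const_class v) = functional_of f (const_class v))"
proof -
  define S :: "(real^'d, real^'d^'m) l2 set" where "S = closure test_gradients"
  have gS: "test_gradients \<subseteq> S" unfolding S_def by (rule closure_subset)
  have S: "subspace S" "closed S"
    by (auto simp: S_def intro: subspace_closure subspace_test_gradients)
  obtain A :: "(real^'d, real^'d^'m) l2 \<Rightarrow> (real^'d, real^'d^'m) l2" where A: "bounded_linear A"
    "\<And>U V. U \<in> H1_dot \<Longrightarrow> V \<in> H1_dot \<Longrightarrow> bilinear_form C U V = A (l2_grad U) \<bullet> l2_grad V"
    using bilinear_form_operator[OF assms(1)] by metis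
  obtain c where c: "c > 0" "\<And>U. U \<in> H1_dot \<Longrightarrow> bilinear_form C U U \<ge> c * (H1_dot_norm U)\<^sup>2"
    using assms(5) by (auto simp: coercive_form_def)
  \<comment> \<open>The hypothesis speaks of classes in \<open>H1_dot\<close>; it reaches
    \<open>S\<close> because every limit of test gradients is the gradient of such a class.\<close>
  have coercive: "A p \<bullet> p \<ge> c * (norm p)\<^sup>2" if "p \<in> S" for p
  proof -
    obtain U where "U \<in> H1_dot" "l2_grad U = p"
      using closure_test_gradients_imp_l2_grad \<open>p \<in> S\<close> unfolding S_def by metis
    then show ?thesis using c(2)[of U] by (auto simp: A H1_dot_norm_eq)
  qed
  have weak_form: "(\<forall>v\<in>test_functions. bilinear_form C U (const_class v) = functional_of f (const_class v))
      \<longleftrightarrow> (\<forall>q\<in>test_gradients. A (l2_grad U) \<bullet> q = - abs_l2 g \<bullet> q)" if "U \<in> H1_dot" for U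
    using that
    by (simp add: test_gradients_def A const_class_test_H1_dot l2_grad_test
        functional_of_test[OF assms(2-4)])
  obtain p where p: "p \<in> S" "\<And>q. q \<in> S \<Longrightarrow> A p \<bullet> q = - abs_l2 g \<bullet> q"
    using Lax_Milgram[OF A(1) S c(1) coercive] by metis
  obtain U where U: "U \<in> H1_dot" "l2_grad U = p"
    using closure_test_gradients_imp_l2_grad p(1) unfolding S_def by metis
  show ?thesis
  proof (rule ex1I[of _ U])
    show "U \<in> H1_dot \<and>
        (\<forall>v\<in>test_functions. bilinear_form C U (const_class v) = functional_of f (const_class v))"
      using U p(2) gS weak_form[OF U(1)] by auto
    fix V :: "(real^'d \<Rightarrow> real^'m) set"
    assume V: "V \<in> H1_dot \<and>
        (\<forall>v\<in>test_functions. bilinear_form C V (const_class v) = functional_of f (const_class v))"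
    define r where "r = l2_grad V - p"
    interpret A: bounded_linear A by (rule A(1))
    \<comment> \<open>A competing solution V is an arbitrary class, so this needs the density of
      test gradients.\<close>
    have rS: "r \<in> S"
      unfolding r_def using V p(1) S(1) l2_grad_in_closure[of V] by (auto simp: S_def intro: subspace_diff)
    have Ar: "A r \<bullet> q = 0" if "q \<in> test_gradients" for q
    proof -
      have "q \<in> S" using that gS by blast
      then show ?thesis
        using V weak_form[of V] that p(2)[of q] by (simp add: r_def A.diff inner_diff_left)
    qed
    \<comment> \<open>The equation is known against test gradients only. It extends by continuity to
      their limit \<open>r\<close>, and coercivity then gives r = 0.\<close>
    have "A r \<bullet> r = 0"
    proof -
      obtain q where q: "\<And>n. q n \<in> test_gradients" "q \<longlonglongrightarrow> r"
        using rS by (auto simp: S_def closure_sequential)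
      have "(\<lambda>n. A r \<bullet> q n) \<longlonglongrightarrow> A r \<bullet> r" by (intro tendsto_intros q)
      then show ?thesis using LIMSEQ_unique[OF _ tendsto_const[of 0]] by (simp add: Ar q(1))
    qed
    with coercive[OF rS] c(1) have "r = 0" by (simp add: mult_le_0_iff)
    then show "V = U" using l2_grad_inj[of V U] V U by (simp add: r_def)
  qed
qed

end
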